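(* Let $\mathscr{B}$ and $\mathscr{C}$ be closed bicategories equipped with coshadows $\mathrm{Csh}_{\mathscr{B}}$ and $\mathrm{Csh}_{\mathscr{C}}$, let $F:\mathscr{B}\to\mathscr{C}$ (with $F_{\cosh}$ and $\phi$) be a lax coshadow functor, and let $M\in\mathscr{B}(R,S)$ be a right dualizable 1-cell with right dual $M^*$. (1) If the maps $c:F(M)\odot F(M^* )\to F(M\odot M^* )$ and $i:U_{F(S)}\to F(U_S)$ are isomorphisms, then $F(M)$ is right dualizable with right dual $F(M^* )$. (2) Let $Q\in\mathscr{B}(S,S)$ and $P\in\mathscr{B}(R,R)$. If, furthermore, the map $c_{M,Q}:F(M\triangleright Q)\to F(M)\triangleright F(Q)$ is an isomorphism, then for any 2-cell $f:M\triangleright Q\to P\triangleleft M$, $$\phi_P\circ F_{\cosh}(\mathrm{cotr}(f))=\mathrm{cotr}\big(c_{M,P}\circ F(f)\circ c_{M,Q}^{-1}\big)\circ\phi_Q$$ as maps $F_{\cosh}(\mathrm{Csh}_{\mathscr{B}}(Q))\to\mathrm{Csh}_{\mathscr{C}}(F(P))$, where $c_{M,P}$ is the map $F(P\triangleleft M)\to F(P)\triangleleft F(M)$ and the cotrace on the right is taken with respect to $F(M)$.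
   Context: **Bicategories.** $\mathscr{B}(R,S)$ is the category of 1-cells $M:R\to S$ and 2-cells between them. Composition of 1-cells $\odot:\mathscr{B}(R,S)\times\mathscr{B}(S,T)\to\mathscr{B}(R,T)$ is written in diagrammatic order; $U_R$ is the identity 1-cell; $l:U_R\odot M\to M$ and $r:M\odot U_S\to M$ are the unitors for $M:R\to S$. Associators for $\odot$ are suppressed. **Closed bicategory.** A bicategory with functors $-\triangleleft-:\mathscr{B}(R,T)\times\mathscr{B}(R,S)^{\mathrm{op}}\to\mathscr{B}(S,T)$ and $-\triangleright-:\mathscr{B}(S,T)^{\mathrm{op}}\times\mathscr{B}(R,T)\to\mathscr{B}(R,S)$ and natural isomorphisms $\mathscr{B}(S,T)(N,P\triangleleft M)\cong\mathscr{B}(R,T)(M\odot N,P)\cong\mathscr{B}(R,S)(M,N\triangleright P)$ for $M:R\to S$, $N:S\to T$, $P:R\to T$. Corresponding 2-cells are called transposes of each other. The evaluations $\mathrm{ev}:(N\triangleright P)\odot N\to P$ and $\mathrm{ev}:M\odot(P\triangleleft M)\to P$ are the transposes of identities, and the coevaluation $\mathrm{coev}:M\to N\triangleright(M\odot N)$ is the transpose of $\mathrm{id}_{M\odot N}$. For a 2-cell $h$, $h_*$ (resp. $h^*$) is the map induced on hom-objects by covariance in the target (resp. contravariance in the source). **Canonical isomorphisms.** $t:(M\odot N)\triangleright P\to M\triangleright(N\triangleright P)$ is the transpose of the transpose of $\mathrm{ev}:((M\odot N)\triangleright P)\odot M\odot N\to P$; similarly $t:P\triangleleft(M\odot N)\to(P\triangleleft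 M)\triangleleft N$. The isomorphism $a:(N\triangleright P)\triangleleft M\to N\triangleright(P\triangleleft M)$ is the map whose transpose with respect to both $N$ and $M$ is $M\odot((N\triangleright P)\triangleleft M)\odot N\xrightarrow{\mathrm{ev}\odot1}(N\triangleright P)\odot N\xrightarrow{\mathrm{ev}}P$. For $M:R\to S$, $\overline{l}:M\to M\triangleleft U_R$ is the transpose of $l$ and $\overline{r}:M\to U_S\triangleright M$ is the transpose of $r$; both are isomorphisms. **Duality.** $M\in\mathscr{B}(R,S)$ is right dualizable if there are $M^*\in\mathscr{B}(S,R)$ (a right dual) and 2-cells $\eta:U_R\to M\odot M^*$, $\varepsilon:M^*\odot M\to U_S$ with $(1_M\odot\varepsilon)(\eta\odot 1_M)=1_M$ and $(\varepsilon\odot1_{M^*})(1_{M^*}\odot\eta)=1_{M^*}$. **Coshadow.** A coshadow on a closed bicategory with target category $\mathbf{T}$: functors $\mathrm{Csh}:\mathscr{B}(R,R)\to\mathbf{T}$ for each $R$ and natural isomorphisms $\theta:\mathrm{Csh}(M\triangleright N)\to\mathrm{Csh}(N\triangleleft M)$ for $M,N\in\mathscr{B}(R,S)$ (inverses are also denoted $\theta$), such that for $M:R\to S$, $N:S\to T$, $P:R\to T$ the composites $\mathrm{Csh}((M\odot N)\triangleright P)\xrightarrow{\theta}\mathrm{Csh}(P\triangleleft(M\odot N))\xrightarrow{\mathrm{Csh}(t)}\mathrm{Csh}((P\triangleleft M)\triangleleft N)\xrightarrow{\theta}\mathrm{Csh}(N\triangleright(P\triangleleft M))$ and $\mathrm{Csh}((M\odot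 N)\triangleright P)\xrightarrow{\mathrm{Csh}(t)}\mathrm{Csh}(M\triangleright(N\triangleright P))\xrightarrow{\theta}\mathrm{Csh}((N\triangleright P)\triangleleft M)\xrightarrow{\mathrm{Csh}(a)}\mathrm{Csh}(N\triangleright(P\triangleleft M))$ agree, and for $M\in\mathscr{B}(R,R)$, $\mathrm{Csh}(\overline{l}^{-1})\circ\theta=\mathrm{Csh}(\overline{r}^{-1}):\mathrm{Csh}(U_R\triangleright M)\to\mathrm{Csh}(M)$. **Cotrace.** For a dual pair $(M,M^* )$ with $M:R\to S$ and $f:M\triangleright Q\to P\triangleleft M$ with $Q:S\to S$, $P:R\to R$, $\mathrm{cotr}(f):\mathrm{Csh}(Q)\to\mathrm{Csh}(P)$ is the composite of $\mathrm{Csh}$ of the evident maps (and $\theta$): $$Q\xrightarrow{\overline{r}}U_S\triangleright Q\xrightarrow{\varepsilon^*}(M^*\odot M)\triangleright Q\xrightarrow{t}M^*\triangleright(M\triangleright Q)\xrightarrow{f_*}M^*\triangleright(P\triangleleft M),$$ $$\theta:\mathrm{Csh}(M^*\triangleright(P\triangleleft M))\to\mathrm{Csh}((P\triangleleft M)\triangleleft M^* ),$$ $$(P\triangleleft M)\triangleleft M^*\xrightarrow{t^{-1}}P\triangleleft(M\odot M^* )\xrightarrow{\eta^*}P\triangleleft U_R\xrightarrow{\overline{l}^{-1}}P.$$ It does not depend on the choice of $M^*,\eta,\varepsilon$. **Lax closed functor.** The composition map $(Y\triangleright Z)\odot(X\triangleright Y)\to X\triangleright Z$ is the transpose of $(Y\triangleright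 Z)\odot(X\triangleright Y)\odot X\xrightarrow{1\odot\mathrm{ev}}(Y\triangleright Z)\odot Y\xrightarrow{\mathrm{ev}}Z$; its transpose is denoted $\overline{\circ}:Y\triangleright Z\to(X\triangleright Y)\triangleright(X\triangleright Z)$. Similarly one has $\overline{\circ}:Z\triangleleft Y\to(Z\triangleleft X)\triangleleft(Y\triangleleft X)$. A lax closed functor $F:\mathscr{B}\to\mathscr{C}$ consists of a function $F$ on 0-cells, functors $F:\mathscr{B}(R,S)\to\mathscr{C}(F(R),F(S))$, natural transformations $c:F(N\triangleright P)\to F(N)\triangleright F(P)$ and $c:F(P\triangleleft M)\to F(P)\triangleleft F(M)$, and maps $i:U_{F(R)}\to F(U_R)$, such that, whenever these make sense: (a) $F(N\triangleright P)\xrightarrow{F(\overline{\circ})}F((M\triangleright N)\triangleright(M\triangleright P))\xrightarrow{c}F(M\triangleright N)\triangleright F(M\triangleright P)\xrightarrow{c_*}F(M\triangleright N)\triangleright(F(M)\triangleright F(P))$ equals $F(N\triangleright P)\xrightarrow{c}F(N)\triangleright F(P)\xrightarrow{\overline{\circ}}(F(M)\triangleright F(N))\triangleright(F(M)\triangleright F(P))\xrightarrow{c^*}F(M\triangleright N)\triangleright(F(M)\triangleright F(P))$; (b) $U_{F(R)}\xrightarrow{i}F(U_R)\to F(M\triangleright M)\xrightarrow{c}F(M)\triangleright F(M)$ equals the transpose of $l:U_{F(R)}\odot F(M)\to F(M)$, where the middle map is $F$ of the transpose $U_R\to M\triangleright M$ of $l:U_R\odot M\to M$; (c) $F(M)\xrightarrow{F(\overline{r})}F(U_S\triangleright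 M)\xrightarrow{c}F(U_S)\triangleright F(M)\xrightarrow{i^*}U_{F(S)}\triangleright F(M)$ equals $\overline{r}$; (d) the mirror-image versions of (a)–(c) for $\triangleleft$ (in (b) using the transpose $U_S\to M\triangleleft M$ of $r$, in (c) using $\overline{l}$); (e) $F((M\triangleright N)\triangleleft P)\xrightarrow{c}F(M\triangleright N)\triangleleft F(P)\xrightarrow{c_*}(F(M)\triangleright F(N))\triangleleft F(P)\xrightarrow{a}F(M)\triangleright(F(N)\triangleleft F(P))$ equals $F((M\triangleright N)\triangleleft P)\xrightarrow{F(a)}F(M\triangleright(N\triangleleft P))\xrightarrow{c}F(M)\triangleright F(N\triangleleft P)\xrightarrow{c_*}F(M)\triangleright(F(N)\triangleleft F(P))$. A lax closed functor is the same thing as a lax functor of the underlying bicategories; the corresponding map $c:F(M)\odot F(N)\to F(M\odot N)$ is the transpose of $F(M)\xrightarrow{F(\mathrm{coev})}F(N\triangleright(M\odot N))\xrightarrow{c}F(N)\triangleright F(M\odot N)$, and conversely $c:F(M\triangleright N)\to F(M)\triangleright F(N)$ is the transpose of $F(M\triangleright N)\odot F(M)\to F((M\triangleright N)\odot M)\xrightarrow{F(\mathrm{ev})}F(N)$. **Lax coshadow functor.** If $\mathrm{Csh}_{\mathscr{B}}$ and $\mathrm{Csh}_{\mathscr{C}}$ have target categories $\mathbf{T}$ and $\mathbf{Z}$, a lax coshadow functor is a lax closed functor $F:\mathscr{B}\to\mathscr{C}$ together with a functor $F_{\cosh}:\mathbf{T}\to\mathbf{Z}$ and natural transformations $\phi:F_{\cosh}\circ\mathrm{Csh}_{\mathscr{B}}\to\mathrm{Csh}_{\mathscr{C}}\circ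 F$ such that, for $M,N\in\mathscr{B}(R,S)$, the composites $F_{\cosh}\mathrm{Csh}_{\mathscr{B}}(M\triangleright N)\xrightarrow{\phi}\mathrm{Csh}_{\mathscr{C}}(F(M\triangleright N))\xrightarrow{\mathrm{Csh}(c)}\mathrm{Csh}_{\mathscr{C}}(F(M)\triangleright F(N))\xrightarrow{\theta}\mathrm{Csh}_{\mathscr{C}}(F(N)\triangleleft F(M))$ and $F_{\cosh}\mathrm{Csh}_{\mathscr{B}}(M\triangleright N)\xrightarrow{F_{\cosh}(\theta)}F_{\cosh}\mathrm{Csh}_{\mathscr{B}}(N\triangleleft M)\xrightarrow{\phi}\mathrm{Csh}_{\mathscr{C}}(F(N\triangleleft M))\xrightarrow{\mathrm{Csh}(c)}\mathrm{Csh}_{\mathscr{C}}(F(N)\triangleleft F(M))$ agree. *)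

theory Defs
  imports Main
begin

section \<open>Categories\<close>

record ('a, 'f) category =
  Ob :: "'a set"
  Ar :: "'f set"
  Dom :: "'f \<Rightarrow> 'a"
  Cod :: "'f \<Rightarrow> 'a"
  Id :: "'a \<Rightarrow> 'f"
  Comp :: "'f \<Rightarrow> 'f \<Rightarrow> 'f"  (infixr \<open>\<cdot>\<index>\<close> 55)

definition hom :: "('a, 'f, 'z) category_scheme \<Rightarrow> 'a \<Rightarrow> 'a \<Rightarrow> 'f set" where
  "hom C a b = {f \<in> Ar C. Dom C f = a \<and> Cod C f = b}"

locale category =
  fixes C :: "('a, 'f, 'z) category_scheme" (structure)
  assumes Dom_in_Ob: "f \<in> Ar C \<Longrightarrow> Dom C f \<in> Ob C"
    and Cod_in_Ob: "f \<in> Ar C \<Longrightarrow> Cod C f \<in> Ob C"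
    and Id_in_hom: "a \<in> Ob C \<Longrightarrow> Id C a \<in> hom C a a"
    and Comp_in_hom: "f \<in> hom C a b \<Longrightarrow> g \<in> hom C b c \<Longrightarrow> g \<cdot> f \<in> hom C a c"
    and Comp_Id: "f \<in> hom C a b \<Longrightarrow> f \<cdot> Id C a = f"
    and Id_Comp: "f \<in> hom C a b \<Longrightarrow> Id C b \<cdot> f = f"
    and Comp_assoc: "f \<in> hom C a b \<Longrightarrow> g \<in> hom C b c \<Longrightarrow> h \<in> hom C c d \<Longrightarrow>
      (h \<cdot> g) \<cdot> f = h \<cdot> (g \<cdot> f)"

definition inverses :: "('a, 'f, 'z) category_scheme \<Rightarrow> 'f \<Rightarrow> 'f \<Rightarrow> bool" where
  "inverses C f g \<longleftrightarrow> f \<in> Ar C \<and> g \<in> hom C (Cod C f) (Dom C f) \<and>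
     g \<cdot>\<^bsub>C\<^esub> f = Id C (Dom C f) \<and> f \<cdot>\<^bsub>C\<^esub> g = Id C (Cod C f)"

definition is_iso :: "('a, 'f, 'z) category_scheme \<Rightarrow> 'f \<Rightarrow> bool" where
  "is_iso C f \<longleftrightarrow> (\<exists>g. inverses C f g)"

definition inv_ar :: "('a, 'f, 'z) category_scheme \<Rightarrow> 'f \<Rightarrow> 'f" where
  "inv_ar C f = (THE g. inverses C f g)"

definition op_cat :: "('a, 'f, 'z) category_scheme \<Rightarrow> ('a, 'f) category" where
  "op_cat C = \<lparr>Ob = Ob C, Ar = Ar C, Dom = Cod C, Cod = Dom C, Id = Id C,
     Comp = (\<lambda>g f. f \<cdot>\<^bsub>C\<^esub> g)\<rparr>"

definition prod_cat ::
  "('a, 'f, 'y) category_scheme \<Rightarrow> ('b, 'g, 'z) category_scheme \<Rightarrow> ('a \<times> 'b, 'f \<times> 'g) category"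
  (infixr \<open>\<times>\<^sub>c\<close> 75) where
  "C \<times>\<^sub>c D = \<lparr>Ob = Ob C \<times> Ob D, Ar = Ar C \<times> Ar D,
     Dom = map_prod (Dom C) (Dom D), Cod = map_prod (Cod C) (Cod D),
     Id = map_prod (Id C) (Id D),
     Comp = (\<lambda>(g, g') (f, f'). (g \<cdot>\<^bsub>C\<^esub> f, g' \<cdot>\<^bsub>D\<^esub> f'))\<rparr>"

text \<open>A functor is given by its object map and its arrow map; only the values on the carriers
  matter.\<close>

definition cat_functor ::
  "('a, 'f, 'y) category_scheme \<Rightarrow> ('b, 'g, 'z) category_scheme \<Rightarrow> ('a \<Rightarrow> 'b) \<Rightarrow> ('f \<Rightarrow> 'g) \<Rightarrow> bool"
  where
  "cat_functor C D Fo Fa \<longleftrightarrow>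
     (\<forall>a\<in>Ob C. Fo a \<in> Ob D) \<and>
     (\<forall>a b. \<forall>f\<in>hom C a b. Fa f \<in> hom D (Fo a) (Fo b)) \<and>
     (\<forall>a\<in>Ob C. Fa (Id C a) = Id D (Fo a)) \<and>
     (\<forall>a b c. \<forall>f\<in>hom C a b. \<forall>g\<in>hom C b c. Fa (g \<cdot>\<^bsub>C\<^esub> f) = Fa g \<cdot>\<^bsub>D\<^esub> Fa f)"

definition nat_trans ::
  "('a, 'f, 'y) category_scheme \<Rightarrow> ('b, 'g, 'z) category_scheme \<Rightarrow> ('a \<Rightarrow> 'b) \<Rightarrow> ('f \<Rightarrow> 'g) \<Rightarrow>
   ('a \<Rightarrow> 'b) \<Rightarrow> ('f \<Rightarrow> 'g) \<Rightarrow> ('a \<Rightarrow> 'g) \<Rightarrow> bool" where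
  "nat_trans C D Fo Fa Go Ga \<tau> \<longleftrightarrow>
     (\<forall>a\<in>Ob C. \<tau> a \<in> hom D (Fo a) (Go a)) \<and>
     (\<forall>a b. \<forall>f\<in>hom C a b. \<tau> b \<cdot>\<^bsub>D\<^esub> Fa f = Ga f \<cdot>\<^bsub>D\<^esub> \<tau> a)"

definition nat_iso ::
  "('a, 'f, 'y) category_scheme \<Rightarrow> ('b, 'g, 'z) category_scheme \<Rightarrow> ('a \<Rightarrow> 'b) \<Rightarrow> ('f \<Rightarrow> 'g) \<Rightarrow>
   ('a \<Rightarrow> 'b) \<Rightarrow> ('f \<Rightarrow> 'g) \<Rightarrow> ('a \<Rightarrow> 'g) \<Rightarrow> bool" where
  "nat_iso C D Fo Fa Go Ga \<tau> \<longleftrightarrow>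
     nat_trans C D Fo Fa Go Ga \<tau> \<and> (\<forall>a\<in>Ob C. is_iso D (\<tau> a))"


section \<open>Bicategories\<close>

text \<open>The category fields of a bicategory describe the disjoint union of all hom-categories: its
  objects are the 1-cells, its arrows are the 2-cells, and \<open>\<cdot>\<close> is vertical composition. Each
  1-cell has a source and a target 0-cell, and \<open>hom_cat B R S\<close> is the category of 1-cells from
  \<open>R\<close> to \<open>S\<close>. Horizontal composition \<open>\<odot>\<close> is written in diagrammatic order; \<open>\<odot>\<^sub>2\<close> is its action
  on 2-cells.\<close>

record ('o, 'm, 'c) bicategory = "('m, 'c) category" +
  Cell0 :: "'o set"
  Src :: "'m \<Rightarrow> 'o"
  Trg :: "'m \<Rightarrow> 'o"
  U :: "'o \<Rightarrow> 'm"
  HComp1 :: "'m \<Rightarrow> 'm \<Rightarrow> 'm"  (infixr \<open>\<odot>\<index>\<close> 70)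
  HComp2 :: "'c \<Rightarrow> 'c \<Rightarrow> 'c"  (infixr \<open>\<odot>\<^sub>2\<index>\<close> 70)
  assoc :: "'m \<Rightarrow> 'm \<Rightarrow> 'm \<Rightarrow> 'c"
  lunit :: "'m \<Rightarrow> 'c"
  runit :: "'m \<Rightarrow> 'c"

definition Hom1 :: "('o, 'm, 'c, 'z) bicategory_scheme \<Rightarrow> 'o \<Rightarrow> 'o \<Rightarrow> 'm set" where
  "Hom1 B R S = {M \<in> Ob B. Src B M = R \<and> Trg B M = S}"

definition hom_cat :: "('o, 'm, 'c, 'z) bicategory_scheme \<Rightarrow> 'o \<Rightarrow> 'o \<Rightarrow> ('m, 'c) category" where
  "hom_cat B R S = \<lparr>Ob = Hom1 B R S,
     Ar = {f \<in> Ar B. Dom B f \<in> Hom1 B R S \<and> Cod B f \<in> Hom1 B R S},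
     Dom = Dom B, Cod = Cod B, Id = Id B, Comp = Comp B\<rparr>"

locale bicategory = category B
  for B :: "('o, 'm, 'c, 'z) bicategory_scheme" (structure) +
  assumes Src_in_Cell0: "M \<in> Ob B \<Longrightarrow> Src B M \<in> Cell0 B"
    and Trg_in_Cell0: "M \<in> Ob B \<Longrightarrow> Trg B M \<in> Cell0 B"
    and Src_parallel: "f \<in> Ar B \<Longrightarrow> Src B (Dom B f) = Src B (Cod B f)"
    and Trg_parallel: "f \<in> Ar B \<Longrightarrow> Trg B (Dom B f) = Trg B (Cod B f)"
    and U_in_Hom1: "R \<in> Cell0 B \<Longrightarrow> U B R \<in> Hom1 B R R"
    and HComp_functor: "\<lbrakk>R \<in> Cell0 B; S \<in> Cell0 B; T \<in> Cell0 B\<rbrakk> \<Longrightarrow>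
      cat_functor (hom_cat B R S \<times>\<^sub>c hom_cat B S T) (hom_cat B R T)
        (\<lambda>(M, N). M \<odot> N) (\<lambda>(m, n). m \<odot>\<^sub>2 n)"
    and assoc_nat_iso: "\<lbrakk>R \<in> Cell0 B; S \<in> Cell0 B; T \<in> Cell0 B; V \<in> Cell0 B\<rbrakk> \<Longrightarrow>
      nat_iso (hom_cat B R S \<times>\<^sub>c hom_cat B S T \<times>\<^sub>c hom_cat B T V) (hom_cat B R V)
        (\<lambda>(M, N, P). (M \<odot> N) \<odot> P) (\<lambda>(m, n, p). (m \<odot>\<^sub>2 n) \<odot>\<^sub>2 p)
        (\<lambda>(M, N, P). M \<odot> (N \<odot> P)) (\<lambda>(m, n, p). m \<odot>\<^sub>2 (n \<odot>\<^sub>2 p))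
        (\<lambda>(M, N, P). assoc B M N P)"
    and lunit_nat_iso: "\<lbrakk>R \<in> Cell0 B; S \<in> Cell0 B\<rbrakk> \<Longrightarrow>
      nat_iso (hom_cat B R S) (hom_cat B R S)
        (\<lambda>M. U B R \<odot> M) (\<lambda>m. Id B (U B R) \<odot>\<^sub>2 m) (\<lambda>M. M) (\<lambda>m. m) (lunit B)"
    and runit_nat_iso: "\<lbrakk>R \<in> Cell0 B; S \<in> Cell0 B\<rbrakk> \<Longrightarrow>
      nat_iso (hom_cat B R S) (hom_cat B R S)
        (\<lambda>M. M \<odot> U B S) (\<lambda>m. m \<odot>\<^sub>2 Id B (U B S)) (\<lambda>M. M) (\<lambda>m. m) (runit B)"
    and pentagon: "\<lbrakk>M \<in> Hom1 B R S; N \<in> Hom1 B S T; P \<in> Hom1 B T V; Q \<in> Hom1 B V W\<rbrakk> \<Longrightarrow>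
      assoc B M N (P \<odot> Q) \<cdot> assoc B (M \<odot> N) P Q =
      (Id B M \<odot>\<^sub>2 assoc B N P Q) \<cdot> assoc B M (N \<odot> P) Q \<cdot> (assoc B M N P \<odot>\<^sub>2 Id B Q)"
    and triangle: "\<lbrakk>M \<in> Hom1 B R S; N \<in> Hom1 B S T\<rbrakk> \<Longrightarrow>
      (Id B M \<odot>\<^sub>2 lunit B N) \<cdot> assoc B M (U B S) N = runit B M \<odot>\<^sub>2 Id B N"


section \<open>Closed bicategories\<close>

text \<open>For \<open>M : R \<rightarrow> S\<close>, \<open>N : S \<rightarrow> T\<close>, \<open>P : R \<rightarrow> T\<close>, \<open>trR B M N\<close> sends a 2-cell
  \<open>M \<odot> N \<Rightarrow> P\<close> to its transpose \<open>M \<Rightarrow> N \<triangleright> P\<close>, and \<open>trL B M N\<close> sends it to its transpose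
  \<open>N \<Rightarrow> P \<triangleleft> M\<close>. \<open>\<triangleleft>\<^sub>2\<close> and \<open>\<triangleright>\<^sub>2\<close> are the actions on 2-cells, so the induced maps
  \<open>h\<^sub>*\<close> and \<open>h\<^sup>*\<close> are written as \<open>Id B N \<triangleright>\<^sub>2 h\<close> and \<open>h \<triangleright>\<^sub>2 Id B P\<close>, respectively
  \<open>h \<triangleleft>\<^sub>2 Id B M\<close> and \<open>Id B P \<triangleleft>\<^sub>2 h\<close>.\<close>

record ('o, 'm, 'c) closed_bicategory = "('o, 'm, 'c) bicategory" +
  LHom1 :: "'m \<Rightarrow> 'm \<Rightarrow> 'm"  (\<open>(_ \<triangleleft>\<index> _)\<close> [66, 66] 65)
  LHom2 :: "'c \<Rightarrow> 'c \<Rightarrow> 'c"  (\<open>(_ \<triangleleft>\<^sub>2\<index> _)\<close> [66, 66] 65)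
  RHom1 :: "'m \<Rightarrow> 'm \<Rightarrow> 'm"  (\<open>(_ \<triangleright>\<index> _)\<close> [66, 66] 65)
  RHom2 :: "'c \<Rightarrow> 'c \<Rightarrow> 'c"  (\<open>(_ \<triangleright>\<^sub>2\<index> _)\<close> [66, 66] 65)
  trL :: "'m \<Rightarrow> 'm \<Rightarrow> 'c \<Rightarrow> 'c"
  trR :: "'m \<Rightarrow> 'm \<Rightarrow> 'c \<Rightarrow> 'c"

locale closed_bicategory = bicategory B
  for B :: "('o, 'm, 'c, 'z) closed_bicategory_scheme" (structure) +
  assumes LHom_functor: "\<lbrakk>R \<in> Cell0 B; S \<in> Cell0 B; T \<in> Cell0 B\<rbrakk> \<Longrightarrow>
      cat_functor (hom_cat B R T \<times>\<^sub>c op_cat (hom_cat B R S)) (hom_cat B S T)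
        (\<lambda>(P, M). P \<triangleleft> M) (\<lambda>(p, m). p \<triangleleft>\<^sub>2 m)"
    and RHom_functor: "\<lbrakk>R \<in> Cell0 B; S \<in> Cell0 B; T \<in> Cell0 B\<rbrakk> \<Longrightarrow>
      cat_functor (op_cat (hom_cat B S T) \<times>\<^sub>c hom_cat B R T) (hom_cat B R S)
        (\<lambda>(N, P). N \<triangleright> P) (\<lambda>(n, p). n \<triangleright>\<^sub>2 p)"
    and trL_bij: "\<lbrakk>M \<in> Hom1 B R S; N \<in> Hom1 B S T; P \<in> Hom1 B R T\<rbrakk> \<Longrightarrow>
      bij_betw (trL B M N) (hom B (M \<odot> N) P) (hom B N (P \<triangleleft> M))"
    and trR_bij: "\<lbrakk>M \<in> Hom1 B R S; N \<in> Hom1 B S T; P \<in> Hom1 B R T\<rbrakk> \<Longrightarrow>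
      bij_betw (trR B M N) (hom B (M \<odot> N) P) (hom B M (N \<triangleright> P))"
    and trL_natural: "\<lbrakk>M \<in> Hom1 B R S; N \<in> Hom1 B S T; P \<in> Hom1 B R T;
        f \<in> hom B (M \<odot> N) P; m \<in> hom B M' M; n \<in> hom B N' N; p \<in> hom B P P'\<rbrakk> \<Longrightarrow>
      trL B M' N' (p \<cdot> f \<cdot> (m \<odot>\<^sub>2 n)) = (p \<triangleleft>\<^sub>2 m) \<cdot> trL B M N f \<cdot> n"
    and trR_natural: "\<lbrakk>M \<in> Hom1 B R S; N \<in> Hom1 B S T; P \<in> Hom1 B R T;
        f \<in> hom B (M \<odot> N) P; m \<in> hom B M' M; n \<in> hom B N' N; p \<in> hom B P P'\<rbrakk> \<Longrightarrow>
      trR B M' N' (p \<cdot> f \<cdot> (m \<odot>\<^sub>2 n)) = (n \<triangleright>\<^sub>2 p) \<cdot> trR B M N f \<cdot> m"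

context
  fixes B :: "('o, 'm, 'c, 'z) closed_bicategory_scheme" (structure)
begin

definition untrL :: "'m \<Rightarrow> 'm \<Rightarrow> 'm \<Rightarrow> 'c \<Rightarrow> 'c" where
  "untrL M N P g = inv_into (hom B (M \<odot> N) P) (trL B M N) g"

definition untrR :: "'m \<Rightarrow> 'm \<Rightarrow> 'm \<Rightarrow> 'c \<Rightarrow> 'c" where
  "untrR M N P g = inv_into (hom B (M \<odot> N) P) (trR B M N) g"

text \<open>\<open>evL M P : M \<odot> (P \<triangleleft> M) \<Rightarrow> P\<close> and \<open>evR N P : (N \<triangleright> P) \<odot> N \<Rightarrow> P\<close>.\<close>

definition evL :: "'m \<Rightarrow> 'm \<Rightarrow> 'c" where
  "evL M P = untrL M (P \<triangleleft> M) P (Id B (P \<triangleleft> M))"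

definition evR :: "'m \<Rightarrow> 'm \<Rightarrow> 'c" where
  "evR N P = untrR (N \<triangleright> P) N P (Id B (N \<triangleright> P))"

text \<open>\<open>coev M N : M \<Rightarrow> N \<triangleright> (M \<odot> N)\<close>.\<close>

definition coev :: "'m \<Rightarrow> 'm \<Rightarrow> 'c" where
  "coev M N = trR B M N (Id B (M \<odot> N))"

text \<open>\<open>tR M N P : (M \<odot> N) \<triangleright> P \<Rightarrow> M \<triangleright> (N \<triangleright> P)\<close> and
  \<open>tL P M N : P \<triangleleft> (M \<odot> N) \<Rightarrow> (P \<triangleleft> M) \<triangleleft> N\<close>.\<close>

definition tR :: "'m \<Rightarrow> 'm \<Rightarrow> 'm \<Rightarrow> 'c" where
  "tR M N P =
     trR B ((M \<odot> N) \<triangleright> P) M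
       (trR B (((M \<odot> N) \<triangleright> P) \<odot> M) N
         (evR (M \<odot> N) P \<cdot> assoc B ((M \<odot> N) \<triangleright> P) M N))"

definition tL :: "'m \<Rightarrow> 'm \<Rightarrow> 'm \<Rightarrow> 'c" where
  "tL P M N =
     trL B N (P \<triangleleft> (M \<odot> N))
       (trL B M (N \<odot> (P \<triangleleft> (M \<odot> N)))
         (evL (M \<odot> N) P \<cdot> inv_ar B (assoc B M N (P \<triangleleft> (M \<odot> N)))))"

text \<open>\<open>amap N P M : (N \<triangleright> P) \<triangleleft> M \<Rightarrow> N \<triangleright> (P \<triangleleft> M)\<close>.\<close>

definition amap :: "'m \<Rightarrow> 'm \<Rightarrow> 'm \<Rightarrow> 'c" where
  "amap N P M =
     trR B ((N \<triangleright> P) \<triangleleft> M) N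
       (trL B M (((N \<triangleright> P) \<triangleleft> M) \<odot> N)
         (evR N P \<cdot> (evL M (N \<triangleright> P) \<odot>\<^sub>2 Id B N) \<cdot> inv_ar B (assoc B M ((N \<triangleright> P) \<triangleleft> M) N)))"

text \<open>\<open>lbar M : M \<Rightarrow> M \<triangleleft> U\<close> and \<open>rbar M : M \<Rightarrow> U \<triangleright> M\<close>.\<close>

definition lbar :: "'m \<Rightarrow> 'c" where
  "lbar M = trL B (U B (Src B M)) M (lunit B M)"

definition rbar :: "'m \<Rightarrow> 'c" where
  "rbar M = trR B M (U B (Trg B M)) (runit B M)"

text \<open>\<open>compR X Y Z : (Y \<triangleright> Z) \<odot> (X \<triangleright> Y) \<Rightarrow> X \<triangleright> Z\<close> is the composition map, and
  \<open>ocR X Y Z : Y \<triangleright> Z \<Rightarrow> (X \<triangleright> Y) \<triangleright> (X \<triangleright> Z)\<close> is its transpose; similarly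
  \<open>compL Z Y X : (Y \<triangleleft> X) \<odot> (Z \<triangleleft> Y) \<Rightarrow> Z \<triangleleft> X\<close> and
  \<open>ocL Z Y X : Z \<triangleleft> Y \<Rightarrow> (Z \<triangleleft> X) \<triangleleft> (Y \<triangleleft> X)\<close>.\<close>

definition compR :: "'m \<Rightarrow> 'm \<Rightarrow> 'm \<Rightarrow> 'c" where
  "compR X Y Z =
     trR B ((Y \<triangleright> Z) \<odot> (X \<triangleright> Y)) X
       (evR Y Z \<cdot> (Id B (Y \<triangleright> Z) \<odot>\<^sub>2 evR X Y) \<cdot> assoc B (Y \<triangleright> Z) (X \<triangleright> Y) X)"

definition ocR :: "'m \<Rightarrow> 'm \<Rightarrow> 'm \<Rightarrow> 'c" where
  "ocR X Y Z = trR B (Y \<triangleright> Z) (X \<triangleright> Y) (compR X Y Z)"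

definition compL :: "'m \<Rightarrow> 'm \<Rightarrow> 'm \<Rightarrow> 'c" where
  "compL Z Y X =
     trL B X ((Y \<triangleleft> X) \<odot> (Z \<triangleleft> Y))
       (evL Y Z \<cdot> (evL X Y \<odot>\<^sub>2 Id B (Z \<triangleleft> Y)) \<cdot> inv_ar B (assoc B X (Y \<triangleleft> X) (Z \<triangleleft> Y)))"

definition ocL :: "'m \<Rightarrow> 'm \<Rightarrow> 'm \<Rightarrow> 'c" where
  "ocL Z Y X = trL B (Y \<triangleleft> X) (Z \<triangleleft> Y) (compL Z Y X)"

end


section \<open>Duality\<close>

definition dual_pair ::
  "('o, 'm, 'c, 'z) bicategory_scheme \<Rightarrow> 'm \<Rightarrow> 'm \<Rightarrow> 'c \<Rightarrow> 'c \<Rightarrow> bool" where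
  "dual_pair B M M' \<eta> \<epsilon> \<longleftrightarrow>
     M \<in> Ob B \<and> M' \<in> Hom1 B (Trg B M) (Src B M) \<and>
     \<eta> \<in> hom B (U B (Src B M)) (M \<odot>\<^bsub>B\<^esub> M') \<and>
     \<epsilon> \<in> hom B (M' \<odot>\<^bsub>B\<^esub> M) (U B (Trg B M)) \<and>
     runit B M \<cdot>\<^bsub>B\<^esub> (Id B M \<odot>\<^sub>2\<^bsub>B\<^esub> \<epsilon>) \<cdot>\<^bsub>B\<^esub> assoc B M M' M \<cdot>\<^bsub>B\<^esub>
       (\<eta> \<odot>\<^sub>2\<^bsub>B\<^esub> Id B M) \<cdot>\<^bsub>B\<^esub> inv_ar B (lunit B M) = Id B M \<and>
     lunit B M' \<cdot>\<^bsub>B\<^esub> (\<epsilon> \<odot>\<^sub>2\<^bsub>B\<^esub> Id B M') \<cdot>\<^bsub>B\<^esub> inv_ar B (assoc B M' M M') \<cdot>\<^bsub>B\<^esub>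
       (Id B M' \<odot>\<^sub>2\<^bsub>B\<^esub> \<eta>) \<cdot>\<^bsub>B\<^esub> inv_ar B (runit B M') = Id B M'"

definition right_dual :: "('o, 'm, 'c, 'z) bicategory_scheme \<Rightarrow> 'm \<Rightarrow> 'm \<Rightarrow> bool" where
  "right_dual B M M' \<longleftrightarrow> (\<exists>\<eta> \<epsilon>. dual_pair B M M' \<eta> \<epsilon>)"


section \<open>Coshadows and cotraces\<close>

text \<open>Since the 1-cells of different hom-categories are distinct, the functors
  \<open>Csh : B(R, R) \<rightarrow> T\<close> for the various \<open>R\<close> are packed into one pair of maps.
  \<open>theta Sh M N : Csh (M \<triangleright> N) \<rightarrow> Csh (N \<triangleleft> M)\<close>.\<close>

record ('m, 'c, 't, 'u) coshadow =
  Csh1 :: "'m \<Rightarrow> 't"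
  Csh2 :: "'c \<Rightarrow> 'u"
  theta :: "'m \<Rightarrow> 'm \<Rightarrow> 'u"

locale coshadow = B: closed_bicategory B + T: category T
  for B :: "('o, 'm, 'c, 'z) closed_bicategory_scheme"
    and T :: "('t, 'u, 'y) category_scheme" +
  fixes Sh :: "('m, 'c, 't, 'u, 'x) coshadow_scheme"
  assumes Csh_functor: "R \<in> Cell0 B \<Longrightarrow> cat_functor (hom_cat B R R) T (Csh1 Sh) (Csh2 Sh)"
    and theta_nat_iso: "\<lbrakk>R \<in> Cell0 B; S \<in> Cell0 B\<rbrakk> \<Longrightarrow>
      nat_iso (op_cat (hom_cat B R S) \<times>\<^sub>c hom_cat B R S) T
        (\<lambda>(M, N). Csh1 Sh (M \<triangleright>\<^bsub>B\<^esub> N)) (\<lambda>(m, n). Csh2 Sh (m \<triangleright>\<^sub>2\<^bsub>B\<^esub> n))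
        (\<lambda>(M, N). Csh1 Sh (N \<triangleleft>\<^bsub>B\<^esub> M)) (\<lambda>(m, n). Csh2 Sh (n \<triangleleft>\<^sub>2\<^bsub>B\<^esub> m))
        (\<lambda>(M, N). theta Sh M N)"
    and theta_assoc: "\<lbrakk>M \<in> Hom1 B R S; N \<in> Hom1 B S V; P \<in> Hom1 B R V\<rbrakk> \<Longrightarrow>
      inv_ar T (theta Sh N (P \<triangleleft>\<^bsub>B\<^esub> M)) \<cdot>\<^bsub>T\<^esub> Csh2 Sh (tL B P M N) \<cdot>\<^bsub>T\<^esub> theta Sh (M \<odot>\<^bsub>B\<^esub> N) P =
      Csh2 Sh (amap B N P M) \<cdot>\<^bsub>T\<^esub> theta Sh M (N \<triangleright>\<^bsub>B\<^esub> P) \<cdot>\<^bsub>T\<^esub> Csh2 Sh (tR B M N P)"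
    and theta_unit: "\<lbrakk>R \<in> Cell0 B; M \<in> Hom1 B R R\<rbrakk> \<Longrightarrow>
      Csh2 Sh (inv_ar B (lbar B M)) \<cdot>\<^bsub>T\<^esub> theta Sh (U B R) M = Csh2 Sh (inv_ar B (rbar B M))"

text \<open>The cotrace of \<open>f : M \<triangleright> Q \<Rightarrow> P \<triangleleft> M\<close>, computed from the duality data
  \<open>(M', \<eta>, \<epsilon>)\<close> of \<open>M\<close>.\<close>

definition cotr ::
  "('o, 'm, 'c, 'z) closed_bicategory_scheme \<Rightarrow> ('t, 'u, 'y) category_scheme \<Rightarrow>
   ('m, 'c, 't, 'u, 'x) coshadow_scheme \<Rightarrow> 'm \<Rightarrow> 'm \<Rightarrow> 'c \<Rightarrow> 'c \<Rightarrow> 'm \<Rightarrow> 'm \<Rightarrow> 'c \<Rightarrow> 'u" where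
  "cotr B T Sh M M' \<eta> \<epsilon> Q P f =
     Csh2 Sh (inv_ar B (lbar B P) \<cdot>\<^bsub>B\<^esub> (Id B P \<triangleleft>\<^sub>2\<^bsub>B\<^esub> \<eta>) \<cdot>\<^bsub>B\<^esub> inv_ar B (tL B P M M')) \<cdot>\<^bsub>T\<^esub>
     theta Sh M' (P \<triangleleft>\<^bsub>B\<^esub> M) \<cdot>\<^bsub>T\<^esub>
     Csh2 Sh ((Id B M' \<triangleright>\<^sub>2\<^bsub>B\<^esub> f) \<cdot>\<^bsub>B\<^esub> tR B M' M Q \<cdot>\<^bsub>B\<^esub> (\<epsilon> \<triangleright>\<^sub>2\<^bsub>B\<^esub> Id B Q) \<cdot>\<^bsub>B\<^esub> rbar B Q)"


section \<open>Lax closed functors and lax coshadow functors\<close>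

text \<open>\<open>F0\<close>, \<open>F1\<close>, \<open>F2\<close> are the actions on 0-, 1- and 2-cells;
  \<open>cR F N P : F (N \<triangleright> P) \<Rightarrow> F N \<triangleright> F P\<close>, \<open>cL F P M : F (P \<triangleleft> M) \<Rightarrow> F P \<triangleleft> F M\<close> and
  \<open>iU F R : U (F R) \<Rightarrow> F (U R)\<close>.\<close>

record ('o, 'm, 'c, 'p, 'n, 'd) lax_closed_functor =
  F0 :: "'o \<Rightarrow> 'p"
  F1 :: "'m \<Rightarrow> 'n"
  F2 :: "'c \<Rightarrow> 'd"
  cR :: "'m \<Rightarrow> 'm \<Rightarrow> 'd"
  cL :: "'m \<Rightarrow> 'm \<Rightarrow> 'd"
  iU :: "'o \<Rightarrow> 'd"

locale lax_closed_functor = B: closed_bicategory B + C: closed_bicategory C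
  for B :: "('o, 'm, 'c, 'y) closed_bicategory_scheme"
    and C :: "('p, 'n, 'd, 'z) closed_bicategory_scheme" +
  fixes F :: "('o, 'm, 'c, 'p, 'n, 'd, 'x) lax_closed_functor_scheme"
  assumes F0_in_Cell0: "R \<in> Cell0 B \<Longrightarrow> F0 F R \<in> Cell0 C"
    and F_functor: "\<lbrakk>R \<in> Cell0 B; S \<in> Cell0 B\<rbrakk> \<Longrightarrow>
      cat_functor (hom_cat B R S) (hom_cat C (F0 F R) (F0 F S)) (F1 F) (F2 F)"
    and cR_nat: "\<lbrakk>R \<in> Cell0 B; S \<in> Cell0 B; T \<in> Cell0 B\<rbrakk> \<Longrightarrow>
      nat_trans (op_cat (hom_cat B S T) \<times>\<^sub>c hom_cat B R T) (hom_cat C (F0 F R) (F0 F S))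
        (\<lambda>(N, P). F1 F (N \<triangleright>\<^bsub>B\<^esub> P)) (\<lambda>(n, p). F2 F (n \<triangleright>\<^sub>2\<^bsub>B\<^esub> p))
        (\<lambda>(N, P). F1 F N \<triangleright>\<^bsub>C\<^esub> F1 F P) (\<lambda>(n, p). F2 F n \<triangleright>\<^sub>2\<^bsub>C\<^esub> F2 F p)
        (\<lambda>(N, P). cR F N P)"
    and cL_nat: "\<lbrakk>R \<in> Cell0 B; S \<in> Cell0 B; T \<in> Cell0 B\<rbrakk> \<Longrightarrow>
      nat_trans (hom_cat B R T \<times>\<^sub>c op_cat (hom_cat B R S)) (hom_cat C (F0 F S) (F0 F T))
        (\<lambda>(P, M). F1 F (P \<triangleleft>\<^bsub>B\<^esub> M)) (\<lambda>(p, m). F2 F (p \<triangleleft>\<^sub>2\<^bsub>B\<^esub> m))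
        (\<lambda>(P, M). F1 F P \<triangleleft>\<^bsub>C\<^esub> F1 F M) (\<lambda>(p, m). F2 F p \<triangleleft>\<^sub>2\<^bsub>C\<^esub> F2 F m)
        (\<lambda>(P, M). cL F P M)"
    and iU_in_hom: "R \<in> Cell0 B \<Longrightarrow> iU F R \<in> hom C (U C (F0 F R)) (F1 F (U B R))"
    and cR_comp: "\<lbrakk>M \<in> Hom1 B S T; N \<in> Hom1 B R T; P \<in> Hom1 B Q T\<rbrakk> \<Longrightarrow>
      (Id C (F1 F (M \<triangleright>\<^bsub>B\<^esub> N)) \<triangleright>\<^sub>2\<^bsub>C\<^esub> cR F M P) \<cdot>\<^bsub>C\<^esub>
        cR F (M \<triangleright>\<^bsub>B\<^esub> N) (M \<triangleright>\<^bsub>B\<^esub> P) \<cdot>\<^bsub>C\<^esub> F2 F (ocR B M N P) =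
      (cR F M N \<triangleright>\<^sub>2\<^bsub>C\<^esub> Id C (F1 F M \<triangleright>\<^bsub>C\<^esub> F1 F P)) \<cdot>\<^bsub>C\<^esub>
        ocR C (F1 F M) (F1 F N) (F1 F P) \<cdot>\<^bsub>C\<^esub> cR F N P"
    and cR_iU: "M \<in> Hom1 B R S \<Longrightarrow>
      cR F M M \<cdot>\<^bsub>C\<^esub> F2 F (trR B (U B R) M (lunit B M)) \<cdot>\<^bsub>C\<^esub> iU F R =
      trR C (U C (F0 F R)) (F1 F M) (lunit C (F1 F M))"
    and cR_rbar: "M \<in> Hom1 B R S \<Longrightarrow>
      (iU F S \<triangleright>\<^sub>2\<^bsub>C\<^esub> Id C (F1 F M)) \<cdot>\<^bsub>C\<^esub> cR F (U B S) M \<cdot>\<^bsub>C\<^esub> F2 F (rbar B M) =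
      rbar C (F1 F M)"
    and cL_comp: "\<lbrakk>M \<in> Hom1 B R S; N \<in> Hom1 B R T; P \<in> Hom1 B R Q\<rbrakk> \<Longrightarrow>
      (cL F P M \<triangleleft>\<^sub>2\<^bsub>C\<^esub> Id C (F1 F (N \<triangleleft>\<^bsub>B\<^esub> M))) \<cdot>\<^bsub>C\<^esub>
        cL F (P \<triangleleft>\<^bsub>B\<^esub> M) (N \<triangleleft>\<^bsub>B\<^esub> M) \<cdot>\<^bsub>C\<^esub> F2 F (ocL B P N M) =
      (Id C (F1 F P \<triangleleft>\<^bsub>C\<^esub> F1 F M) \<triangleleft>\<^sub>2\<^bsub>C\<^esub> cL F N M) \<cdot>\<^bsub>C\<^esub>
        ocL C (F1 F P) (F1 F N) (F1 F M) \<cdot>\<^bsub>C\<^esub> cL F P N"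
    and cL_iU: "M \<in> Hom1 B R S \<Longrightarrow>
      cL F M M \<cdot>\<^bsub>C\<^esub> F2 F (trL B M (U B S) (runit B M)) \<cdot>\<^bsub>C\<^esub> iU F S =
      trL C (F1 F M) (U C (F0 F S)) (runit C (F1 F M))"
    and cL_lbar: "M \<in> Hom1 B R S \<Longrightarrow>
      (Id C (F1 F M) \<triangleleft>\<^sub>2\<^bsub>C\<^esub> iU F R) \<cdot>\<^bsub>C\<^esub> cL F M (U B R) \<cdot>\<^bsub>C\<^esub> F2 F (lbar B M) =
      lbar C (F1 F M)"
    and c_amap: "\<lbrakk>M \<in> Hom1 B Q T; N \<in> Hom1 B R T; P \<in> Hom1 B R S\<rbrakk> \<Longrightarrow>
      amap C (F1 F M) (F1 F N) (F1 F P) \<cdot>\<^bsub>C\<^esub>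
        (cR F M N \<triangleleft>\<^sub>2\<^bsub>C\<^esub> Id C (F1 F P)) \<cdot>\<^bsub>C\<^esub> cL F (M \<triangleright>\<^bsub>B\<^esub> N) P =
      (Id C (F1 F M) \<triangleright>\<^sub>2\<^bsub>C\<^esub> cL F N P) \<cdot>\<^bsub>C\<^esub>
        cR F M (N \<triangleleft>\<^bsub>B\<^esub> P) \<cdot>\<^bsub>C\<^esub> F2 F (amap B M N P)"

text \<open>The constraint \<open>F M \<odot> F N \<Rightarrow> F (M \<odot> N)\<close> of the underlying lax functor.\<close>

definition c_hcomp ::
  "('o, 'm, 'c, 'y) closed_bicategory_scheme \<Rightarrow> ('p, 'n, 'd, 'z) closed_bicategory_scheme \<Rightarrow>
   ('o, 'm, 'c, 'p, 'n, 'd, 'x) lax_closed_functor_scheme \<Rightarrow> 'm \<Rightarrow> 'm \<Rightarrow> 'd" where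
  "c_hcomp B C F M N =
     untrR C (F1 F M) (F1 F N) (F1 F (M \<odot>\<^bsub>B\<^esub> N))
       (cR F N (M \<odot>\<^bsub>B\<^esub> N) \<cdot>\<^bsub>C\<^esub> F2 F (coev B M N))"

text \<open>\<open>G1\<close> and \<open>G2\<close> are the object and arrow maps of the functor between the target categories.\<close>

record ('o, 'm, 'c, 't, 'u, 'p, 'n, 'd, 'v, 'w) lax_coshadow_functor =
  "('o, 'm, 'c, 'p, 'n, 'd) lax_closed_functor" +
  G1 :: "'t \<Rightarrow> 'v"
  G2 :: "'u \<Rightarrow> 'w"
  phi :: "'m \<Rightarrow> 'w"

locale lax_coshadow_functor =
  lax_closed_functor B C F + B: coshadow B T ShB + C: coshadow C Z ShC
  for B :: "('o, 'm, 'c, 'x1) closed_bicategory_scheme"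
    and T :: "('t, 'u, 'x2) category_scheme"
    and ShB :: "('m, 'c, 't, 'u, 'x3) coshadow_scheme"
    and C :: "('p, 'n, 'd, 'x4) closed_bicategory_scheme"
    and Z :: "('v, 'w, 'x5) category_scheme"
    and ShC :: "('n, 'd, 'v, 'w, 'x6) coshadow_scheme"
    and F :: "('o, 'm, 'c, 't, 'u, 'p, 'n, 'd, 'v, 'w, 'x7) lax_coshadow_functor_scheme" +
  assumes G_functor: "cat_functor T Z (G1 F) (G2 F)"
    and phi_nat: "R \<in> Cell0 B \<Longrightarrow>
      nat_trans (hom_cat B R R) Z
        (\<lambda>M. G1 F (Csh1 ShB M)) (\<lambda>m. G2 F (Csh2 ShB m))
        (\<lambda>M. Csh1 ShC (F1 F M)) (\<lambda>m. Csh2 ShC (F2 F m)) (phi F)"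
    and phi_theta: "\<lbrakk>M \<in> Hom1 B R S; N \<in> Hom1 B R S\<rbrakk> \<Longrightarrow>
      theta ShC (F1 F M) (F1 F N) \<cdot>\<^bsub>Z\<^esub> Csh2 ShC (cR F M N) \<cdot>\<^bsub>Z\<^esub> phi F (M \<triangleright>\<^bsub>B\<^esub> N) =
      Csh2 ShC (cL F N M) \<cdot>\<^bsub>Z\<^esub> phi F (N \<triangleleft>\<^bsub>B\<^esub> M) \<cdot>\<^bsub>Z\<^esub> G2 F (theta ShB M N)"

end

theory Submission
  imports Defs
begin

text \<open>
  The theorem becomes short once every piece of the cotrace is written through ordinary
  composition \<open>\<odot>\<close> and evaluation, because a lax functor is compatible with those.

  \<^bold>\<open>The cotrace through evaluation.\<close> Let \<open>(M, M', \<eta>, \<epsilon>)\<close> be a dual pair. The source half of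
  the cotrace of \<open>f : M \<triangleright> Q \<Rightarrow> P \<triangleleft> M\<close> is the transpose of \<open>f \<cdot> in\<close>, where
  \<open>in : Q \<odot> M' \<Rightarrow> M \<triangleright> Q\<close> is itself the transpose of
  \<open>(Q \<odot> M') \<odot> M \<cong> Q \<odot> (M' \<odot> M) \<Rightarrow> Q \<odot> U \<cong> Q\<close> (lemma \<open>dual_in_eq\<close>). The target half is the map
  \<open>out : (P \<triangleleft> M) \<triangleleft> M' \<Rightarrow> P\<close> that inserts \<open>M \<odot> M'\<close> by \<open>\<eta>\<close> and evaluates twice
  (lemma \<open>dual_out_eq\<close>). In this form \<open>f\<close> occurs once and all units and associators have moved to
  \<open>\<odot>\<close>.

  \<^bold>\<open>The lax structure.\<close> The constraint \<open>c : F M \<odot> F N \<Rightarrow> F (M \<odot> N)\<close> is defined by transposing the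
  constraint for \<open>\<triangleright>\<close>; transposing the one for \<open>\<triangleleft>\<close> gives a second candidate \<open>c_left\<close>. By
  naturality either one turns \<open>F\<close> of a transpose into the transpose of \<open>F\<close> (lemmas \<open>cR_trR\<close> and
  \<open>cL_trL\<close>). Through these the compatibility of \<open>F\<close> with \<open>amap\<close> says precisely that \<open>F\<close> of the
  associator relates \<open>c\<close> after \<open>c_left\<close> to \<open>c_left\<close> after \<open>c\<close> (lemma \<open>c_left_assoc_c\<close>). With a unit
  in the middle this mixed law and the unit laws force \<open>c_left = c\<close>, and then the mixed law is the
  associativity law of a lax functor.

  \<^bold>\<open>Images of dual pairs and of cotraces.\<close> Where \<open>c\<close> and \<open>i\<close> are invertible, \<open>c\<inverse> \<cdot> F \<eta> \<cdot> i\<close> and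
  \<open>i\<inverse> \<cdot> F \<epsilon> \<cdot> c\<close> satisfy the triangle identities because \<open>F\<close> preserves those of
  \<open>(\<eta>, \<epsilon>)\<close>. For this choice of duality data the lax laws give \<open>cR \<cdot> F in \<cdot> c = in\<close> and
  \<open>F out = out \<cdot> cL\<^sub>* \<cdot> cL\<close>, with the maps of \<open>F M\<close> on the right. The claim about cotraces then
  follows by sliding \<open>\<phi>\<close> past \<open>out\<close>, past \<open>\<theta>\<close> and past the source half (lemma \<open>phi_cotr\<close>).

  \<^bold>\<open>Choice of the dual.\<close> Both cotraces may be taken with respect to any duality data: two duals of
  \<open>M\<close> are connected by a 2-cell \<open>u\<close> that carries one unit and counit to the other
  (lemma \<open>dual_comparison\<close>), and naturality of \<open>\<theta>\<close> in \<open>u\<close> identifies the two cotraces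
  (lemma \<open>cotr_indep\<close>). Here the associators need genuine coherence, namely the unit
  coherences that follow from the pentagon and the triangle.

  \<^bold>\<open>Convention.\<close> Composites are kept bracketed to the right, and simplification merges horizontal
  composites by interchange and absorbs everything composed with a transpose into it. The facts
  that are not of this kind (naturality, pentagon, triangle) are applied one at a time.
\<close>

section \<open>Calculating in categories\<close>

context category
begin

lemma Dom_Ob [simp]: "f \<in> Ar C \<Longrightarrow> Dom C f \<in> Ob C"
  by (rule Dom_in_Ob)

lemma Cod_Ob [simp]: "f \<in> Ar C \<Longrightarrow> Cod C f \<in> Ob C"
  by (rule Cod_in_Ob)

lemma Id_simps [simp]:
  assumes "a \<in> Ob C"
  shows "Id C a \<in> Ar C" "Dom C (Id C a) = a" "Cod C (Id C a) = a"
  using Id_in_hom[OF assms] by (auto simp: hom_def)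

lemma Comp_simps [simp]:
  assumes "f \<in> Ar C" "g \<in> Ar C" "Cod C f = Dom C g"
  shows "g \<cdot> f \<in> Ar C" "Dom C (g \<cdot> f) = Dom C f" "Cod C (g \<cdot> f) = Cod C g"
  using Comp_in_hom[of f "Dom C f" "Cod C f" g "Cod C g"] assms by (auto simp: hom_def)

lemma Comp_Id_right [simp]: "f \<in> Ar C \<Longrightarrow> Dom C f = a \<Longrightarrow> f \<cdot> Id C a = f"
  using Comp_Id[of f a "Cod C f"] by (simp add: hom_def)

lemma Comp_Id_left [simp]: "f \<in> Ar C \<Longrightarrow> Cod C f = b \<Longrightarrow> Id C b \<cdot> f = f"
  using Id_Comp[of f "Dom C f" b] by (simp add: hom_def)

lemma Comp_assoc_simp [simp]:
  "\<lbrakk>f \<in> Ar C; g \<in> Ar C; h \<in> Ar C; Cod C f = Dom C g; Cod C g = Dom C h\<rbrakk> \<Longrightarrow>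
    (h \<cdot> g) \<cdot> f = h \<cdot> (g \<cdot> f)"
  using Comp_assoc[of f "Dom C f" "Cod C f" g "Cod C g" h "Cod C h"] by (simp add: hom_def)

text \<open>With composites bracketed to the right, an equation with left-hand side \<open>g \<cdot> f\<close> does not
  match the redex \<open>g \<cdot> (f \<cdot> x)\<close>; this rule turns it into one that does.\<close>

lemma extend:
  "\<lbrakk>g \<cdot> f = k; f \<in> Ar C; g \<in> Ar C; Cod C f = Dom C g; x \<in> Ar C; Cod C x = Dom C f\<rbrakk> \<Longrightarrow>
    g \<cdot> (f \<cdot> x) = k \<cdot> x"
  using Comp_assoc_simp[of x f g] by simp

lemma inverses_unique:
  assumes "inverses C f g" "inverses C f h"
  shows "g = h"
proof -
  have "g = g \<cdot> (f \<cdot> h)"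
    using assms by (simp add: inverses_def hom_def)
  also have "\<dots> = (g \<cdot> f) \<cdot> h"
    using assms by (intro Comp_assoc_simp[symmetric]) (auto simp: inverses_def hom_def)
  also have "\<dots> = h"
    using assms by (simp add: inverses_def hom_def del: Comp_assoc_simp)
  finally show ?thesis .
qed

lemma inverses_inv_ar: "is_iso C f \<Longrightarrow> inverses C f (inv_ar C f)"
  unfolding is_iso_def inv_ar_def using inverses_unique by (metis the_equality)

lemma inv_ar_simps [simp]:
  assumes "is_iso C f"
  shows "inv_ar C f \<in> Ar C" "Dom C (inv_ar C f) = Cod C f" "Cod C (inv_ar C f) = Dom C f"
    "inv_ar C f \<cdot> f = Id C (Dom C f)" "f \<cdot> inv_ar C f = Id C (Cod C f)"
  using inverses_inv_ar[OF assms] by (auto simp: inverses_def hom_def)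

lemma is_iso_Ar: "is_iso C f \<Longrightarrow> f \<in> Ar C"
  by (auto simp: is_iso_def inverses_def)

lemma inv_ar_cancel [simp]:
  assumes "is_iso C f" "x \<in> Ar C"
  shows "Cod C x = Dom C f \<Longrightarrow> inv_ar C f \<cdot> (f \<cdot> x) = x"
    and "Cod C x = Cod C f \<Longrightarrow> f \<cdot> (inv_ar C f \<cdot> x) = x"
  using assms is_iso_Ar[OF assms(1)] extend[of "inv_ar C f" f _ x] extend[of f "inv_ar C f" _ x]
  by auto

lemma inv_ar_eqI:
  assumes "f \<in> Ar C" "g \<in> Ar C" "Dom C g = Cod C f" "Cod C g = Dom C f"
    "g \<cdot> f = Id C (Dom C f)" "f \<cdot> g = Id C (Cod C f)"
  shows "is_iso C f" "inv_ar C f = g"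
proof -
  have *: "inverses C f g"
    using assms by (simp add: inverses_def hom_def)
  then show "is_iso C f"
    by (auto simp: is_iso_def)
  then show "inv_ar C f = g"
    using * inverses_unique inverses_inv_ar by blast
qed

lemma is_iso_Id [simp]: "a \<in> Ob C \<Longrightarrow> is_iso C (Id C a)"
  by (rule inv_ar_eqI(1)[where g = "Id C a"]) auto

lemma is_iso_inv_ar [simp]: "is_iso C f \<Longrightarrow> is_iso C (inv_ar C f)"
  using is_iso_Ar by (intro inv_ar_eqI(1)[where g = f]) auto

lemma iso_cancel_left:
  assumes "is_iso C f" "f \<cdot> x = f \<cdot> y" "x \<in> Ar C" "y \<in> Ar C" "Cod C x = Dom C f" "Cod C y = Dom C f"
  shows "x = y"
  using assms by (metis inv_ar_cancel(1))

lemma iso_cancel_right: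
  assumes "is_iso C f" "x \<cdot> f = y \<cdot> f" "x \<in> Ar C" "y \<in> Ar C" "Dom C x = Cod C f" "Dom C y = Cod C f"
  shows "x = y"
proof -
  have "x = (x \<cdot> f) \<cdot> inv_ar C f"
    using assms(1,3,5) is_iso_Ar[OF assms(1)] by simp
  also have "\<dots> = (y \<cdot> f) \<cdot> inv_ar C f"
    by (simp only: assms(2))
  also have "\<dots> = y"
    using assms(1,4,6) is_iso_Ar[OF assms(1)] by simp
  finally show ?thesis .
qed

end

section \<open>Calculating in bicategories\<close>

lemma hom_cat_simps [simp]:
  "Ob (hom_cat B R S) = Hom1 B R S"
  "Ar (hom_cat B R S) = {f \<in> Ar B. Dom B f \<in> Hom1 B R S \<and> Cod B f \<in> Hom1 B R S}"
  "Dom (hom_cat B R S) = Dom B" "Cod (hom_cat B R S) = Cod B" "Id (hom_cat B R S) = Id B"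
  "Comp (hom_cat B R S) = Comp B"
  by (simp_all add: hom_cat_def)

lemma prod_cat_simps [simp]:
  "Ob (C \<times>\<^sub>c D) = Ob C \<times> Ob D" "Ar (C \<times>\<^sub>c D) = Ar C \<times> Ar D"
  "Dom (C \<times>\<^sub>c D) = map_prod (Dom C) (Dom D)" "Cod (C \<times>\<^sub>c D) = map_prod (Cod C) (Cod D)"
  "Id (C \<times>\<^sub>c D) = map_prod (Id C) (Id D)"
  "Comp (C \<times>\<^sub>c D) (g, g') (f, f') = (g \<cdot>\<^bsub>C\<^esub> f, g' \<cdot>\<^bsub>D\<^esub> f')"
  by (simp_all add: prod_cat_def)

lemma op_cat_simps [simp]:
  "Ob (op_cat C) = Ob C" "Ar (op_cat C) = Ar C" "Dom (op_cat C) = Cod C" "Cod (op_cat C) = Dom C"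
  "Id (op_cat C) = Id C" "Comp (op_cat C) g f = f \<cdot>\<^bsub>C\<^esub> g"
  by (simp_all add: op_cat_def)

lemma cat_functorD:
  assumes "cat_functor C D Fo Fa"
  shows "a \<in> Ob C \<Longrightarrow> Fo a \<in> Ob D"
    and "f \<in> Ar C \<Longrightarrow> Fa f \<in> Ar D"
    and "f \<in> Ar C \<Longrightarrow> Dom D (Fa f) = Fo (Dom C f)"
    and "f \<in> Ar C \<Longrightarrow> Cod D (Fa f) = Fo (Cod C f)"
    and "a \<in> Ob C \<Longrightarrow> Fa (Id C a) = Id D (Fo a)"
    and "\<lbrakk>f \<in> Ar C; g \<in> Ar C; Dom C g = Cod C f\<rbrakk> \<Longrightarrow> Fa (g \<cdot>\<^bsub>C\<^esub> f) = Fa g \<cdot>\<^bsub>D\<^esub> Fa f"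
  using assms by (auto simp: cat_functor_def hom_def)

lemma nat_transD:
  assumes "nat_trans C D Fo Fa Go Ga \<tau>"
  shows "a \<in> Ob C \<Longrightarrow> \<tau> a \<in> Ar D"
    and "a \<in> Ob C \<Longrightarrow> Dom D (\<tau> a) = Fo a"
    and "a \<in> Ob C \<Longrightarrow> Cod D (\<tau> a) = Go a"
    and "f \<in> Ar C \<Longrightarrow> \<tau> (Cod C f) \<cdot>\<^bsub>D\<^esub> Fa f = Ga f \<cdot>\<^bsub>D\<^esub> \<tau> (Dom C f)"
  using assms by (auto simp: nat_trans_def hom_def)

lemma nat_isoD:
  assumes "nat_iso C D Fo Fa Go Ga \<tau>"
  shows "nat_trans C D Fo Fa Go Ga \<tau>" and "a \<in> Ob C \<Longrightarrow> is_iso D (\<tau> a)"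
  using assms by (auto simp: nat_iso_def)

lemma is_iso_hom_catD: "is_iso (hom_cat B R S) f \<Longrightarrow> is_iso B f"
  by (auto simp: is_iso_def inverses_def hom_def)

context bicategory
begin

lemma Cell0_simps [simp]:
  "M \<in> Ob B \<Longrightarrow> Src B M \<in> Cell0 B" "M \<in> Ob B \<Longrightarrow> Trg B M \<in> Cell0 B"
  by (rule Src_in_Cell0 Trg_in_Cell0; assumption)+

lemma parallel_simps [simp]:
  "f \<in> Ar B \<Longrightarrow> Src B (Cod B f) = Src B (Dom B f)"
  "f \<in> Ar B \<Longrightarrow> Trg B (Cod B f) = Trg B (Dom B f)"
  by (simp_all add: Src_parallel Trg_parallel)

lemma U_simps [simp]:
  assumes "R \<in> Cell0 B"
  shows "U B R \<in> Ob B" "Src B (U B R) = R" "Trg B (U B R) = R"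
  using U_in_Hom1[OF assms] by (auto simp: Hom1_def)

lemma HComp1_simps [simp]:
  assumes "M \<in> Ob B" "N \<in> Ob B" "Trg B M = Src B N"
  shows "M \<odot> N \<in> Ob B" "Src B (M \<odot> N) = Src B M" "Trg B (M \<odot> N) = Trg B N"
  using cat_functorD(1)[OF HComp_functor[of "Src B M" "Trg B M" "Trg B N"], of "(M, N)"] assms
  by (auto simp: Hom1_def)

lemma HComp2_simps [simp]:
  assumes "m \<in> Ar B" "n \<in> Ar B" "Trg B (Dom B m) = Src B (Dom B n)"
  shows "m \<odot>\<^sub>2 n \<in> Ar B" "Dom B (m \<odot>\<^sub>2 n) = Dom B m \<odot> Dom B n"
    "Cod B (m \<odot>\<^sub>2 n) = Cod B m \<odot> Cod B n"
  using cat_functorD(2-4)[OF HComp_functor[of "Src B (Dom B m)" "Trg B (Dom B m)" "Trg B (Dom B n)"],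
      of "(m, n)"] assms
  by (auto simp: Hom1_def)

lemma HComp2_Id [simp]:
  assumes "M \<in> Ob B" "N \<in> Ob B" "Trg B M = Src B N"
  shows "Id B M \<odot>\<^sub>2 Id B N = Id B (M \<odot> N)"
  using cat_functorD(5)[OF HComp_functor[of "Src B M" "Trg B M" "Trg B N"], of "(M, N)"] assms
  by (auto simp: Hom1_def)

lemma interchange [simp]:
  assumes "m \<in> Ar B" "n \<in> Ar B" "Trg B (Dom B m) = Src B (Dom B n)"
    "m' \<in> Ar B" "n' \<in> Ar B" "Dom B m' = Cod B m" "Dom B n' = Cod B n"
  shows "(m' \<odot>\<^sub>2 n') \<cdot> (m \<odot>\<^sub>2 n) = (m' \<cdot> m) \<odot>\<^sub>2 (n' \<cdot> n)"
  using cat_functorD(6)[OF HComp_functor[of "Src B (Dom B m)" "Trg B (Dom B m)" "Trg B (Dom B n)"],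
      of "(m, n)" "(m', n')"] assms
  by (auto simp: Hom1_def)

lemma interchange_extend [simp]:
  assumes "m \<in> Ar B" "n \<in> Ar B" "Trg B (Dom B m) = Src B (Dom B n)"
    "m' \<in> Ar B" "n' \<in> Ar B" "Dom B m' = Cod B m" "Dom B n' = Cod B n"
    "x \<in> Ar B" "Cod B x = Dom B m \<odot> Dom B n"
  shows "(m' \<odot>\<^sub>2 n') \<cdot> (m \<odot>\<^sub>2 n) \<cdot> x = ((m' \<cdot> m) \<odot>\<^sub>2 (n' \<cdot> n)) \<cdot> x"
  using assms by (intro extend) auto

lemma HComp2_iso [simp]:
  assumes "is_iso B m" "is_iso B n" "Trg B (Dom B m) = Src B (Dom B n)"
  shows "is_iso B (m \<odot>\<^sub>2 n)"
proof -
  note [simp] = assms is_iso_Ar[OF assms(1)] is_iso_Ar[OF assms(2)]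
  show ?thesis
    by (rule inv_ar_eqI(1)[where g = "inv_ar B m \<odot>\<^sub>2 inv_ar B n"]) auto
qed

lemma assoc_simps [simp]:
  assumes "M \<in> Ob B" "N \<in> Ob B" "P \<in> Ob B" "Trg B M = Src B N" "Trg B N = Src B P"
  shows "assoc B M N P \<in> Ar B" "Dom B (assoc B M N P) = (M \<odot> N) \<odot> P"
    "Cod B (assoc B M N P) = M \<odot> (N \<odot> P)" "is_iso B (assoc B M N P)"
proof -
  note * = assoc_nat_iso[of "Src B M" "Trg B M" "Trg B N" "Trg B P"]
  show "assoc B M N P \<in> Ar B" "Dom B (assoc B M N P) = (M \<odot> N) \<odot> P"
    "Cod B (assoc B M N P) = M \<odot> (N \<odot> P)"
    using nat_transD(1-3)[OF nat_isoD(1)[OF *], of "(M, N, P)"] assms by (auto simp: Hom1_def)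
  show "is_iso B (assoc B M N P)"
    using nat_isoD(2)[OF *, of "(M, N, P)"] assms by (auto simp: Hom1_def dest: is_iso_hom_catD)
qed

text \<open>The naturality laws name the components of the transformation and the domains and codomains of
  the 2-cells separately. Thus they match terms in which the latter have already been simplified.\<close>

lemma assoc_natural:
  assumes "m \<in> Ar B" "n \<in> Ar B" "p \<in> Ar B"
    "Trg B (Dom B m) = Src B (Dom B n)" "Trg B (Dom B n) = Src B (Dom B p)"
    "M = Dom B m" "N = Dom B n" "P = Dom B p" "M' = Cod B m" "N' = Cod B n" "P' = Cod B p"
  shows "assoc B M' N' P' \<cdot> ((m \<odot>\<^sub>2 n) \<odot>\<^sub>2 p) = (m \<odot>\<^sub>2 (n \<odot>\<^sub>2 p)) \<cdot> assoc B M N P"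
  using nat_transD(4)[OF nat_isoD(1)[OF assoc_nat_iso[of "Src B M" "Trg B M" "Trg B N" "Trg B P"]],
      of "(m, n, p)"] assms
  by (auto simp: Hom1_def)

lemma inv_assoc_natural:
  assumes "m \<in> Ar B" "n \<in> Ar B" "p \<in> Ar B"
    "Trg B (Dom B m) = Src B (Dom B n)" "Trg B (Dom B n) = Src B (Dom B p)"
    "M = Dom B m" "N = Dom B n" "P = Dom B p" "M' = Cod B m" "N' = Cod B n" "P' = Cod B p"
  shows "((m \<odot>\<^sub>2 n) \<odot>\<^sub>2 p) \<cdot> inv_ar B (assoc B M N P) =
    inv_ar B (assoc B M' N' P') \<cdot> (m \<odot>\<^sub>2 (n \<odot>\<^sub>2 p))"
proof (rule iso_cancel_left)
  show "is_iso B (assoc B M' N' P')"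
    using assms by simp
  have "assoc B M' N' P' \<cdot> ((m \<odot>\<^sub>2 n) \<odot>\<^sub>2 p) \<cdot> inv_ar B (assoc B M N P) =
      ((m \<odot>\<^sub>2 (n \<odot>\<^sub>2 p)) \<cdot> assoc B M N P) \<cdot> inv_ar B (assoc B M N P)"
    using assms by (intro extend assoc_natural) auto
  also have "\<dots> = assoc B M' N' P' \<cdot> inv_ar B (assoc B M' N' P') \<cdot> (m \<odot>\<^sub>2 (n \<odot>\<^sub>2 p))"
    using assms by simp
  finally show "assoc B M' N' P' \<cdot> ((m \<odot>\<^sub>2 n) \<odot>\<^sub>2 p) \<cdot> inv_ar B (assoc B M N P) =
      assoc B M' N' P' \<cdot> inv_ar B (assoc B M' N' P') \<cdot> (m \<odot>\<^sub>2 (n \<odot>\<^sub>2 p))" .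
qed (use assms in auto)

lemma lunit_simps [simp]:
  assumes "M \<in> Ob B"
  shows "lunit B M \<in> Ar B" "Dom B (lunit B M) = U B (Src B M) \<odot> M" "Cod B (lunit B M) = M"
    "is_iso B (lunit B M)"
proof -
  note * = lunit_nat_iso[of "Src B M" "Trg B M"]
  show "lunit B M \<in> Ar B" "Dom B (lunit B M) = U B (Src B M) \<odot> M" "Cod B (lunit B M) = M"
    using nat_transD(1-3)[OF nat_isoD(1)[OF *], of M] assms by (auto simp: Hom1_def)
  show "is_iso B (lunit B M)"
    using nat_isoD(2)[OF *, of M] assms by (auto simp: Hom1_def dest: is_iso_hom_catD)
qed

lemma runit_simps [simp]:
  assumes "M \<in> Ob B"
  shows "runit B M \<in> Ar B" "Dom B (runit B M) = M \<odot> U B (Trg B M)" "Cod B (runit B M) = M"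
    "is_iso B (runit B M)"
proof -
  note * = runit_nat_iso[of "Src B M" "Trg B M"]
  show "runit B M \<in> Ar B" "Dom B (runit B M) = M \<odot> U B (Trg B M)" "Cod B (runit B M) = M"
    using nat_transD(1-3)[OF nat_isoD(1)[OF *], of M] assms by (auto simp: Hom1_def)
  show "is_iso B (runit B M)"
    using nat_isoD(2)[OF *, of M] assms by (auto simp: Hom1_def dest: is_iso_hom_catD)
qed

lemma lunit_natural:
  assumes "m \<in> Ar B" "M = Dom B m" "M' = Cod B m" "R = Src B M"
  shows "lunit B M' \<cdot> (Id B (U B R) \<odot>\<^sub>2 m) = m \<cdot> lunit B M"
  using nat_transD(4)[OF nat_isoD(1)[OF lunit_nat_iso[of "Src B M" "Trg B M"]], of m] assms
  by (auto simp: Hom1_def)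

lemma runit_natural:
  assumes "m \<in> Ar B" "M = Dom B m" "M' = Cod B m" "S = Trg B M"
  shows "runit B M' \<cdot> (m \<odot>\<^sub>2 Id B (U B S)) = m \<cdot> runit B M"
  using nat_transD(4)[OF nat_isoD(1)[OF runit_nat_iso[of "Src B M" "Trg B M"]], of m] assms
  by (auto simp: Hom1_def)

lemma pentagon_simp:
  assumes "M \<in> Ob B" "N \<in> Ob B" "P \<in> Ob B" "Q \<in> Ob B"
    "Trg B M = Src B N" "Trg B N = Src B P" "Trg B P = Src B Q"
  shows "(Id B M \<odot>\<^sub>2 assoc B N P Q) \<cdot> assoc B M (N \<odot> P) Q \<cdot> (assoc B M N P \<odot>\<^sub>2 Id B Q) =
    assoc B M N (P \<odot> Q) \<cdot> assoc B (M \<odot> N) P Q"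
  using assms by (intro pentagon[symmetric]) (auto simp: Hom1_def)

lemma triangle_simp:
  assumes "M \<in> Ob B" "N \<in> Ob B" "Trg B M = Src B N" "S = Trg B M"
  shows "(Id B M \<odot>\<^sub>2 lunit B N) \<cdot> assoc B M (U B S) N = runit B M \<odot>\<^sub>2 Id B N"
  using assms by (intro triangle) (auto simp: Hom1_def)

text \<open>Whiskering with a unit is isomorphic, through the unitor, to doing nothing, so it is faithful.\<close>

lemma whisker_right_U_cancel:
  assumes "f \<odot>\<^sub>2 Id B (U B S) = g \<odot>\<^sub>2 Id B (U B S)" "f \<in> Ar B" "g \<in> Ar B"
    "Dom B f = Dom B g" "Cod B f = Cod B g" "S = Trg B (Dom B f)"
  shows "f = g"
proof (rule iso_cancel_right)
  show "f \<cdot> runit B (Dom B f) = g \<cdot> runit B (Dom B f)"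
    using assms runit_natural[of f _ _ S] runit_natural[of g _ _ S] by metis
qed (use assms in auto)

lemma whisker_left_U_cancel:
  assumes "Id B (U B S) \<odot>\<^sub>2 f = Id B (U B S) \<odot>\<^sub>2 g" "f \<in> Ar B" "g \<in> Ar B"
    "Dom B f = Dom B g" "Cod B f = Cod B g" "S = Src B (Dom B f)"
  shows "f = g"
proof (rule iso_cancel_right)
  show "f \<cdot> lunit B (Dom B f) = g \<cdot> lunit B (Dom B f)"
    using assms lunit_natural[of f _ _ S] lunit_natural[of g _ _ S] by metis
qed (use assms in auto)

text \<open>Kelly's argument: after whiskering with \<open>U\<close> on the right, which is faithful, the claim is an
  instance of the pentagon for \<open>M, N, U, U\<close> in which the triangle turns each left unitor of the
  inner \<open>U\<close> into a right unitor.\<close>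

lemma runit_HComp:
  assumes M: "M \<in> Ob B" and N: "N \<in> Ob B" and MN: "Trg B M = Src B N" and S: "S = Trg B N"
  shows "(Id B M \<odot>\<^sub>2 runit B N) \<cdot> assoc B M N (U B S) = runit B (M \<odot> N)"
proof (rule whisker_right_U_cancel[where S = S])
  let ?U = "U B S"
  have [simp]: "S \<in> Cell0 B"
    using N S by simp
  note [simp] = M N MN S[symmetric]
  have n1: "assoc B M N ?U \<cdot> ((Id B M \<odot>\<^sub>2 runit B N) \<odot>\<^sub>2 Id B ?U) =
      (Id B M \<odot>\<^sub>2 (runit B N \<odot>\<^sub>2 Id B ?U)) \<cdot> assoc B M (N \<odot> ?U) ?U"
    by (intro assoc_natural) auto
  have n2: "(Id B M \<odot>\<^sub>2 (Id B N \<odot>\<^sub>2 lunit B ?U)) \<cdot> assoc B M N (?U \<odot> ?U) =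
      assoc B M N ?U \<cdot> ((Id B M \<odot>\<^sub>2 Id B N) \<odot>\<^sub>2 lunit B ?U)"
    by (intro assoc_natural[symmetric]) auto
  have t1: "(Id B N \<odot>\<^sub>2 lunit B ?U) \<cdot> assoc B N ?U ?U = runit B N \<odot>\<^sub>2 Id B ?U"
    by (intro triangle_simp) auto
  have t2: "(Id B (M \<odot> N) \<odot>\<^sub>2 lunit B ?U) \<cdot> assoc B (M \<odot> N) ?U ?U = runit B (M \<odot> N) \<odot>\<^sub>2 Id B ?U"
    by (intro triangle_simp) auto
  have p: "(Id B M \<odot>\<^sub>2 assoc B N ?U ?U) \<cdot> assoc B M (N \<odot> ?U) ?U \<cdot> (assoc B M N ?U \<odot>\<^sub>2 Id B ?U) =
      assoc B M N (?U \<odot> ?U) \<cdot> assoc B (M \<odot> N) ?U ?U"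
    by (intro pentagon_simp) auto
  let ?f = "(Id B M \<odot>\<^sub>2 runit B N) \<cdot> assoc B M N ?U"
  have "assoc B M N ?U \<cdot> (?f \<odot>\<^sub>2 Id B ?U) =
      (assoc B M N ?U \<cdot> ((Id B M \<odot>\<^sub>2 runit B N) \<odot>\<^sub>2 Id B ?U)) \<cdot> (assoc B M N ?U \<odot>\<^sub>2 Id B ?U)"
    by simp
  also have "\<dots> = (Id B M \<odot>\<^sub>2 (Id B N \<odot>\<^sub>2 lunit B ?U)) \<cdot> (Id B M \<odot>\<^sub>2 assoc B N ?U ?U) \<cdot>
      assoc B M (N \<odot> ?U) ?U \<cdot> (assoc B M N ?U \<odot>\<^sub>2 Id B ?U)"
    unfolding n1 by (simp add: t1)
  also have "\<dots> = ((Id B M \<odot>\<^sub>2 (Id B N \<odot>\<^sub>2 lunit B ?U)) \<cdot> assoc B M N (?U \<odot> ?U)) \<cdot>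
      assoc B (M \<odot> N) ?U ?U"
    unfolding p by simp
  also have "\<dots> = assoc B M N ?U \<cdot> (runit B (M \<odot> N) \<odot>\<^sub>2 Id B ?U)"
    unfolding n2 by (simp add: t2)
  finally show "?f \<odot>\<^sub>2 Id B ?U = runit B (M \<odot> N) \<odot>\<^sub>2 Id B ?U"
    by (rule iso_cancel_left[rotated]) auto
qed (use assms in auto)

text \<open>The mirror image of the previous argument, with the pentagon for \<open>U, U, M, N\<close>.\<close>

lemma lunit_HComp:
  assumes M: "M \<in> Ob B" and N: "N \<in> Ob B" and MN: "Trg B M = Src B N" and R: "R = Src B M"
  shows "lunit B (M \<odot> N) \<cdot> assoc B (U B R) M N = lunit B M \<odot>\<^sub>2 Id B N"
proof (rule whisker_left_U_cancel[where S = R])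
  let ?U = "U B R"
  note [simp] = assms
  have n1: "(Id B ?U \<odot>\<^sub>2 (lunit B M \<odot>\<^sub>2 Id B N)) \<cdot> assoc B ?U (?U \<odot> M) N =
      assoc B ?U M N \<cdot> ((Id B ?U \<odot>\<^sub>2 lunit B M) \<odot>\<^sub>2 Id B N)"
    by (intro assoc_natural[symmetric]) auto
  have n2: "assoc B ?U M N \<cdot> ((runit B ?U \<odot>\<^sub>2 Id B M) \<odot>\<^sub>2 Id B N) =
      (runit B ?U \<odot>\<^sub>2 (Id B M \<odot>\<^sub>2 Id B N)) \<cdot> assoc B (?U \<odot> ?U) M N"
    by (intro assoc_natural) auto
  have t1: "(Id B ?U \<odot>\<^sub>2 lunit B M) \<cdot> assoc B ?U ?U M = runit B ?U \<odot>\<^sub>2 Id B M"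
    by (intro triangle_simp) auto
  have t2: "(Id B ?U \<odot>\<^sub>2 lunit B (M \<odot> N)) \<cdot> assoc B ?U ?U (M \<odot> N) = runit B ?U \<odot>\<^sub>2 Id B (M \<odot> N)"
    by (intro triangle_simp) auto
  have p: "(Id B ?U \<odot>\<^sub>2 assoc B ?U M N) \<cdot> assoc B ?U (?U \<odot> M) N \<cdot> (assoc B ?U ?U M \<odot>\<^sub>2 Id B N) =
      assoc B ?U ?U (M \<odot> N) \<cdot> assoc B (?U \<odot> ?U) M N"
    by (intro pentagon_simp) auto
  let ?f = "lunit B (M \<odot> N) \<cdot> assoc B ?U M N"
  let ?x = "assoc B ?U (?U \<odot> M) N \<cdot> (assoc B ?U ?U M \<odot>\<^sub>2 Id B N)"
  have iso: "is_iso B ?x"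
  proof (rule inv_ar_eqI(1))
    let ?y = "(inv_ar B (assoc B ?U ?U M) \<odot>\<^sub>2 Id B N) \<cdot> inv_ar B (assoc B ?U (?U \<odot> M) N)"
    show "?y \<cdot> ?x = Id B (Dom B ?x)" "?x \<cdot> ?y = Id B (Cod B ?x)"
      by auto
  qed auto
  have "(Id B ?U \<odot>\<^sub>2 ?f) \<cdot> ?x = (Id B ?U \<odot>\<^sub>2 lunit B (M \<odot> N)) \<cdot>
      ((Id B ?U \<odot>\<^sub>2 assoc B ?U M N) \<cdot> assoc B ?U (?U \<odot> M) N \<cdot> (assoc B ?U ?U M \<odot>\<^sub>2 Id B N))"
    by simp
  also have "\<dots> = ((Id B ?U \<odot>\<^sub>2 lunit B (M \<odot> N)) \<cdot> assoc B ?U ?U (M \<odot> N)) \<cdot> assoc B (?U \<odot> ?U) M N"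
    unfolding p by simp
  also have "\<dots> = (runit B ?U \<odot>\<^sub>2 (Id B M \<odot>\<^sub>2 Id B N)) \<cdot> assoc B (?U \<odot> ?U) M N"
    unfolding t2 by simp
  also have "\<dots> = assoc B ?U M N \<cdot>
      (((Id B ?U \<odot>\<^sub>2 lunit B M) \<cdot> assoc B ?U ?U M) \<odot>\<^sub>2 Id B N)"
    unfolding n2[symmetric] t1 ..
  also have "\<dots> = (assoc B ?U M N \<cdot> ((Id B ?U \<odot>\<^sub>2 lunit B M) \<odot>\<^sub>2 Id B N)) \<cdot>
      (assoc B ?U ?U M \<odot>\<^sub>2 Id B N)"
    by simp
  also have "\<dots> = (Id B ?U \<odot>\<^sub>2 (lunit B M \<odot>\<^sub>2 Id B N)) \<cdot> ?x"
    unfolding n1[symmetric] by simp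
  finally show "Id B ?U \<odot>\<^sub>2 ?f = Id B ?U \<odot>\<^sub>2 (lunit B M \<odot>\<^sub>2 Id B N)"
    by (rule iso_cancel_right[OF iso]) auto
qed (use assms in auto)

text \<open>Naturality of \<open>l\<close> at \<open>l\<^bsub>U\<^esub>\<close> gives \<open>1 \<odot> l\<^bsub>U\<^esub> = l\<^bsub>U \<odot> U\<^esub>\<close>. Hence the coherence of \<open>l\<close> and the
  triangle express \<open>l\<^bsub>U\<^esub> \<odot> 1\<close> and \<open>r\<^bsub>U\<^esub> \<odot> 1\<close> by the same composite.\<close>

lemma lunit_U_eq_runit_U:
  assumes [simp]: "R \<in> Cell0 B"
  shows "lunit B (U B R) = runit B (U B R)"
proof (rule whisker_right_U_cancel[where S = R])
  let ?U = "U B R"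
  have "lunit B ?U \<cdot> (Id B ?U \<odot>\<^sub>2 lunit B ?U) = lunit B ?U \<cdot> lunit B (?U \<odot> ?U)"
    by (rule lunit_natural) auto
  then have l: "Id B ?U \<odot>\<^sub>2 lunit B ?U = lunit B (?U \<odot> ?U)"
    by (rule iso_cancel_left[rotated]) auto
  have "lunit B ?U \<odot>\<^sub>2 Id B ?U = lunit B (?U \<odot> ?U) \<cdot> assoc B ?U ?U ?U"
    by (rule lunit_HComp[symmetric]) auto
  also have "\<dots> = runit B ?U \<odot>\<^sub>2 Id B ?U"
    unfolding l[symmetric] by (rule triangle_simp) auto
  finally show "lunit B ?U \<odot>\<^sub>2 Id B ?U = runit B ?U \<odot>\<^sub>2 Id B ?U" .
qed auto

end

section \<open>Dual pairs\<close>

context bicategory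
begin

lemma dual_pairD:
  assumes "dual_pair B M M' \<eta> \<epsilon>"
  shows "M \<in> Ob B" "M' \<in> Ob B" "Src B M' = Trg B M" "Trg B M' = Src B M"
    "\<eta> \<in> Ar B" "Dom B \<eta> = U B (Src B M)" "Cod B \<eta> = M \<odot> M'"
    "\<epsilon> \<in> Ar B" "Dom B \<epsilon> = M' \<odot> M" "Cod B \<epsilon> = U B (Trg B M)"
  using assms by (auto simp: dual_pair_def Hom1_def hom_def)

lemma dual_pair_zigzag:
  assumes "dual_pair B M M' \<eta> \<epsilon>"
  shows "runit B M \<cdot> (Id B M \<odot>\<^sub>2 \<epsilon>) \<cdot> assoc B M M' M \<cdot> (\<eta> \<odot>\<^sub>2 Id B M) \<cdot> inv_ar B (lunit B M) = Id B M"
    "lunit B M' \<cdot> (\<epsilon> \<odot>\<^sub>2 Id B M') \<cdot> inv_ar B (assoc B M' M M') \<cdot> (Id B M' \<odot>\<^sub>2 \<eta>) \<cdot>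
      inv_ar B (runit B M') = Id B M'"
  using assms by (auto simp: dual_pair_def)

text \<open>For a dual pair the functor \<open>- \<odot> M\<close> is left adjoint to \<open>- \<odot> M'\<close>. The two maps below are its
  transpositions between 2-cells \<open>X \<Rightarrow> Y \<odot> M'\<close> and \<open>X \<odot> M \<Rightarrow> Y\<close>.\<close>

definition lower :: "'m \<Rightarrow> 'm \<Rightarrow> 'c \<Rightarrow> 'm \<Rightarrow> 'c \<Rightarrow> 'c" where
  "lower M M' \<epsilon> Y x = runit B Y \<cdot> (Id B Y \<odot>\<^sub>2 \<epsilon>) \<cdot> assoc B Y M' M \<cdot> (x \<odot>\<^sub>2 Id B M)"

definition raise :: "'m \<Rightarrow> 'm \<Rightarrow> 'c \<Rightarrow> 'm \<Rightarrow> 'c \<Rightarrow> 'c" where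
  "raise M M' \<eta> X g = (g \<odot>\<^sub>2 Id B M') \<cdot> inv_ar B (assoc B X M M') \<cdot> (Id B X \<odot>\<^sub>2 \<eta>) \<cdot> inv_ar B (runit B X)"

text \<open>One half of the adjunction: naturality moves \<open>g\<close> to the front, and what remains is the first
  triangle identity whiskered by \<open>X\<close>. The coherence \<open>runit_HComp\<close> and the triangle bring the unitors
  of \<open>X \<odot> M\<close> into that form.\<close>

lemma lower_raise:
  assumes d: "dual_pair B M M' \<eta> \<epsilon>"
    and g: "g \<in> Ar B" "Dom B g = X \<odot> M" "Cod B g = Y" and X: "X \<in> Ob B" "Trg B X = Src B M"
  shows "lower M M' \<epsilon> Y (raise M M' \<eta> X g) = g"
proof -
  note [simp] = dual_pairD[OF d] g(1,2) g(3)[symmetric] X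
  have [simp]: "Src B Y = Src B X" "Trg B Y = Trg B M"
    using parallel_simps[of g] by (simp_all del: parallel_simps)
  let ?U = "U B (Trg B M)"
  let ?XM = "X \<odot> M"
  have n1: "assoc B (Cod B g) M' M \<cdot> ((g \<odot>\<^sub>2 Id B M') \<odot>\<^sub>2 Id B M) =
      (g \<odot>\<^sub>2 (Id B M' \<odot>\<^sub>2 Id B M)) \<cdot> assoc B ?XM M' M"
    by (intro assoc_natural) auto
  have n2: "runit B (Cod B g) \<cdot> (g \<odot>\<^sub>2 Id B ?U) = g \<cdot> runit B ?XM"
    by (intro runit_natural) auto
  have n3: "assoc B X (M \<odot> M') M \<cdot> ((Id B X \<odot>\<^sub>2 \<eta>) \<odot>\<^sub>2 Id B M) =
      (Id B X \<odot>\<^sub>2 (\<eta> \<odot>\<^sub>2 Id B M)) \<cdot> assoc B X (U B (Src B M)) M"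
    by (intro assoc_natural) auto
  have n4: "(Id B X \<odot>\<^sub>2 (Id B M \<odot>\<^sub>2 \<epsilon>)) \<cdot> assoc B X M (M' \<odot> M) =
      assoc B X M ?U \<cdot> ((Id B X \<odot>\<^sub>2 Id B M) \<odot>\<^sub>2 \<epsilon>)"
    by (intro assoc_natural[symmetric]) auto
  have p: "(Id B X \<odot>\<^sub>2 assoc B M M' M) \<cdot> assoc B X (M \<odot> M') M \<cdot> (assoc B X M M' \<odot>\<^sub>2 Id B M) =
      assoc B X M (M' \<odot> M) \<cdot> assoc B ?XM M' M"
    by (intro pentagon_simp) auto
  have t: "(Id B X \<odot>\<^sub>2 lunit B M) \<cdot> assoc B X (U B (Src B M)) M = runit B X \<odot>\<^sub>2 Id B M"
    by (intro triangle_simp) auto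
  have k: "(Id B X \<odot>\<^sub>2 runit B M) \<cdot> assoc B X M ?U = runit B ?XM"
    by (intro runit_HComp) auto
  let ?w = "((inv_ar B (assoc B X M M') \<cdot> (Id B X \<odot>\<^sub>2 \<eta>) \<cdot> inv_ar B (runit B X)) \<odot>\<^sub>2 Id B M)"
  have w: "?w = (inv_ar B (assoc B X M M') \<odot>\<^sub>2 Id B M) \<cdot> ((Id B X \<odot>\<^sub>2 \<eta>) \<odot>\<^sub>2 Id B M) \<cdot>
      (inv_ar B (runit B X) \<odot>\<^sub>2 Id B M)"
    by simp
  have t': "assoc B X (U B (Src B M)) M \<cdot> (inv_ar B (runit B X) \<odot>\<^sub>2 Id B M) =
      Id B X \<odot>\<^sub>2 inv_ar B (lunit B M)"
  proof -
    have "assoc B X (U B (Src B M)) M \<cdot> (inv_ar B (runit B X) \<odot>\<^sub>2 Id B M) =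
        (Id B X \<odot>\<^sub>2 inv_ar B (lunit B M)) \<cdot> ((Id B X \<odot>\<^sub>2 lunit B M) \<cdot> assoc B X (U B (Src B M)) M) \<cdot>
          (inv_ar B (runit B X) \<odot>\<^sub>2 Id B M)"
      by simp
    also have "\<dots> = Id B X \<odot>\<^sub>2 inv_ar B (lunit B M)"
      unfolding t by simp
    finally show ?thesis .
  qed
  have "lower M M' \<epsilon> Y (raise M M' \<eta> X g) = runit B (Cod B g) \<cdot> (Id B (Cod B g) \<odot>\<^sub>2 \<epsilon>) \<cdot>
      (assoc B (Cod B g) M' M \<cdot> ((g \<odot>\<^sub>2 Id B M') \<odot>\<^sub>2 Id B M)) \<cdot> ?w"
    unfolding lower_def raise_def by simp
  also have "\<dots> = (runit B (Cod B g) \<cdot> (g \<odot>\<^sub>2 Id B ?U)) \<cdot> (Id B ?XM \<odot>\<^sub>2 \<epsilon>) \<cdot> assoc B ?XM M' M \<cdot> ?w"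
    unfolding n1 by simp
  also have "\<dots> = (g \<cdot> runit B ?XM) \<cdot> (Id B ?XM \<odot>\<^sub>2 \<epsilon>) \<cdot> assoc B ?XM M' M \<cdot> ?w"
    unfolding n2 ..
  also have "\<dots> = g \<cdot> (Id B X \<odot>\<^sub>2 runit B M) \<cdot>
      (assoc B X M ?U \<cdot> ((Id B X \<odot>\<^sub>2 Id B M) \<odot>\<^sub>2 \<epsilon>)) \<cdot> assoc B ?XM M' M \<cdot> ?w"
    unfolding k[symmetric] by simp
  also have "\<dots> = g \<cdot> (Id B X \<odot>\<^sub>2 runit B M) \<cdot> (Id B X \<odot>\<^sub>2 (Id B M \<odot>\<^sub>2 \<epsilon>)) \<cdot>
      (assoc B X M (M' \<odot> M) \<cdot> assoc B ?XM M' M) \<cdot> ?w"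
    unfolding n4[symmetric] by simp
  also have "\<dots> = g \<cdot> (Id B X \<odot>\<^sub>2 runit B M) \<cdot> (Id B X \<odot>\<^sub>2 (Id B M \<odot>\<^sub>2 \<epsilon>)) \<cdot>
      (Id B X \<odot>\<^sub>2 assoc B M M' M) \<cdot> (assoc B X (M \<odot> M') M \<cdot> ((Id B X \<odot>\<^sub>2 \<eta>) \<odot>\<^sub>2 Id B M)) \<cdot>
      (inv_ar B (runit B X) \<odot>\<^sub>2 Id B M)"
    unfolding p[symmetric] w by simp
  also have "\<dots> = g \<cdot> (Id B X \<odot>\<^sub>2 runit B M) \<cdot> (Id B X \<odot>\<^sub>2 (Id B M \<odot>\<^sub>2 \<epsilon>)) \<cdot>
      (Id B X \<odot>\<^sub>2 assoc B M M' M) \<cdot> (Id B X \<odot>\<^sub>2 (\<eta> \<odot>\<^sub>2 Id B M)) \<cdot>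
      (assoc B X (U B (Src B M)) M \<cdot> (inv_ar B (runit B X) \<odot>\<^sub>2 Id B M))"
    unfolding n3 by simp
  also have "\<dots> = g"
    unfolding t' by (simp add: dual_pair_zigzag(1)[OF d])
  finally show ?thesis .
qed

text \<open>The other half: naturality moves \<open>x\<close> to the end, and what remains is the second triangle
  identity whiskered by \<open>Y\<close>.\<close>

lemma raise_lower:
  assumes d: "dual_pair B M M' \<eta> \<epsilon>"
    and x: "x \<in> Ar B" "Dom B x = X" "Cod B x = Y \<odot> M'" and Y: "Y \<in> Ob B" "Trg B Y = Trg B M"
  shows "raise M M' \<eta> X (lower M M' \<epsilon> Y x) = x"
proof -
  note [simp] = dual_pairD[OF d] x(1,3) x(2)[symmetric] Y
  have [simp]: "Trg B (Dom B x) = Src B M" "Src B (Dom B x) = Src B Y"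
    using parallel_simps[of x] by (simp_all del: parallel_simps)
  let ?YM = "Y \<odot> M'"
  let ?U = "U B (Src B M)"
  let ?V = "U B (Trg B M)"
  have n1: "((x \<odot>\<^sub>2 Id B M) \<odot>\<^sub>2 Id B M') \<cdot> inv_ar B (assoc B (Dom B x) M M') =
      inv_ar B (assoc B ?YM M M') \<cdot> (x \<odot>\<^sub>2 (Id B M \<odot>\<^sub>2 Id B M'))"
    by (intro inv_assoc_natural) auto
  have n2: "(x \<odot>\<^sub>2 Id B ?U) \<cdot> inv_ar B (runit B (Dom B x)) = inv_ar B (runit B ?YM) \<cdot> x"
  proof (rule iso_cancel_left)
    have "runit B ?YM \<cdot> (x \<odot>\<^sub>2 Id B ?U) \<cdot> inv_ar B (runit B (Dom B x)) =
        (x \<cdot> runit B (Dom B x)) \<cdot> inv_ar B (runit B (Dom B x))"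
      by (intro extend runit_natural) auto
    then show "runit B ?YM \<cdot> (x \<odot>\<^sub>2 Id B ?U) \<cdot> inv_ar B (runit B (Dom B x)) =
        runit B ?YM \<cdot> inv_ar B (runit B ?YM) \<cdot> x"
      by simp
  qed auto
  have n3: "((Id B Y \<odot>\<^sub>2 Id B M') \<odot>\<^sub>2 \<eta>) \<cdot> inv_ar B (assoc B Y M' ?U) =
      inv_ar B (assoc B Y M' (M \<odot> M')) \<cdot> (Id B Y \<odot>\<^sub>2 (Id B M' \<odot>\<^sub>2 \<eta>))"
    by (intro inv_assoc_natural) auto
  have n4: "((Id B Y \<odot>\<^sub>2 \<epsilon>) \<odot>\<^sub>2 Id B M') \<cdot> inv_ar B (assoc B Y (M' \<odot> M) M') =
      inv_ar B (assoc B Y ?V M') \<cdot> (Id B Y \<odot>\<^sub>2 (\<epsilon> \<odot>\<^sub>2 Id B M'))"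
    by (intro inv_assoc_natural) auto
  have k: "inv_ar B (runit B ?YM) = inv_ar B (assoc B Y M' ?U) \<cdot> (Id B Y \<odot>\<^sub>2 inv_ar B (runit B M'))"
  proof (rule inv_ar_eqI(2))
    have "(Id B Y \<odot>\<^sub>2 runit B M') \<cdot> assoc B Y M' ?U = runit B ?YM"
      by (intro runit_HComp) auto
    then have e: "runit B ?YM = (Id B Y \<odot>\<^sub>2 runit B M') \<cdot> assoc B Y M' ?U" ..
    show "(inv_ar B (assoc B Y M' ?U) \<cdot> (Id B Y \<odot>\<^sub>2 inv_ar B (runit B M'))) \<cdot> runit B ?YM =
        Id B (Dom B (runit B ?YM))"
      unfolding e by simp
    show "runit B ?YM \<cdot> (inv_ar B (assoc B Y M' ?U) \<cdot> (Id B Y \<odot>\<^sub>2 inv_ar B (runit B M'))) =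
        Id B (Cod B (runit B ?YM))"
      unfolding e by simp
  qed auto
  have p: "(assoc B Y M' M \<odot>\<^sub>2 Id B M') \<cdot> inv_ar B (assoc B ?YM M M') \<cdot>
      inv_ar B (assoc B Y M' (M \<odot> M')) =
      inv_ar B (assoc B Y (M' \<odot> M) M') \<cdot> (Id B Y \<odot>\<^sub>2 inv_ar B (assoc B M' M M'))" (is "?l = ?r")
  proof -
    have "?l = inv_ar B (assoc B Y (M' \<odot> M) M') \<cdot> (Id B Y \<odot>\<^sub>2 inv_ar B (assoc B M' M M')) \<cdot>
      ((Id B Y \<odot>\<^sub>2 assoc B M' M M') \<cdot> assoc B Y (M' \<odot> M) M' \<cdot> (assoc B Y M' M \<odot>\<^sub>2 Id B M')) \<cdot>
      inv_ar B (assoc B ?YM M M') \<cdot> inv_ar B (assoc B Y M' (M \<odot> M'))"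
      by simp
    also have "(Id B Y \<odot>\<^sub>2 assoc B M' M M') \<cdot> assoc B Y (M' \<odot> M) M' \<cdot> (assoc B Y M' M \<odot>\<^sub>2 Id B M') =
      assoc B Y M' (M \<odot> M') \<cdot> assoc B ?YM M M'"
      by (intro pentagon_simp) auto
    finally show ?thesis
      by simp
  qed
  have t: "(runit B Y \<odot>\<^sub>2 Id B M') \<cdot> inv_ar B (assoc B Y ?V M') = Id B Y \<odot>\<^sub>2 lunit B M'"
  proof -
    have "(Id B Y \<odot>\<^sub>2 lunit B M') \<cdot> assoc B Y ?V M' = runit B Y \<odot>\<^sub>2 Id B M'"
      by (intro triangle_simp) auto
    then have e: "runit B Y \<odot>\<^sub>2 Id B M' = (Id B Y \<odot>\<^sub>2 lunit B M') \<cdot> assoc B Y ?V M'" ..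
    show ?thesis
      unfolding e by simp
  qed
  have "raise M M' \<eta> X (lower M M' \<epsilon> Y x) =
      ((runit B Y \<cdot> (Id B Y \<odot>\<^sub>2 \<epsilon>) \<cdot> assoc B Y M' M) \<odot>\<^sub>2 Id B M') \<cdot>
      (((x \<odot>\<^sub>2 Id B M) \<odot>\<^sub>2 Id B M') \<cdot> inv_ar B (assoc B (Dom B x) M M')) \<cdot>
      (Id B (Dom B x) \<odot>\<^sub>2 \<eta>) \<cdot> inv_ar B (runit B (Dom B x))"
    unfolding lower_def raise_def by simp
  also have "\<dots> = ((runit B Y \<cdot> (Id B Y \<odot>\<^sub>2 \<epsilon>) \<cdot> assoc B Y M' M) \<odot>\<^sub>2 Id B M') \<cdot>
      inv_ar B (assoc B ?YM M M') \<cdot>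
      (Id B ?YM \<odot>\<^sub>2 \<eta>) \<cdot> ((x \<odot>\<^sub>2 Id B ?U) \<cdot> inv_ar B (runit B (Dom B x)))"
    unfolding n1 by simp
  also have "\<dots> = ((runit B Y \<cdot> (Id B Y \<odot>\<^sub>2 \<epsilon>) \<cdot> assoc B Y M' M) \<odot>\<^sub>2 Id B M') \<cdot>
      inv_ar B (assoc B ?YM M M') \<cdot>
      (((Id B Y \<odot>\<^sub>2 Id B M') \<odot>\<^sub>2 \<eta>) \<cdot> inv_ar B (assoc B Y M' ?U)) \<cdot> (Id B Y \<odot>\<^sub>2 inv_ar B (runit B M')) \<cdot> x"
    unfolding n2 k by simp
  also have "\<dots> = ((runit B Y \<cdot> (Id B Y \<odot>\<^sub>2 \<epsilon>)) \<odot>\<^sub>2 Id B M') \<cdot>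
      ((assoc B Y M' M \<odot>\<^sub>2 Id B M') \<cdot> inv_ar B (assoc B ?YM M M') \<cdot>
        inv_ar B (assoc B Y M' (M \<odot> M'))) \<cdot> (Id B Y \<odot>\<^sub>2 ((Id B M' \<odot>\<^sub>2 \<eta>) \<cdot> inv_ar B (runit B M'))) \<cdot> x"
    unfolding n3 by simp
  also have "\<dots> = (runit B Y \<odot>\<^sub>2 Id B M') \<cdot>
      (((Id B Y \<odot>\<^sub>2 \<epsilon>) \<odot>\<^sub>2 Id B M') \<cdot> inv_ar B (assoc B Y (M' \<odot> M) M')) \<cdot>
      (Id B Y \<odot>\<^sub>2 (inv_ar B (assoc B M' M M') \<cdot> (Id B M' \<odot>\<^sub>2 \<eta>) \<cdot> inv_ar B (runit B M'))) \<cdot> x"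
    unfolding p by simp
  also have "\<dots> = ((runit B Y \<odot>\<^sub>2 Id B M') \<cdot> inv_ar B (assoc B Y ?V M')) \<cdot>
      (Id B Y \<odot>\<^sub>2 ((\<epsilon> \<odot>\<^sub>2 Id B M') \<cdot> inv_ar B (assoc B M' M M') \<cdot> (Id B M' \<odot>\<^sub>2 \<eta>) \<cdot>
        inv_ar B (runit B M'))) \<cdot> x"
    unfolding n4 by simp
  also have "\<dots> = x"
    unfolding t by (simp add: dual_pair_zigzag(2)[OF d])
  finally show ?thesis .
qed

lemma dual_pair_zigzag_lunit:
  assumes d: "dual_pair B M M' \<eta> \<epsilon>"
  shows "runit B M \<cdot> (Id B M \<odot>\<^sub>2 \<epsilon>) \<cdot> assoc B M M' M \<cdot> (\<eta> \<odot>\<^sub>2 Id B M) = lunit B M"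
proof (rule iso_cancel_right)
  note [simp] = dual_pairD[OF d]
  show "is_iso B (inv_ar B (lunit B M))"
    by simp
  show "(runit B M \<cdot> (Id B M \<odot>\<^sub>2 \<epsilon>) \<cdot> assoc B M M' M \<cdot> (\<eta> \<odot>\<^sub>2 Id B M)) \<cdot> inv_ar B (lunit B M) =
      lunit B M \<cdot> inv_ar B (lunit B M)"
    using dual_pair_zigzag(1)[OF d] by simp
qed (use dual_pairD[OF d] in auto)

text \<open>The 2-cell \<open>u\<close> corresponds to the counit \<open>\<epsilon>\<close> under the adjunction given by the second dual, so
  the equation for the counits is the adjunction itself. The equation for the units holds because
  both sides have the same image under the adjunction, namely the left unitor of \<open>M\<close>, by the first
  triangle identity of either pair.\<close>

lemma dual_comparison:
  assumes d: "dual_pair B M M' \<eta> \<epsilon>" and d2: "dual_pair B M M'' \<eta>' \<epsilon>'"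
  obtains u where "u \<in> Ar B" "Dom B u = M'" "Cod B u = M''"
    "\<epsilon>' \<cdot> (u \<odot>\<^sub>2 Id B M) = \<epsilon>" "(Id B M \<odot>\<^sub>2 u) \<cdot> \<eta> = \<eta>'"
proof -
  note [simp] = dual_pairD[OF d] dual_pairD[OF d2]
  let ?U = "U B (Trg B M)"
  \<comment> \<open>The adjunction only yields a 2-cell into \<open>U \<odot> M''\<close>, which is why a left unitor follows it and
    why \<open>lunit_HComp\<close> and \<open>l\<^bsub>U\<^esub> = r\<^bsub>U\<^esub>\<close> enter.\<close>
  define u\<^sub>0 where "u\<^sub>0 = raise M M'' \<eta>' M' \<epsilon>"
  have [simp]: "u\<^sub>0 \<in> Ar B" "Dom B u\<^sub>0 = M'" "Cod B u\<^sub>0 = ?U \<odot> M''"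
    by (simp_all add: u\<^sub>0_def raise_def)
  have l: "lower M M'' \<epsilon>' ?U u\<^sub>0 = \<epsilon>"
    unfolding u\<^sub>0_def by (rule lower_raise[OF d2]) auto
  define u where "u = lunit B M'' \<cdot> u\<^sub>0"
  have [simp]: "u \<in> Ar B" "Dom B u = M'" "Cod B u = M''"
    by (simp_all add: u_def)
  have n: "lunit B ?U \<cdot> (Id B ?U \<odot>\<^sub>2 \<epsilon>') = \<epsilon>' \<cdot> lunit B (M'' \<odot> M)"
    by (rule lunit_natural) auto
  have k: "lunit B (M'' \<odot> M) \<cdot> assoc B ?U M'' M = lunit B M'' \<odot>\<^sub>2 Id B M"
    by (rule lunit_HComp) auto
  have "\<epsilon>' \<cdot> (u \<odot>\<^sub>2 Id B M) = \<epsilon>' \<cdot> (lunit B (M'' \<odot> M) \<cdot> assoc B ?U M'' M) \<cdot> (u\<^sub>0 \<odot>\<^sub>2 Id B M)"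
    unfolding k by (simp add: u_def)
  also have "\<dots> = (lunit B ?U \<cdot> (Id B ?U \<odot>\<^sub>2 \<epsilon>')) \<cdot> assoc B ?U M'' M \<cdot> (u\<^sub>0 \<odot>\<^sub>2 Id B M)"
    unfolding n by simp
  also have "\<dots> = \<epsilon>"
    unfolding l[symmetric] lower_def lunit_U_eq_runit_U[OF Cell0_simps(2)[OF dual_pairD(1)[OF d]]]
    by simp
  finally have eps: "\<epsilon>' \<cdot> (u \<odot>\<^sub>2 Id B M) = \<epsilon>" .
  have n2: "assoc B M M'' M \<cdot> ((Id B M \<odot>\<^sub>2 u) \<odot>\<^sub>2 Id B M) =
      (Id B M \<odot>\<^sub>2 (u \<odot>\<^sub>2 Id B M)) \<cdot> assoc B M M' M"
    by (rule assoc_natural) auto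
  let ?x = "(Id B M \<odot>\<^sub>2 u) \<cdot> \<eta>"
  have "lower M M'' \<epsilon>' M ?x = runit B M \<cdot> (Id B M \<odot>\<^sub>2 \<epsilon>') \<cdot>
      (assoc B M M'' M \<cdot> ((Id B M \<odot>\<^sub>2 u) \<odot>\<^sub>2 Id B M)) \<cdot> (\<eta> \<odot>\<^sub>2 Id B M)"
    unfolding lower_def by simp
  also have "\<dots> = lunit B M"
    unfolding n2 by (simp add: eps dual_pair_zigzag_lunit[OF d])
  also have "\<dots> = lower M M'' \<epsilon>' M \<eta>'"
    unfolding lower_def by (rule dual_pair_zigzag_lunit[OF d2, symmetric])
  finally have low: "lower M M'' \<epsilon>' M ?x = lower M M'' \<epsilon>' M \<eta>'" .
  have "?x = raise M M'' \<eta>' (U B (Src B M)) (lower M M'' \<epsilon>' M ?x)"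
    by (rule raise_lower[OF d2, symmetric]) auto
  also have "\<dots> = \<eta>'"
    unfolding low by (rule raise_lower[OF d2]) auto
  finally have eta: "?x = \<eta>'" .
  show thesis
    by (rule that[of u]) (auto simp: eps eta)
qed

end

section \<open>Transposition in closed bicategories\<close>

context closed_bicategory
begin

lemma LHom1_simps [simp]:
  assumes "M \<in> Ob B" "P \<in> Ob B" "Src B M = Src B P"
  shows "P \<triangleleft> M \<in> Ob B" "Src B (P \<triangleleft> M) = Trg B M" "Trg B (P \<triangleleft> M) = Trg B P"
  using cat_functorD(1)[OF LHom_functor[of "Src B M" "Trg B M" "Trg B P"], of "(P, M)"] assms
  by (auto simp: Hom1_def)

lemma RHom1_simps [simp]:
  assumes "N \<in> Ob B" "P \<in> Ob B" "Trg B N = Trg B P"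
  shows "N \<triangleright> P \<in> Ob B" "Src B (N \<triangleright> P) = Src B P" "Trg B (N \<triangleright> P) = Src B N"
  using cat_functorD(1)[OF RHom_functor[of "Src B P" "Src B N" "Trg B N"], of "(N, P)"] assms
  by (auto simp: Hom1_def)

lemma LHom2_simps [simp]:
  assumes "m \<in> Ar B" "p \<in> Ar B" "Src B (Dom B m) = Src B (Dom B p)"
  shows "p \<triangleleft>\<^sub>2 m \<in> Ar B" "Dom B (p \<triangleleft>\<^sub>2 m) = Dom B p \<triangleleft> Cod B m"
    "Cod B (p \<triangleleft>\<^sub>2 m) = Cod B p \<triangleleft> Dom B m"
  using cat_functorD(2-4)[OF LHom_functor[of "Src B (Dom B m)" "Trg B (Dom B m)" "Trg B (Dom B p)"],
      of "(p, m)"] assms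
  by (auto simp: Hom1_def)

lemma RHom2_simps [simp]:
  assumes "n \<in> Ar B" "p \<in> Ar B" "Trg B (Dom B n) = Trg B (Dom B p)"
  shows "n \<triangleright>\<^sub>2 p \<in> Ar B" "Dom B (n \<triangleright>\<^sub>2 p) = Cod B n \<triangleright> Dom B p"
    "Cod B (n \<triangleright>\<^sub>2 p) = Dom B n \<triangleright> Cod B p"
  using cat_functorD(2-4)[OF RHom_functor[of "Src B (Dom B p)" "Src B (Dom B n)" "Trg B (Dom B n)"],
      of "(n, p)"] assms
  by (auto simp: Hom1_def)

lemma transpose_bij:
  assumes "M \<in> Ob B" "N \<in> Ob B" "Trg B M = Src B N" "P \<in> Ob B" "Src B P = Src B M" "Trg B P = Trg B N"
  shows "bij_betw (trL B M N) (hom B (M \<odot> N) P) (hom B N (P \<triangleleft> M))"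
    and "bij_betw (trR B M N) (hom B (M \<odot> N) P) (hom B M (N \<triangleright> P))"
  using assms by (intro trL_bij trR_bij; auto simp: Hom1_def)+

lemma Cod_HComp1:
  assumes "h \<in> Ar B" "Dom B h = M \<odot> N" "M \<in> Ob B" "N \<in> Ob B" "Trg B M = Src B N"
  shows "Src B (Cod B h) = Src B M" "Trg B (Cod B h) = Trg B N"
  using assms by auto

lemma trL_simps [simp]:
  assumes "h \<in> Ar B" "Dom B h = M \<odot> N" "M \<in> Ob B" "N \<in> Ob B" "Trg B M = Src B N"
  shows "trL B M N h \<in> Ar B" "Dom B (trL B M N h) = N" "Cod B (trL B M N h) = Cod B h \<triangleleft> M"
  using bij_betw_apply[OF transpose_bij(1)[of M N "Cod B h"], of h] assms
  by (auto simp: hom_def)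

lemma trR_simps [simp]:
  assumes "h \<in> Ar B" "Dom B h = M \<odot> N" "M \<in> Ob B" "N \<in> Ob B" "Trg B M = Src B N"
  shows "trR B M N h \<in> Ar B" "Dom B (trR B M N h) = M" "Cod B (trR B M N h) = N \<triangleright> Cod B h"
  using bij_betw_apply[OF transpose_bij(2)[of M N "Cod B h"], of h] assms
  by (auto simp: hom_def)

lemma trL_inject:
  assumes "trL B M N h = trL B M N h'" "h \<in> Ar B" "Dom B h = M \<odot> N" "h' \<in> Ar B" "Dom B h' = M \<odot> N"
    "Cod B h' = Cod B h" "M \<in> Ob B" "N \<in> Ob B" "Trg B M = Src B N"
  shows "h = h'"
  using bij_betw_imp_inj_on[OF transpose_bij(1)[of M N "Cod B h"]] assms
  by (auto simp: hom_def dest: inj_onD)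

lemma trR_inject:
  assumes "trR B M N h = trR B M N h'" "h \<in> Ar B" "Dom B h = M \<odot> N" "h' \<in> Ar B" "Dom B h' = M \<odot> N"
    "Cod B h' = Cod B h" "M \<in> Ob B" "N \<in> Ob B" "Trg B M = Src B N"
  shows "h = h'"
  using bij_betw_imp_inj_on[OF transpose_bij(2)[of M N "Cod B h"]] assms
  by (auto simp: hom_def dest: inj_onD)

lemma LHom2_Id [simp]:
  assumes "M \<in> Ob B" "P \<in> Ob B" "Src B M = Src B P"
  shows "Id B P \<triangleleft>\<^sub>2 Id B M = Id B (P \<triangleleft> M)"
  using cat_functorD(5)[OF LHom_functor[of "Src B M" "Trg B M" "Trg B P"], of "(P, M)"] assms
  by (auto simp: Hom1_def)

lemma RHom2_Id [simp]:
  assumes "N \<in> Ob B" "P \<in> Ob B" "Trg B N = Trg B P"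
  shows "Id B N \<triangleright>\<^sub>2 Id B P = Id B (N \<triangleright> P)"
  using cat_functorD(5)[OF RHom_functor[of "Src B P" "Src B N" "Trg B N"], of "(N, P)"] assms
  by (auto simp: Hom1_def)

lemma trL_precomp [simp]:
  assumes "h \<in> Ar B" "Dom B h = M \<odot> N" "M \<in> Ob B" "N \<in> Ob B" "Trg B M = Src B N"
    "x \<in> Ar B" "Cod B x = N"
  shows "trL B M N h \<cdot> x = trL B M (Dom B x) (h \<cdot> (Id B M \<odot>\<^sub>2 x))"
  using trL_natural[of M "Src B M" "Trg B M" N "Trg B N" "Cod B h" h "Id B M" M x "Dom B x"
      "Id B (Cod B h)" "Cod B h"] assms parallel_simps[of x]
  by (auto simp: Hom1_def hom_def)

lemma trR_precomp [simp]:
  assumes "h \<in> Ar B" "Dom B h = M \<odot> N" "M \<in> Ob B" "N \<in> Ob B" "Trg B M = Src B N"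
    "x \<in> Ar B" "Cod B x = M"
  shows "trR B M N h \<cdot> x = trR B (Dom B x) N (h \<cdot> (x \<odot>\<^sub>2 Id B N))"
  using trR_natural[of M "Src B M" "Trg B M" N "Trg B N" "Cod B h" h x "Dom B x" "Id B N" N
      "Id B (Cod B h)" "Cod B h"] assms parallel_simps[of x]
  by (auto simp: Hom1_def hom_def)

lemma trL_postcomp [simp]:
  assumes "h \<in> Ar B" "Dom B h = M \<odot> N" "M \<in> Ob B" "N \<in> Ob B" "Trg B M = Src B N"
    "m \<in> Ar B" "Cod B m = M" "p \<in> Ar B" "Dom B p = Cod B h"
  shows "(p \<triangleleft>\<^sub>2 m) \<cdot> trL B M N h = trL B (Dom B m) N (p \<cdot> h \<cdot> (m \<odot>\<^sub>2 Id B N))"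
  using trL_natural[of M "Src B M" "Trg B M" N "Trg B N" "Cod B h" h m "Dom B m" "Id B N" N
      p "Cod B p"] assms parallel_simps[of m]
  by (auto simp: Hom1_def hom_def)

lemma trR_postcomp [simp]:
  assumes "h \<in> Ar B" "Dom B h = M \<odot> N" "M \<in> Ob B" "N \<in> Ob B" "Trg B M = Src B N"
    "n \<in> Ar B" "Cod B n = N" "p \<in> Ar B" "Dom B p = Cod B h"
  shows "(n \<triangleright>\<^sub>2 p) \<cdot> trR B M N h = trR B M (Dom B n) (p \<cdot> h \<cdot> (Id B M \<odot>\<^sub>2 n))"
  using trR_natural[of M "Src B M" "Trg B M" N "Trg B N" "Cod B h" h "Id B M" M n "Dom B n"
      p "Cod B p"] assms parallel_simps[of n]
  by (auto simp: Hom1_def hom_def)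

lemma untrL_simps:
  assumes "M \<in> Ob B" "N \<in> Ob B" "Trg B M = Src B N" "P \<in> Ob B" "Src B P = Src B M" "Trg B P = Trg B N"
    "g \<in> Ar B" "Dom B g = N" "Cod B g = P \<triangleleft> M"
  shows "untrL B M N P g \<in> Ar B" "Dom B (untrL B M N P g) = M \<odot> N" "Cod B (untrL B M N P g) = P"
    "trL B M N (untrL B M N P g) = g"
proof -
  note b = transpose_bij(1)[OF assms(1-6)]
  have g: "g \<in> hom B N (P \<triangleleft> M)"
    using assms by (simp add: hom_def)
  then show "trL B M N (untrL B M N P g) = g"
    unfolding untrL_def by (rule bij_betw_inv_into_right[OF b])
  have "untrL B M N P g \<in> hom B (M \<odot> N) P"
    unfolding untrL_def using g by (rule bij_betw_apply[OF bij_betw_inv_into[OF b]])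
  then show "untrL B M N P g \<in> Ar B" "Dom B (untrL B M N P g) = M \<odot> N" "Cod B (untrL B M N P g) = P"
    by (auto simp: hom_def)
qed

lemma untrR_simps:
  assumes "M \<in> Ob B" "N \<in> Ob B" "Trg B M = Src B N" "P \<in> Ob B" "Src B P = Src B M" "Trg B P = Trg B N"
    "g \<in> Ar B" "Dom B g = M" "Cod B g = N \<triangleright> P"
  shows "untrR B M N P g \<in> Ar B" "Dom B (untrR B M N P g) = M \<odot> N" "Cod B (untrR B M N P g) = P"
    "trR B M N (untrR B M N P g) = g"
proof -
  note b = transpose_bij(2)[OF assms(1-6)]
  have g: "g \<in> hom B M (N \<triangleright> P)"
    using assms by (simp add: hom_def)
  then show "trR B M N (untrR B M N P g) = g"
    unfolding untrR_def by (rule bij_betw_inv_into_right[OF b])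
  have "untrR B M N P g \<in> hom B (M \<odot> N) P"
    unfolding untrR_def using g by (rule bij_betw_apply[OF bij_betw_inv_into[OF b]])
  then show "untrR B M N P g \<in> Ar B" "Dom B (untrR B M N P g) = M \<odot> N" "Cod B (untrR B M N P g) = P"
    by (auto simp: hom_def)
qed

lemma evL_simps [simp]:
  assumes "M \<in> Ob B" "P \<in> Ob B" "Src B M = Src B P"
  shows "evL B M P \<in> Ar B" "Dom B (evL B M P) = M \<odot> (P \<triangleleft> M)" "Cod B (evL B M P) = P"
    "trL B M (P \<triangleleft> M) (evL B M P) = Id B (P \<triangleleft> M)"
  unfolding evL_def using assms by (simp_all add: untrL_simps)

lemma evR_simps [simp]:
  assumes "N \<in> Ob B" "P \<in> Ob B" "Trg B N = Trg B P"
  shows "evR B N P \<in> Ar B" "Dom B (evR B N P) = (N \<triangleright> P) \<odot> N" "Cod B (evR B N P) = P"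
    "trR B (N \<triangleright> P) N (evR B N P) = Id B (N \<triangleright> P)"
  unfolding evR_def using assms by (simp_all add: untrR_simps)

lemma trL_evL [simp]:
  assumes "M \<in> Ob B" "P \<in> Ob B" "Src B M = Src B P" "g \<in> Ar B" "Dom B g = N" "Cod B g = P \<triangleleft> M"
  shows "trL B M N (evL B M P \<cdot> (Id B M \<odot>\<^sub>2 g)) = g"
  using trL_precomp[of "evL B M P" M "P \<triangleleft> M" g] assms by (simp del: trL_precomp)

lemma trR_evR [simp]:
  assumes "N \<in> Ob B" "P \<in> Ob B" "Trg B N = Trg B P" "g \<in> Ar B" "Dom B g = M" "Cod B g = N \<triangleright> P"
  shows "trR B M N (evR B N P \<cdot> (g \<odot>\<^sub>2 Id B N)) = g"
  using trR_precomp[of "evR B N P" "N \<triangleright> P" N g] assms by (simp del: trR_precomp)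

lemma evL_trL [simp]:
  assumes "h \<in> Ar B" "Dom B h = M \<odot> N" "M \<in> Ob B" "N \<in> Ob B" "Trg B M = Src B N" "P = Cod B h"
  shows "evL B M P \<cdot> (Id B M \<odot>\<^sub>2 trL B M N h) = h"
  by (rule trL_inject[of M N]) (use assms in \<open>auto simp del: trL_precomp\<close>)

lemma evR_trR [simp]:
  assumes "h \<in> Ar B" "Dom B h = M \<odot> N" "M \<in> Ob B" "N \<in> Ob B" "Trg B M = Src B N" "P = Cod B h"
  shows "evR B N P \<cdot> (trR B M N h \<odot>\<^sub>2 Id B N) = h"
  by (rule trR_inject[of M N]) (use assms in \<open>auto simp del: trR_precomp\<close>)

lemma evL_trL_extend [simp]:
  assumes "h \<in> Ar B" "Dom B h = M \<odot> N" "M \<in> Ob B" "N \<in> Ob B" "Trg B M = Src B N" "P = Cod B h"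
    "x \<in> Ar B" "Cod B x = M \<odot> N"
  shows "evL B M P \<cdot> (Id B M \<odot>\<^sub>2 trL B M N h) \<cdot> x = h \<cdot> x"
proof (rule extend)
  show "evL B M P \<cdot> (Id B M \<odot>\<^sub>2 trL B M N h) = h"
    by (rule evL_trL) (use assms in auto)
qed (use assms in auto)

lemma evR_trR_extend [simp]:
  assumes "h \<in> Ar B" "Dom B h = M \<odot> N" "M \<in> Ob B" "N \<in> Ob B" "Trg B M = Src B N" "P = Cod B h"
    "x \<in> Ar B" "Cod B x = M \<odot> N"
  shows "evR B N P \<cdot> (trR B M N h \<odot>\<^sub>2 Id B N) \<cdot> x = h \<cdot> x"
proof (rule extend)
  show "evR B N P \<cdot> (trR B M N h \<odot>\<^sub>2 Id B N) = h"
    by (rule evR_trR) (use assms in auto)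
qed (use assms in auto)

lemma amap_simps [simp]:
  assumes "N \<in> Ob B" "P \<in> Ob B" "M \<in> Ob B" "Trg B N = Trg B P" "Src B M = Src B P"
  shows "amap B N P M \<in> Ar B" "Dom B (amap B N P M) = (N \<triangleright> P) \<triangleleft> M"
    "Cod B (amap B N P M) = N \<triangleright> (P \<triangleleft> M)"
  using assms by (simp_all add: amap_def)

lemma tL_simps [simp]:
  assumes "M \<in> Ob B" "N \<in> Ob B" "P \<in> Ob B" "Trg B M = Src B N" "Src B M = Src B P"
  shows "tL B P M N \<in> Ar B" "Dom B (tL B P M N) = P \<triangleleft> (M \<odot> N)"
    "Cod B (tL B P M N) = (P \<triangleleft> M) \<triangleleft> N"
  using assms by (simp_all add: tL_def)

text \<open>The defining property of the isomorphism \<open>a\<close> at arbitrary 2-cells: it exchanges the order of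
  the two transpositions. This is the form in which compatibility of a functor with \<open>a\<close> can be
  compared with its effect on transposes.\<close>

lemma amap_trL_trR:
  assumes "h \<in> Ar B" "Dom B h = (M \<odot> X) \<odot> N" "M \<in> Ob B" "X \<in> Ob B" "N \<in> Ob B"
    "Trg B M = Src B X" "Trg B X = Src B N" "P = Cod B h"
  shows "amap B N P M \<cdot> trL B M X (trR B (M \<odot> X) N h) =
    trR B X N (trL B M (X \<odot> N) (h \<cdot> inv_ar B (assoc B M X N)))"
proof -
  note [simp] = assms
  let ?A = "(N \<triangleright> Cod B h) \<triangleleft> M"
  let ?x = "trL B M X (trR B (M \<odot> X) N h)"
  have n: "((Id B M \<odot>\<^sub>2 ?x) \<odot>\<^sub>2 Id B N) \<cdot> inv_ar B (assoc B M X N) =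
      inv_ar B (assoc B M ?A N) \<cdot> (Id B M \<odot>\<^sub>2 (?x \<odot>\<^sub>2 Id B N))"
    by (rule inv_assoc_natural) auto
  have "amap B N P M \<cdot> ?x = trR B X N (trL B M (X \<odot> N) (evR B N (Cod B h) \<cdot>
      (evL B M (N \<triangleright> Cod B h) \<odot>\<^sub>2 Id B N) \<cdot>
      (inv_ar B (assoc B M ?A N) \<cdot> (Id B M \<odot>\<^sub>2 (?x \<odot>\<^sub>2 Id B N)))))"
    unfolding amap_def by simp
  also have "\<dots> = trR B X N (trL B M (X \<odot> N) (h \<cdot> inv_ar B (assoc B M X N)))"
    unfolding n[symmetric] by simp
  finally show ?thesis .
qed

lemma tR_trR:
  assumes "h \<in> Ar B" "Dom B h = X \<odot> (M \<odot> N)" "X \<in> Ob B" "M \<in> Ob B" "N \<in> Ob B"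
    "Trg B X = Src B M" "Trg B M = Src B N" "P = Cod B h"
  shows "tR B M N P \<cdot> trR B X (M \<odot> N) h = trR B X M (trR B (X \<odot> M) N (h \<cdot> assoc B X M N))"
proof -
  note [simp] = assms
  let ?A = "(M \<odot> N) \<triangleright> Cod B h"
  let ?x = "trR B X (M \<odot> N) h"
  have n: "assoc B ?A M N \<cdot> ((?x \<odot>\<^sub>2 Id B M) \<odot>\<^sub>2 Id B N) =
      (?x \<odot>\<^sub>2 (Id B M \<odot>\<^sub>2 Id B N)) \<cdot> assoc B X M N"
    by (rule assoc_natural) auto
  have "tR B M N P \<cdot> ?x = trR B X M (trR B (X \<odot> M) N (evR B (M \<odot> N) (Cod B h) \<cdot>
      (assoc B ?A M N \<cdot> ((?x \<odot>\<^sub>2 Id B M) \<odot>\<^sub>2 Id B N))))"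
    unfolding tR_def by simp
  also have "\<dots> = trR B X M (trR B (X \<odot> M) N (h \<cdot> assoc B X M N))"
    unfolding n by simp
  finally show ?thesis .
qed

text \<open>Two-fold transposition is invertible, so the inverse of \<open>t\<close> is found by transposing the iterated
  evaluation back along the associator.\<close>

lemma inv_tL:
  assumes "M \<in> Ob B" "N \<in> Ob B" "P \<in> Ob B" "Trg B M = Src B N" "Src B M = Src B P"
  shows "is_iso B (tL B P M N)"
    "inv_ar B (tL B P M N) = trL B (M \<odot> N) ((P \<triangleleft> M) \<triangleleft> N)
      (evL B M P \<cdot> (Id B M \<odot>\<^sub>2 evL B N (P \<triangleleft> M)) \<cdot> assoc B M N ((P \<triangleleft> M) \<triangleleft> N))" (is "_ = ?g")
proof -
  note [simp] = assms
  let ?A = "P \<triangleleft> (M \<odot> N)"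
  let ?D = "(P \<triangleleft> M) \<triangleleft> N"
  have n1: "inv_ar B (assoc B M N ?A) \<cdot> (Id B M \<odot>\<^sub>2 (Id B N \<odot>\<^sub>2 ?g)) =
      ((Id B M \<odot>\<^sub>2 Id B N) \<odot>\<^sub>2 ?g) \<cdot> inv_ar B (assoc B M N ?D)"
    by (rule inv_assoc_natural[symmetric]) auto
  have "tL B P M N \<cdot> ?g = trL B N ?D (trL B M (N \<odot> ?D) (evL B (M \<odot> N) P \<cdot>
      (inv_ar B (assoc B M N ?A) \<cdot> (Id B M \<odot>\<^sub>2 (Id B N \<odot>\<^sub>2 ?g)))))"
    by (subst tL_def) simp
  also have "\<dots> = Id B ?D"
    unfolding n1 by simp
  finally have 1: "tL B P M N \<cdot> ?g = Id B ?D" .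
  have n2: "assoc B M N ?D \<cdot> ((Id B M \<odot>\<^sub>2 Id B N) \<odot>\<^sub>2 tL B P M N) =
      (Id B M \<odot>\<^sub>2 (Id B N \<odot>\<^sub>2 tL B P M N)) \<cdot> assoc B M N ?A"
    by (rule assoc_natural) auto
  have "?g \<cdot> tL B P M N = trL B (M \<odot> N) ?A (evL B M P \<cdot> (Id B M \<odot>\<^sub>2 evL B N (P \<triangleleft> M)) \<cdot>
      (assoc B M N ?D \<cdot> ((Id B M \<odot>\<^sub>2 Id B N) \<odot>\<^sub>2 tL B P M N)))"
    by simp
  also have "\<dots> = Id B ?A"
    unfolding n2 by (simp add: tL_def)
  finally have 2: "?g \<cdot> tL B P M N = Id B ?A" .
  show "is_iso B (tL B P M N)" "inv_ar B (tL B P M N) = ?g"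
    by (rule inv_ar_eqI; use 1 2 in simp)+
qed

lemma lbar_simps [simp]:
  assumes "M \<in> Ob B"
  shows "lbar B M \<in> Ar B" "Dom B (lbar B M) = M" "Cod B (lbar B M) = M \<triangleleft> U B (Src B M)"
  using assms by (simp_all add: lbar_def)

lemma inv_lbar:
  assumes [simp]: "M \<in> Ob B"
  shows "is_iso B (lbar B M)"
    "inv_ar B (lbar B M) = evL B (U B (Src B M)) M \<cdot> inv_ar B (lunit B (M \<triangleleft> U B (Src B M)))"
    (is "_ = ?g")
proof -
  let ?U = "U B (Src B M)"
  have n1: "lunit B M \<cdot> (Id B ?U \<odot>\<^sub>2 ?g) = ?g \<cdot> lunit B (M \<triangleleft> ?U)"
    by (rule lunit_natural) auto
  have 1: "lbar B M \<cdot> ?g = Id B (M \<triangleleft> ?U)"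
    unfolding lbar_def using n1 by simp
  have n2: "lunit B (M \<triangleleft> ?U) \<cdot> (Id B ?U \<odot>\<^sub>2 lbar B M) = lbar B M \<cdot> lunit B M"
    by (rule lunit_natural) auto
  have "lunit B M = evL B ?U M \<cdot> (inv_ar B (lunit B (M \<triangleleft> ?U)) \<cdot> lunit B (M \<triangleleft> ?U)) \<cdot>
      (Id B ?U \<odot>\<^sub>2 lbar B M)"
    by (simp add: lbar_def)
  also have "\<dots> = evL B ?U M \<cdot> inv_ar B (lunit B (M \<triangleleft> ?U)) \<cdot> (lbar B M \<cdot> lunit B M)"
    unfolding n2[symmetric] by simp
  also have "\<dots> = (?g \<cdot> lbar B M) \<cdot> lunit B M"
    by simp
  finally have "Id B M \<cdot> lunit B M = (?g \<cdot> lbar B M) \<cdot> lunit B M"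
    by simp
  then have 2: "Id B M = ?g \<cdot> lbar B M"
    by (rule iso_cancel_right[rotated]) auto
  show "is_iso B (lbar B M)" "inv_ar B (lbar B M) = ?g"
    by (rule inv_ar_eqI; use 1 2 in simp)+
qed

text \<open>By naturality of the left unitor, \<open>lbar\<close> turns \<open>h \<cdot> l\<inverse>\<close> into the transpose of \<open>h\<close>; this is how
  \<open>lbar\<close> disappears from the cotrace.\<close>

lemma inv_lbar_trL:
  assumes "h \<in> Ar B" "Dom B h = U B (Src B X) \<odot> X" "X \<in> Ob B" "P = Cod B h"
  shows "inv_ar B (lbar B P) \<cdot> trL B (U B (Src B X)) X h = h \<cdot> inv_ar B (lunit B X)"
proof (rule iso_cancel_left)
  note [simp] = assms(1-3)
  note P = assms(4)
  have [simp]: "P \<in> Ob B" "Src B P = Src B X" "Trg B P = Trg B X" "Cod B h = P"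
    using Cod_HComp1[OF assms(1,2)] by (auto simp: P)
  have i: "is_iso B (lbar B P)"
    by (rule inv_lbar(1)) simp
  then show "is_iso B (lbar B P)" .
  note [simp] = i
  let ?U = "U B (Src B X)"
  have n: "lunit B P \<cdot> (Id B ?U \<odot>\<^sub>2 (h \<cdot> inv_ar B (lunit B X))) =
      (h \<cdot> inv_ar B (lunit B X)) \<cdot> lunit B X"
    by (rule lunit_natural) auto
  have "lbar B P \<cdot> h \<cdot> inv_ar B (lunit B X) = trL B ?U X h"
    unfolding lbar_def using n by simp
  then show "lbar B P \<cdot> inv_ar B (lbar B P) \<cdot> trL B ?U X h = lbar B P \<cdot> h \<cdot> inv_ar B (lunit B X)"
    by simp
  show "inv_ar B (lbar B P) \<cdot> trL B ?U X h \<in> Ar B" "Cod B (inv_ar B (lbar B P) \<cdot> trL B ?U X h) = Dom B (lbar B P)"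
    "h \<cdot> inv_ar B (lunit B X) \<in> Ar B" "Cod B (h \<cdot> inv_ar B (lunit B X)) = Dom B (lbar B P)"
    by auto
qed

text \<open>The two maps that duality adds to the closed structure: \<open>dual_in\<close> is the comparison
  \<open>Q \<odot> M' \<Rightarrow> M \<triangleright> Q\<close> induced by the counit, and \<open>dual_out\<close> evaluates \<open>(P \<triangleleft> M) \<triangleleft> M' \<Rightarrow> P\<close> after
  the unit has provided the arguments.\<close>

definition dual_in :: "'m \<Rightarrow> 'm \<Rightarrow> 'c \<Rightarrow> 'm \<Rightarrow> 'c" where
  "dual_in M M' \<epsilon> Q = trR B (Q \<odot> M') M (runit B Q \<cdot> (Id B Q \<odot>\<^sub>2 \<epsilon>) \<cdot> assoc B Q M' M)"

definition dual_out :: "'m \<Rightarrow> 'm \<Rightarrow> 'c \<Rightarrow> 'm \<Rightarrow> 'c" where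
  "dual_out M M' \<eta> P = evL B M P \<cdot> (Id B M \<odot>\<^sub>2 evL B M' (P \<triangleleft> M)) \<cdot> assoc B M M' ((P \<triangleleft> M) \<triangleleft> M') \<cdot>
    (\<eta> \<odot>\<^sub>2 Id B ((P \<triangleleft> M) \<triangleleft> M')) \<cdot> inv_ar B (lunit B ((P \<triangleleft> M) \<triangleleft> M'))"

lemma dual_in_simps [simp]:
  assumes "dual_pair B M M' \<eta> \<epsilon>" "Q \<in> Ob B" "Trg B Q = Trg B M"
  shows "dual_in M M' \<epsilon> Q \<in> Ar B" "Dom B (dual_in M M' \<epsilon> Q) = Q \<odot> M'"
    "Cod B (dual_in M M' \<epsilon> Q) = M \<triangleright> Q"
  unfolding dual_in_def using assms(2,3) dual_pairD[OF assms(1)] by simp_all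

lemma dual_out_simps [simp]:
  assumes "dual_pair B M M' \<eta> \<epsilon>" "P \<in> Ob B" "Src B P = Src B M"
  shows "dual_out M M' \<eta> P \<in> Ar B" "Dom B (dual_out M M' \<eta> P) = (P \<triangleleft> M) \<triangleleft> M'"
    "Cod B (dual_out M M' \<eta> P) = P"
  unfolding dual_out_def using assms(2,3) dual_pairD[OF assms(1)] by simp_all

text \<open>The target half of the cotrace.\<close>

lemma dual_out_eq:
  assumes d: "dual_pair B M M' \<eta> \<epsilon>" and P: "P \<in> Ob B" "Src B P = Src B M"
  shows "inv_ar B (lbar B P) \<cdot> (Id B P \<triangleleft>\<^sub>2 \<eta>) \<cdot> inv_ar B (tL B P M M') = dual_out M M' \<eta> P"
proof -
  note [simp] = dual_pairD[OF d] P
  let ?X = "(P \<triangleleft> M) \<triangleleft> M'"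
  let ?k = "evL B M P \<cdot> (Id B M \<odot>\<^sub>2 evL B M' (P \<triangleleft> M)) \<cdot> assoc B M M' ?X \<cdot> (\<eta> \<odot>\<^sub>2 Id B ?X)"
  have "inv_ar B (lbar B P) \<cdot> (Id B P \<triangleleft>\<^sub>2 \<eta>) \<cdot> inv_ar B (tL B P M M') =
      inv_ar B (lbar B P) \<cdot> trL B (U B (Src B ?X)) ?X ?k"
    by (simp add: inv_tL)
  also have "\<dots> = ?k \<cdot> inv_ar B (lunit B ?X)"
    by (rule inv_lbar_trL) auto
  also have "\<dots> = dual_out M M' \<eta> P"
    by (simp add: dual_out_def)
  finally show ?thesis .
qed

text \<open>The source half of the cotrace. It is a single transpose along \<open>M'\<close> in which \<open>f\<close> is only
  postcomposed.\<close>

lemma dual_in_eq: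
  assumes d: "dual_pair B M M' \<eta> \<epsilon>" and Q: "Q \<in> Ob B" "Src B Q = Trg B M" "Trg B Q = Trg B M"
    and f: "f \<in> Ar B" "Dom B f = M \<triangleright> Q"
  shows "(Id B M' \<triangleright>\<^sub>2 f) \<cdot> tR B M' M Q \<cdot> (\<epsilon> \<triangleright>\<^sub>2 Id B Q) \<cdot> rbar B Q = trR B Q M' (f \<cdot> dual_in M M' \<epsilon> Q)"
proof -
  note [simp] = dual_pairD[OF d] Q f
  have [simp]: "Src B (Dom B f) = Trg B M" "Trg B (Dom B f) = Src B M"
    by simp_all
  have r: "(\<epsilon> \<triangleright>\<^sub>2 Id B Q) \<cdot> rbar B Q = trR B Q (M' \<odot> M) (runit B Q \<cdot> (Id B Q \<odot>\<^sub>2 \<epsilon>))"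
    by (simp add: rbar_def)
  have t: "tR B M' M Q \<cdot> trR B Q (M' \<odot> M) (runit B Q \<cdot> (Id B Q \<odot>\<^sub>2 \<epsilon>)) =
      trR B Q M' (trR B (Q \<odot> M') M ((runit B Q \<cdot> (Id B Q \<odot>\<^sub>2 \<epsilon>)) \<cdot> assoc B Q M' M))"
    by (rule tR_trR) auto
  show ?thesis
    unfolding r t by (simp add: dual_in_def)
qed

end

section \<open>Cotraces do not depend on the dual pair\<close>

context coshadow
begin

lemma Csh2_simps [simp]:
  assumes "f \<in> Ar B" "Src B (Dom B f) = Trg B (Dom B f)"
  shows "Csh2 Sh f \<in> Ar T" "Dom T (Csh2 Sh f) = Csh1 Sh (Dom B f)" "Cod T (Csh2 Sh f) = Csh1 Sh (Cod B f)"
  using cat_functorD(2-4)[OF Csh_functor[of "Src B (Dom B f)"], of f] assms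
  by (auto simp: Hom1_def)

lemma Csh2_Comp:
  assumes "f \<in> Ar B" "Src B (Dom B f) = Trg B (Dom B f)" "g \<in> Ar B" "Dom B g = Cod B f"
  shows "Csh2 Sh (g \<cdot>\<^bsub>B\<^esub> f) = Csh2 Sh g \<cdot>\<^bsub>T\<^esub> Csh2 Sh f"
  using cat_functorD(6)[OF Csh_functor[of "Src B (Dom B f)"], of f g] assms
  by (auto simp: Hom1_def)

lemma theta_simps [simp]:
  assumes "M \<in> Ob B" "N \<in> Ob B" "Src B M = Src B N" "Trg B M = Trg B N"
  shows "theta Sh M N \<in> Ar T" "Dom T (theta Sh M N) = Csh1 Sh (M \<triangleright>\<^bsub>B\<^esub> N)"
    "Cod T (theta Sh M N) = Csh1 Sh (N \<triangleleft>\<^bsub>B\<^esub> M)"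
  using nat_transD(1-3)[OF nat_isoD(1)[OF theta_nat_iso[of "Src B M" "Trg B M"]], of "(M, N)"] assms
  by (auto simp: Hom1_def)

lemma theta_natural:
  assumes "m \<in> Ar B" "n \<in> Ar B" "Src B (Dom B m) = Src B (Dom B n)" "Trg B (Dom B m) = Trg B (Dom B n)"
    "M = Cod B m" "M' = Dom B m" "N = Dom B n" "N' = Cod B n"
  shows "theta Sh M' N' \<cdot>\<^bsub>T\<^esub> Csh2 Sh (m \<triangleright>\<^sub>2\<^bsub>B\<^esub> n) = Csh2 Sh (n \<triangleleft>\<^sub>2\<^bsub>B\<^esub> m) \<cdot>\<^bsub>T\<^esub> theta Sh M N"
  using nat_transD(4)[OF nat_isoD(1)[OF theta_nat_iso[of "Src B M" "Trg B M"]], of "(m, n)"] assms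
  by (auto simp: Hom1_def)

lemma cotr_eq:
  assumes d: "dual_pair B M M' \<eta> \<epsilon>" and Q: "Q \<in> Ob B" "Src B Q = Trg B M" "Trg B Q = Trg B M"
    and P: "P \<in> Ob B" "Src B P = Src B M"
    and f: "f \<in> Ar B" "Dom B f = M \<triangleright>\<^bsub>B\<^esub> Q"
  shows "cotr B T Sh M M' \<eta> \<epsilon> Q P f = Csh2 Sh (B.dual_out M M' \<eta> P) \<cdot>\<^bsub>T\<^esub> theta Sh M' (P \<triangleleft>\<^bsub>B\<^esub> M) \<cdot>\<^bsub>T\<^esub>
    Csh2 Sh (trR B Q M' (f \<cdot>\<^bsub>B\<^esub> B.dual_in M M' \<epsilon> Q))"
  unfolding cotr_def B.dual_out_eq[OF d P] B.dual_in_eq[OF d Q f] ..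

text \<open>With \<open>u : M' \<Rightarrow> M''\<close> comparing the duals, the source halves differ by \<open>u\<^sup>*\<close> on \<open>\<triangleright>\<close> and the
  target halves by \<open>u\<^sup>*\<close> on \<open>\<triangleleft>\<close>. Naturality of \<open>\<theta>\<close> trades one for the other.\<close>

lemma cotr_indep:
  assumes d: "dual_pair B M M' \<eta> \<epsilon>" and d2: "dual_pair B M M'' \<eta>' \<epsilon>'"
    and Q: "Q \<in> Ob B" "Src B Q = Trg B M" "Trg B Q = Trg B M"
    and P: "P \<in> Ob B" "Src B P = Src B M" "Trg B P = Src B M"
    and f: "f \<in> Ar B" "Dom B f = M \<triangleright>\<^bsub>B\<^esub> Q" "Cod B f = P \<triangleleft>\<^bsub>B\<^esub> M"
  shows "cotr B T Sh M M' \<eta> \<epsilon> Q P f = cotr B T Sh M M'' \<eta>' \<epsilon>' Q P f"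
proof -
  obtain u where u: "u \<in> Ar B" "Dom B u = M'" "Cod B u = M''"
    and eps: "\<epsilon>' \<cdot>\<^bsub>B\<^esub> (u \<odot>\<^sub>2\<^bsub>B\<^esub> Id B M) = \<epsilon>" and eta: "(Id B M \<odot>\<^sub>2\<^bsub>B\<^esub> u) \<cdot>\<^bsub>B\<^esub> \<eta> = \<eta>'"
    using B.dual_comparison[OF d d2] .
  note [simp] = B.dual_pairD[OF d] B.dual_pairD[OF d2] Q P f u
    B.dual_in_simps[OF d] B.dual_in_simps[OF d2] B.dual_out_simps[OF d] B.dual_out_simps[OF d2]
  let ?PM = "P \<triangleleft>\<^bsub>B\<^esub> M"
  let ?X = "?PM \<triangleleft>\<^bsub>B\<^esub> M'"
  let ?Y = "?PM \<triangleleft>\<^bsub>B\<^esub> M''"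
  let ?v = "Id B ?PM \<triangleleft>\<^sub>2\<^bsub>B\<^esub> u"
  have n: "assoc B Q M'' M \<cdot>\<^bsub>B\<^esub> ((Id B Q \<odot>\<^sub>2\<^bsub>B\<^esub> u) \<odot>\<^sub>2\<^bsub>B\<^esub> Id B M) =
      (Id B Q \<odot>\<^sub>2\<^bsub>B\<^esub> (u \<odot>\<^sub>2\<^bsub>B\<^esub> Id B M)) \<cdot>\<^bsub>B\<^esub> assoc B Q M' M"
    by (rule B.assoc_natural) auto
  have i: "B.dual_in M M'' \<epsilon>' Q \<cdot>\<^bsub>B\<^esub> (Id B Q \<odot>\<^sub>2\<^bsub>B\<^esub> u) = B.dual_in M M' \<epsilon> Q"
    unfolding B.dual_in_def by (simp add: n eps)
  have a: "trR B Q M' (f \<cdot>\<^bsub>B\<^esub> B.dual_in M M' \<epsilon> Q) =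
      (u \<triangleright>\<^sub>2\<^bsub>B\<^esub> Id B ?PM) \<cdot>\<^bsub>B\<^esub> trR B Q M'' (f \<cdot>\<^bsub>B\<^esub> B.dual_in M M'' \<epsilon>' Q)"
    by (simp add: i)
  \<comment> \<open>Evaluation is dinatural in the 1-cell at which one evaluates.\<close>
  have ev: "evL B M' ?PM \<cdot>\<^bsub>B\<^esub> (Id B M' \<odot>\<^sub>2\<^bsub>B\<^esub> ?v) = evL B M'' ?PM \<cdot>\<^bsub>B\<^esub> (u \<odot>\<^sub>2\<^bsub>B\<^esub> Id B ?Y)"
  proof (rule B.trL_inject[of M' ?Y])
    have "trL B M' ?Y (evL B M'' ?PM \<cdot>\<^bsub>B\<^esub> (u \<odot>\<^sub>2\<^bsub>B\<^esub> Id B ?Y)) = ?v \<cdot>\<^bsub>B\<^esub> trL B M'' ?Y (evL B M'' ?PM)"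
      by (simp del: B.evL_simps(4))
    then show "trL B M' ?Y (evL B M' ?PM \<cdot>\<^bsub>B\<^esub> (Id B M' \<odot>\<^sub>2\<^bsub>B\<^esub> ?v)) =
        trL B M' ?Y (evL B M'' ?PM \<cdot>\<^bsub>B\<^esub> (u \<odot>\<^sub>2\<^bsub>B\<^esub> Id B ?Y))"
      by simp
  qed auto
  have n1: "inv_ar B (lunit B ?X) \<cdot>\<^bsub>B\<^esub> ?v =
      (Id B (U B (Src B M)) \<odot>\<^sub>2\<^bsub>B\<^esub> ?v) \<cdot>\<^bsub>B\<^esub> inv_ar B (lunit B ?Y)"
  proof (rule B.iso_cancel_left[of "lunit B ?X"])
    have "lunit B ?X \<cdot>\<^bsub>B\<^esub> (Id B (U B (Src B M)) \<odot>\<^sub>2\<^bsub>B\<^esub> ?v) \<cdot>\<^bsub>B\<^esub> inv_ar B (lunit B ?Y) =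
        (?v \<cdot>\<^bsub>B\<^esub> lunit B ?Y) \<cdot>\<^bsub>B\<^esub> inv_ar B (lunit B ?Y)"
      by (intro B.extend B.lunit_natural) auto
    then show "lunit B ?X \<cdot>\<^bsub>B\<^esub> inv_ar B (lunit B ?X) \<cdot>\<^bsub>B\<^esub> ?v = lunit B ?X \<cdot>\<^bsub>B\<^esub>
        (Id B (U B (Src B M)) \<odot>\<^sub>2\<^bsub>B\<^esub> ?v) \<cdot>\<^bsub>B\<^esub> inv_ar B (lunit B ?Y)"
      by simp
  qed auto
  have n2: "assoc B M M' ?X \<cdot>\<^bsub>B\<^esub> ((Id B M \<odot>\<^sub>2\<^bsub>B\<^esub> Id B M') \<odot>\<^sub>2\<^bsub>B\<^esub> ?v) =
      (Id B M \<odot>\<^sub>2\<^bsub>B\<^esub> (Id B M' \<odot>\<^sub>2\<^bsub>B\<^esub> ?v)) \<cdot>\<^bsub>B\<^esub> assoc B M M' ?Y"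
    by (rule B.assoc_natural) auto
  have n3: "(Id B M \<odot>\<^sub>2\<^bsub>B\<^esub> (u \<odot>\<^sub>2\<^bsub>B\<^esub> Id B ?Y)) \<cdot>\<^bsub>B\<^esub> assoc B M M' ?Y =
      assoc B M M'' ?Y \<cdot>\<^bsub>B\<^esub> ((Id B M \<odot>\<^sub>2\<^bsub>B\<^esub> u) \<odot>\<^sub>2\<^bsub>B\<^esub> Id B ?Y)"
    by (rule B.assoc_natural[symmetric]) auto
  have "B.dual_out M M' \<eta> P \<cdot>\<^bsub>B\<^esub> ?v = evL B M P \<cdot>\<^bsub>B\<^esub> (Id B M \<odot>\<^sub>2\<^bsub>B\<^esub> evL B M' ?PM) \<cdot>\<^bsub>B\<^esub> assoc B M M' ?X \<cdot>\<^bsub>B\<^esub>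
      (\<eta> \<odot>\<^sub>2\<^bsub>B\<^esub> Id B ?X) \<cdot>\<^bsub>B\<^esub> (inv_ar B (lunit B ?X) \<cdot>\<^bsub>B\<^esub> ?v)"
    unfolding B.dual_out_def by simp
  also have "\<dots> = evL B M P \<cdot>\<^bsub>B\<^esub> (Id B M \<odot>\<^sub>2\<^bsub>B\<^esub> evL B M' ?PM) \<cdot>\<^bsub>B\<^esub>
      (assoc B M M' ?X \<cdot>\<^bsub>B\<^esub> ((Id B M \<odot>\<^sub>2\<^bsub>B\<^esub> Id B M') \<odot>\<^sub>2\<^bsub>B\<^esub> ?v)) \<cdot>\<^bsub>B\<^esub> (\<eta> \<odot>\<^sub>2\<^bsub>B\<^esub> Id B ?Y) \<cdot>\<^bsub>B\<^esub> inv_ar B (lunit B ?Y)"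
    unfolding n1 by simp
  also have "\<dots> = evL B M P \<cdot>\<^bsub>B\<^esub> (Id B M \<odot>\<^sub>2\<^bsub>B\<^esub> evL B M'' ?PM) \<cdot>\<^bsub>B\<^esub>
      ((Id B M \<odot>\<^sub>2\<^bsub>B\<^esub> (u \<odot>\<^sub>2\<^bsub>B\<^esub> Id B ?Y)) \<cdot>\<^bsub>B\<^esub> assoc B M M' ?Y) \<cdot>\<^bsub>B\<^esub> (\<eta> \<odot>\<^sub>2\<^bsub>B\<^esub> Id B ?Y) \<cdot>\<^bsub>B\<^esub> inv_ar B (lunit B ?Y)"
    unfolding n2 by (simp add: ev)
  also have "\<dots> = B.dual_out M M'' \<eta>' P"
    unfolding n3 B.dual_out_def by (simp add: eta)
  finally have o: "B.dual_out M M' \<eta> P \<cdot>\<^bsub>B\<^esub> ?v = B.dual_out M M'' \<eta>' P" .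
  have t: "theta Sh M' ?PM \<cdot>\<^bsub>T\<^esub> Csh2 Sh (u \<triangleright>\<^sub>2\<^bsub>B\<^esub> Id B ?PM) = Csh2 Sh ?v \<cdot>\<^bsub>T\<^esub> theta Sh M'' ?PM"
    by (rule theta_natural) auto
  let ?a = "trR B Q M'' (f \<cdot>\<^bsub>B\<^esub> B.dual_in M M'' \<epsilon>' Q)"
  have "cotr B T Sh M M' \<eta> \<epsilon> Q P f = Csh2 Sh (B.dual_out M M' \<eta> P) \<cdot>\<^bsub>T\<^esub> theta Sh M' ?PM \<cdot>\<^bsub>T\<^esub>
      Csh2 Sh ((u \<triangleright>\<^sub>2\<^bsub>B\<^esub> Id B ?PM) \<cdot>\<^bsub>B\<^esub> ?a)"
    unfolding cotr_eq[OF d Q P(1,2) f(1,2)] a ..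
  also have "Csh2 Sh ((u \<triangleright>\<^sub>2\<^bsub>B\<^esub> Id B ?PM) \<cdot>\<^bsub>B\<^esub> ?a) = Csh2 Sh (u \<triangleright>\<^sub>2\<^bsub>B\<^esub> Id B ?PM) \<cdot>\<^bsub>T\<^esub> Csh2 Sh ?a"
    by (rule Csh2_Comp) auto
  also have "theta Sh M' ?PM \<cdot>\<^bsub>T\<^esub> Csh2 Sh (u \<triangleright>\<^sub>2\<^bsub>B\<^esub> Id B ?PM) \<cdot>\<^bsub>T\<^esub> Csh2 Sh ?a =
      (Csh2 Sh ?v \<cdot>\<^bsub>T\<^esub> theta Sh M'' ?PM) \<cdot>\<^bsub>T\<^esub> Csh2 Sh ?a"
    by (rule T.extend[OF t]) auto
  also have "Csh2 Sh (B.dual_out M M' \<eta> P) \<cdot>\<^bsub>T\<^esub> \<dots> =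
      Csh2 Sh (B.dual_out M M' \<eta> P \<cdot>\<^bsub>B\<^esub> ?v) \<cdot>\<^bsub>T\<^esub> theta Sh M'' ?PM \<cdot>\<^bsub>T\<^esub> Csh2 Sh ?a"
    by (simp add: Csh2_Comp)
  also have "\<dots> = cotr B T Sh M M'' \<eta>' \<epsilon>' Q P f"
    unfolding o cotr_eq[OF d2 Q P(1,2) f(1,2)] ..
  finally show ?thesis .
qed

end

section \<open>The underlying lax functor\<close>

context lax_closed_functor
begin

lemma F0_simps [simp]: "R \<in> Cell0 B \<Longrightarrow> F0 F R \<in> Cell0 C"
  by (rule F0_in_Cell0)

lemma F1_simps [simp]:
  assumes "M \<in> Ob B"
  shows "F1 F M \<in> Ob C" "Src C (F1 F M) = F0 F (Src B M)" "Trg C (F1 F M) = F0 F (Trg B M)"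
  using cat_functorD(1)[OF F_functor[of "Src B M" "Trg B M"], of M] assms
  by (auto simp: Hom1_def)

lemma F2_simps [simp]:
  assumes "f \<in> Ar B"
  shows "F2 F f \<in> Ar C" "Dom C (F2 F f) = F1 F (Dom B f)" "Cod C (F2 F f) = F1 F (Cod B f)"
  using cat_functorD(2-4)[OF F_functor[of "Src B (Dom B f)" "Trg B (Dom B f)"], of f] assms
  by (auto simp: Hom1_def)

lemma F2_Id [simp]: "M \<in> Ob B \<Longrightarrow> F2 F (Id B M) = Id C (F1 F M)"
  using cat_functorD(5)[OF F_functor[of "Src B M" "Trg B M"], of M]
  by (auto simp: Hom1_def)

lemma F2_Comp:
  assumes "f \<in> Ar B" "g \<in> Ar B" "Cod B f = Dom B g"
  shows "F2 F (g \<cdot>\<^bsub>B\<^esub> f) = F2 F g \<cdot>\<^bsub>C\<^esub> F2 F f"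
  using cat_functorD(6)[OF F_functor[of "Src B (Dom B f)" "Trg B (Dom B f)"], of f g] assms
    B.parallel_simps[of f]
  by (auto simp: Hom1_def)

lemma iU_simps [simp]:
  assumes "R \<in> Cell0 B"
  shows "iU F R \<in> Ar C" "Dom C (iU F R) = U C (F0 F R)" "Cod C (iU F R) = F1 F (U B R)"
  using iU_in_hom[OF assms] by (auto simp: hom_def)

lemma cR_simps [simp]:
  assumes "N \<in> Ob B" "P \<in> Ob B" "Trg B N = Trg B P"
  shows "cR F N P \<in> Ar C" "Dom C (cR F N P) = F1 F (N \<triangleright>\<^bsub>B\<^esub> P)" "Cod C (cR F N P) = F1 F N \<triangleright>\<^bsub>C\<^esub> F1 F P"
  using nat_transD(1-3)[OF cR_nat[of "Src B P" "Src B N" "Trg B N"], of "(N, P)"] assms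
  by (auto simp: Hom1_def)

lemma cL_simps [simp]:
  assumes "M \<in> Ob B" "P \<in> Ob B" "Src B M = Src B P"
  shows "cL F P M \<in> Ar C" "Dom C (cL F P M) = F1 F (P \<triangleleft>\<^bsub>B\<^esub> M)" "Cod C (cL F P M) = F1 F P \<triangleleft>\<^bsub>C\<^esub> F1 F M"
  using nat_transD(1-3)[OF cL_nat[of "Src B M" "Trg B M" "Trg B P"], of "(P, M)"] assms
  by (auto simp: Hom1_def)

lemma cR_natural:
  assumes "n \<in> Ar B" "p \<in> Ar B" "Trg B (Dom B n) = Trg B (Dom B p)"
    "N = Cod B n" "N' = Dom B n" "P = Dom B p" "P' = Cod B p"
  shows "cR F N' P' \<cdot>\<^bsub>C\<^esub> F2 F (n \<triangleright>\<^sub>2\<^bsub>B\<^esub> p) = (F2 F n \<triangleright>\<^sub>2\<^bsub>C\<^esub> F2 F p) \<cdot>\<^bsub>C\<^esub> cR F N P"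
  using nat_transD(4)[OF cR_nat[of "Src B P" "Src B N" "Trg B N"], of "(n, p)"] assms
  by (auto simp: Hom1_def)

lemma cL_natural:
  assumes "m \<in> Ar B" "p \<in> Ar B" "Src B (Dom B m) = Src B (Dom B p)"
    "M = Cod B m" "M' = Dom B m" "P = Dom B p" "P' = Cod B p"
  shows "cL F P' M' \<cdot>\<^bsub>C\<^esub> F2 F (p \<triangleleft>\<^sub>2\<^bsub>B\<^esub> m) = (F2 F p \<triangleleft>\<^sub>2\<^bsub>C\<^esub> F2 F m) \<cdot>\<^bsub>C\<^esub> cL F P M"
  using nat_transD(4)[OF cL_nat[of "Src B M" "Trg B M" "Trg B P"], of "(p, m)"] assms
  by (auto simp: Hom1_def)

abbreviation c :: "'m \<Rightarrow> 'm \<Rightarrow> 'd" where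
  "c \<equiv> c_hcomp B C F"

definition c_left :: "'m \<Rightarrow> 'm \<Rightarrow> 'd" where
  "c_left M N = untrL C (F1 F M) (F1 F N) (F1 F (M \<odot>\<^bsub>B\<^esub> N))
     (cL F (M \<odot>\<^bsub>B\<^esub> N) M \<cdot>\<^bsub>C\<^esub> F2 F (trL B M N (Id B (M \<odot>\<^bsub>B\<^esub> N))))"

lemma c_simps [simp]:
  assumes "M \<in> Ob B" "N \<in> Ob B" "Trg B M = Src B N"
  shows "c M N \<in> Ar C" "Dom C (c M N) = F1 F M \<odot>\<^bsub>C\<^esub> F1 F N" "Cod C (c M N) = F1 F (M \<odot>\<^bsub>B\<^esub> N)"
    and trR_c: "trR C (F1 F M) (F1 F N) (c M N) =
      cR F N (M \<odot>\<^bsub>B\<^esub> N) \<cdot>\<^bsub>C\<^esub> F2 F (trR B M N (Id B (M \<odot>\<^bsub>B\<^esub> N)))"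
  unfolding c_hcomp_def coev_def using assms by (simp_all add: C.untrR_simps)

lemma c_left_simps [simp]:
  assumes "M \<in> Ob B" "N \<in> Ob B" "Trg B M = Src B N"
  shows "c_left M N \<in> Ar C" "Dom C (c_left M N) = F1 F M \<odot>\<^bsub>C\<^esub> F1 F N"
    "Cod C (c_left M N) = F1 F (M \<odot>\<^bsub>B\<^esub> N)"
    and trL_c_left: "trL C (F1 F M) (F1 F N) (c_left M N) =
      cL F (M \<odot>\<^bsub>B\<^esub> N) M \<cdot>\<^bsub>C\<^esub> F2 F (trL B M N (Id B (M \<odot>\<^bsub>B\<^esub> N)))"
  unfolding c_left_def using assms by (simp_all add: C.untrL_simps)

declare trR_c [simp del] trL_c_left [simp del]

text \<open>The reason for considering \<open>c\<close>: every transpose is the universal one followed by \<open>h\<^sub>*\<close>, so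
  naturality of \<open>cR\<close> reduces the claim to the definition of \<open>c\<close>.\<close>

lemma cR_trR:
  assumes h: "h \<in> Ar B" "Dom B h = M \<odot>\<^bsub>B\<^esub> N" "P = Cod B h"
    and M: "M \<in> Ob B" "N \<in> Ob B" "Trg B M = Src B N"
  shows "cR F N P \<cdot>\<^bsub>C\<^esub> F2 F (trR B M N h) = trR C (F1 F M) (F1 F N) (F2 F h \<cdot>\<^bsub>C\<^esub> c M N)"
proof -
  note [simp] = h M
  let ?j = "trR B M N (Id B (M \<odot>\<^bsub>B\<^esub> N))"
  have n: "cR F N (Cod B h) \<cdot>\<^bsub>C\<^esub> F2 F (Id B N \<triangleright>\<^sub>2\<^bsub>B\<^esub> h) =
      (F2 F (Id B N) \<triangleright>\<^sub>2\<^bsub>C\<^esub> F2 F h) \<cdot>\<^bsub>C\<^esub> cR F N (M \<odot>\<^bsub>B\<^esub> N)"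
    by (rule cR_natural) auto
  have "F2 F (trR B M N h) = F2 F ((Id B N \<triangleright>\<^sub>2\<^bsub>B\<^esub> h) \<cdot>\<^bsub>B\<^esub> ?j)"
    by simp
  also have "\<dots> = F2 F (Id B N \<triangleright>\<^sub>2\<^bsub>B\<^esub> h) \<cdot>\<^bsub>C\<^esub> F2 F ?j"
    by (rule F2_Comp) simp_all
  finally have "F2 F (trR B M N h) = F2 F (Id B N \<triangleright>\<^sub>2\<^bsub>B\<^esub> h) \<cdot>\<^bsub>C\<^esub> F2 F ?j" .
  then have "cR F N P \<cdot>\<^bsub>C\<^esub> F2 F (trR B M N h) =
      (cR F N (Cod B h) \<cdot>\<^bsub>C\<^esub> F2 F (Id B N \<triangleright>\<^sub>2\<^bsub>B\<^esub> h)) \<cdot>\<^bsub>C\<^esub> F2 F ?j"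
    by simp
  also have "\<dots> = (F2 F (Id B N) \<triangleright>\<^sub>2\<^bsub>C\<^esub> F2 F h) \<cdot>\<^bsub>C\<^esub> trR C (F1 F M) (F1 F N) (c M N)"
    unfolding n by (simp add: trR_c)
  also have "\<dots> = trR C (F1 F M) (F1 F N) (F2 F h \<cdot>\<^bsub>C\<^esub> c M N)"
    by simp
  finally show ?thesis .
qed

lemma cL_trL:
  assumes h: "h \<in> Ar B" "Dom B h = M \<odot>\<^bsub>B\<^esub> N" "P = Cod B h"
    and M: "M \<in> Ob B" "N \<in> Ob B" "Trg B M = Src B N"
  shows "cL F P M \<cdot>\<^bsub>C\<^esub> F2 F (trL B M N h) = trL C (F1 F M) (F1 F N) (F2 F h \<cdot>\<^bsub>C\<^esub> c_left M N)"
proof -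
  note [simp] = h M
  let ?j = "trL B M N (Id B (M \<odot>\<^bsub>B\<^esub> N))"
  have n: "cL F (Cod B h) M \<cdot>\<^bsub>C\<^esub> F2 F (h \<triangleleft>\<^sub>2\<^bsub>B\<^esub> Id B M) =
      (F2 F h \<triangleleft>\<^sub>2\<^bsub>C\<^esub> F2 F (Id B M)) \<cdot>\<^bsub>C\<^esub> cL F (M \<odot>\<^bsub>B\<^esub> N) M"
    by (rule cL_natural) auto
  have "F2 F (trL B M N h) = F2 F ((h \<triangleleft>\<^sub>2\<^bsub>B\<^esub> Id B M) \<cdot>\<^bsub>B\<^esub> ?j)"
    by simp
  also have "\<dots> = F2 F (h \<triangleleft>\<^sub>2\<^bsub>B\<^esub> Id B M) \<cdot>\<^bsub>C\<^esub> F2 F ?j"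
    by (rule F2_Comp) simp_all
  finally have "F2 F (trL B M N h) = F2 F (h \<triangleleft>\<^sub>2\<^bsub>B\<^esub> Id B M) \<cdot>\<^bsub>C\<^esub> F2 F ?j" .
  then have "cL F P M \<cdot>\<^bsub>C\<^esub> F2 F (trL B M N h) =
      (cL F (Cod B h) M \<cdot>\<^bsub>C\<^esub> F2 F (h \<triangleleft>\<^sub>2\<^bsub>B\<^esub> Id B M)) \<cdot>\<^bsub>C\<^esub> F2 F ?j"
    by simp
  also have "\<dots> = (F2 F h \<triangleleft>\<^sub>2\<^bsub>C\<^esub> F2 F (Id B M)) \<cdot>\<^bsub>C\<^esub> trL C (F1 F M) (F1 F N) (c_left M N)"
    unfolding n by (simp add: trL_c_left)
  also have "\<dots> = trL C (F1 F M) (F1 F N) (F2 F h \<cdot>\<^bsub>C\<^esub> c_left M N)"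
    by simp
  finally show ?thesis .
qed

text \<open>Both sides have equal transposes by \<open>cR_trR\<close> and naturality of \<open>cR\<close> in the contravariant
  argument.\<close>

lemma c_natural:
  assumes m: "m \<in> Ar B" "n \<in> Ar B" "Trg B (Dom B m) = Src B (Dom B n)"
    "M = Dom B m" "N = Dom B n" "M' = Cod B m" "N' = Cod B n"
  shows "c M' N' \<cdot>\<^bsub>C\<^esub> (F2 F m \<odot>\<^sub>2\<^bsub>C\<^esub> F2 F n) = F2 F (m \<odot>\<^sub>2\<^bsub>B\<^esub> n) \<cdot>\<^bsub>C\<^esub> c M N"
proof (rule C.trR_inject[of "F1 F M" "F1 F N"])
  note [simp] = m
  let ?MN = "Cod B m \<odot>\<^bsub>B\<^esub> Cod B n"
  let ?j = "trR B (Cod B m) (Cod B n) (Id B ?MN)"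
  have e: "F2 F (trR B M N (m \<odot>\<^sub>2\<^bsub>B\<^esub> n)) =
      F2 F (n \<triangleright>\<^sub>2\<^bsub>B\<^esub> Id B ?MN) \<cdot>\<^bsub>C\<^esub> F2 F ?j \<cdot>\<^bsub>C\<^esub> F2 F m"
  proof -
    have "F2 F (trR B M N (m \<odot>\<^sub>2\<^bsub>B\<^esub> n)) = F2 F ((n \<triangleright>\<^sub>2\<^bsub>B\<^esub> Id B ?MN) \<cdot>\<^bsub>B\<^esub> (?j \<cdot>\<^bsub>B\<^esub> m))"
      by simp
    also have "\<dots> = F2 F (n \<triangleright>\<^sub>2\<^bsub>B\<^esub> Id B ?MN) \<cdot>\<^bsub>C\<^esub> F2 F (?j \<cdot>\<^bsub>B\<^esub> m)"
      by (rule F2_Comp) simp_all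
    also have "F2 F (?j \<cdot>\<^bsub>B\<^esub> m) = F2 F ?j \<cdot>\<^bsub>C\<^esub> F2 F m"
      by (rule F2_Comp) simp_all
    finally show ?thesis .
  qed
  have n: "cR F (Dom B n) ?MN \<cdot>\<^bsub>C\<^esub> F2 F (n \<triangleright>\<^sub>2\<^bsub>B\<^esub> Id B ?MN) =
      (F2 F n \<triangleright>\<^sub>2\<^bsub>C\<^esub> F2 F (Id B ?MN)) \<cdot>\<^bsub>C\<^esub> cR F (Cod B n) ?MN"
    by (rule cR_natural) auto
  have "trR C (F1 F M) (F1 F N) (F2 F (m \<odot>\<^sub>2\<^bsub>B\<^esub> n) \<cdot>\<^bsub>C\<^esub> c M N) =
      cR F (Dom B n) ?MN \<cdot>\<^bsub>C\<^esub> F2 F (trR B M N (m \<odot>\<^sub>2\<^bsub>B\<^esub> n))"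
    by (simp add: cR_trR)
  also have "\<dots> = (cR F (Dom B n) ?MN \<cdot>\<^bsub>C\<^esub> F2 F (n \<triangleright>\<^sub>2\<^bsub>B\<^esub> Id B ?MN)) \<cdot>\<^bsub>C\<^esub> F2 F ?j \<cdot>\<^bsub>C\<^esub> F2 F m"
    unfolding e by simp
  also have "\<dots> = (F2 F n \<triangleright>\<^sub>2\<^bsub>C\<^esub> F2 F (Id B ?MN)) \<cdot>\<^bsub>C\<^esub> (cR F (Cod B n) ?MN \<cdot>\<^bsub>C\<^esub> F2 F ?j) \<cdot>\<^bsub>C\<^esub> F2 F m"
    unfolding n by simp
  also have "\<dots> = trR C (F1 F M) (F1 F N) (c M' N' \<cdot>\<^bsub>C\<^esub> (F2 F m \<odot>\<^sub>2\<^bsub>C\<^esub> F2 F n))"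
    by (subst trR_c[symmetric]) auto
  finally show "trR C (F1 F M) (F1 F N) (c M' N' \<cdot>\<^bsub>C\<^esub> (F2 F m \<odot>\<^sub>2\<^bsub>C\<^esub> F2 F n)) =
      trR C (F1 F M) (F1 F N) (F2 F (m \<odot>\<^sub>2\<^bsub>B\<^esub> n) \<cdot>\<^bsub>C\<^esub> c M N)" ..
qed (use m in auto)

lemma c_left_natural:
  assumes m: "m \<in> Ar B" "n \<in> Ar B" "Trg B (Dom B m) = Src B (Dom B n)"
    "M = Dom B m" "N = Dom B n" "M' = Cod B m" "N' = Cod B n"
  shows "c_left M' N' \<cdot>\<^bsub>C\<^esub> (F2 F m \<odot>\<^sub>2\<^bsub>C\<^esub> F2 F n) = F2 F (m \<odot>\<^sub>2\<^bsub>B\<^esub> n) \<cdot>\<^bsub>C\<^esub> c_left M N"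
proof (rule C.trL_inject[of "F1 F M" "F1 F N"])
  note [simp] = m
  let ?MN = "Cod B m \<odot>\<^bsub>B\<^esub> Cod B n"
  let ?j = "trL B (Cod B m) (Cod B n) (Id B ?MN)"
  have e: "F2 F (trL B M N (m \<odot>\<^sub>2\<^bsub>B\<^esub> n)) =
      F2 F (Id B ?MN \<triangleleft>\<^sub>2\<^bsub>B\<^esub> m) \<cdot>\<^bsub>C\<^esub> F2 F ?j \<cdot>\<^bsub>C\<^esub> F2 F n"
  proof -
    have "F2 F (trL B M N (m \<odot>\<^sub>2\<^bsub>B\<^esub> n)) = F2 F ((Id B ?MN \<triangleleft>\<^sub>2\<^bsub>B\<^esub> m) \<cdot>\<^bsub>B\<^esub> (?j \<cdot>\<^bsub>B\<^esub> n))"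
      by simp
    also have "\<dots> = F2 F (Id B ?MN \<triangleleft>\<^sub>2\<^bsub>B\<^esub> m) \<cdot>\<^bsub>C\<^esub> F2 F (?j \<cdot>\<^bsub>B\<^esub> n)"
      by (rule F2_Comp) simp_all
    also have "F2 F (?j \<cdot>\<^bsub>B\<^esub> n) = F2 F ?j \<cdot>\<^bsub>C\<^esub> F2 F n"
      by (rule F2_Comp) simp_all
    finally show ?thesis .
  qed
  have n: "cL F ?MN (Dom B m) \<cdot>\<^bsub>C\<^esub> F2 F (Id B ?MN \<triangleleft>\<^sub>2\<^bsub>B\<^esub> m) =
      (F2 F (Id B ?MN) \<triangleleft>\<^sub>2\<^bsub>C\<^esub> F2 F m) \<cdot>\<^bsub>C\<^esub> cL F ?MN (Cod B m)"
    by (rule cL_natural) auto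
  have "trL C (F1 F M) (F1 F N) (F2 F (m \<odot>\<^sub>2\<^bsub>B\<^esub> n) \<cdot>\<^bsub>C\<^esub> c_left M N) =
      cL F ?MN (Dom B m) \<cdot>\<^bsub>C\<^esub> F2 F (trL B M N (m \<odot>\<^sub>2\<^bsub>B\<^esub> n))"
    by (simp add: cL_trL)
  also have "\<dots> = (cL F ?MN (Dom B m) \<cdot>\<^bsub>C\<^esub> F2 F (Id B ?MN \<triangleleft>\<^sub>2\<^bsub>B\<^esub> m)) \<cdot>\<^bsub>C\<^esub> F2 F ?j \<cdot>\<^bsub>C\<^esub> F2 F n"
    unfolding e by simp
  also have "\<dots> = (F2 F (Id B ?MN) \<triangleleft>\<^sub>2\<^bsub>C\<^esub> F2 F m) \<cdot>\<^bsub>C\<^esub> (cL F ?MN (Cod B m) \<cdot>\<^bsub>C\<^esub> F2 F ?j) \<cdot>\<^bsub>C\<^esub> F2 F n"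
    unfolding n by simp
  also have "\<dots> = trL C (F1 F M) (F1 F N) (c_left M' N' \<cdot>\<^bsub>C\<^esub> (F2 F m \<odot>\<^sub>2\<^bsub>C\<^esub> F2 F n))"
    by (subst trL_c_left[symmetric]) auto
  finally show "trL C (F1 F M) (F1 F N) (c_left M' N' \<cdot>\<^bsub>C\<^esub> (F2 F m \<odot>\<^sub>2\<^bsub>C\<^esub> F2 F n)) =
      trL C (F1 F M) (F1 F N) (F2 F (m \<odot>\<^sub>2\<^bsub>B\<^esub> n) \<cdot>\<^bsub>C\<^esub> c_left M N)" ..
qed (use m in auto)

text \<open>The unit laws are transposed forms of axioms of a lax closed functor: this one of the axiom on
  \<open>rbar\<close>, the other two of those on the units \<open>U \<Rightarrow> M \<triangleright> M\<close> and \<open>U \<Rightarrow> M \<triangleleft> M\<close>.\<close>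

lemma c_runit:
  assumes M: "M \<in> Ob B" "S = Trg B M"
  shows "F2 F (runit B M) \<cdot>\<^bsub>C\<^esub> c M (U B S) \<cdot>\<^bsub>C\<^esub> (Id C (F1 F M) \<odot>\<^sub>2\<^bsub>C\<^esub> iU F S) = runit C (F1 F M)"
proof (rule C.trR_inject[of "F1 F M" "U C (F0 F (Trg B M))"])
  note [simp] = M
  have a: "cR F (U B S) M \<cdot>\<^bsub>C\<^esub> F2 F (rbar B M) =
      trR C (F1 F M) (F1 F (U B S)) (F2 F (runit B M) \<cdot>\<^bsub>C\<^esub> c M (U B S))"
    unfolding rbar_def M(2) by (rule cR_trR) auto
  have "(iU F S \<triangleright>\<^sub>2\<^bsub>C\<^esub> Id C (F1 F M)) \<cdot>\<^bsub>C\<^esub> cR F (U B S) M \<cdot>\<^bsub>C\<^esub> F2 F (rbar B M) = rbar C (F1 F M)"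
    by (rule cR_rbar[of _ "Src B M"]) (simp add: Hom1_def)
  then show "trR C (F1 F M) (U C (F0 F (Trg B M)))
      (F2 F (runit B M) \<cdot>\<^bsub>C\<^esub> c M (U B S) \<cdot>\<^bsub>C\<^esub> (Id C (F1 F M) \<odot>\<^sub>2\<^bsub>C\<^esub> iU F S)) =
      trR C (F1 F M) (U C (F0 F (Trg B M))) (runit C (F1 F M))"
    unfolding a by (simp add: rbar_def)
qed (use M in auto)

lemma c_lunit:
  assumes M: "M \<in> Ob B" "R = Src B M"
  shows "F2 F (lunit B M) \<cdot>\<^bsub>C\<^esub> c (U B R) M \<cdot>\<^bsub>C\<^esub> (iU F R \<odot>\<^sub>2\<^bsub>C\<^esub> Id C (F1 F M)) = lunit C (F1 F M)"
proof (rule C.trR_inject[of "U C (F0 F (Src B M))" "F1 F M"])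
  note [simp] = M
  have "trR C (U C (F0 F R)) (F1 F M) (lunit C (F1 F M)) =
      cR F M M \<cdot>\<^bsub>C\<^esub> F2 F (trR B (U B R) M (lunit B M)) \<cdot>\<^bsub>C\<^esub> iU F R"
    by (rule cR_iU[symmetric, of _ _ "Trg B M"]) (simp add: Hom1_def)
  also have "\<dots> = trR C (F1 F (U B R)) (F1 F M) (F2 F (lunit B M) \<cdot>\<^bsub>C\<^esub> c (U B R) M) \<cdot>\<^bsub>C\<^esub> iU F R"
    using cR_trR[of "lunit B M" "U B R" M M] by (intro C.extend) simp_all
  finally show "trR C (U C (F0 F (Src B M))) (F1 F M)
      (F2 F (lunit B M) \<cdot>\<^bsub>C\<^esub> c (U B R) M \<cdot>\<^bsub>C\<^esub> (iU F R \<odot>\<^sub>2\<^bsub>C\<^esub> Id C (F1 F M))) =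
      trR C (U C (F0 F (Src B M))) (F1 F M) (lunit C (F1 F M))"
    by simp
qed (use M in auto)

lemma c_left_runit:
  assumes M: "M \<in> Ob B" "S = Trg B M"
  shows "F2 F (runit B M) \<cdot>\<^bsub>C\<^esub> c_left M (U B S) \<cdot>\<^bsub>C\<^esub> (Id C (F1 F M) \<odot>\<^sub>2\<^bsub>C\<^esub> iU F S) = runit C (F1 F M)"
proof (rule C.trL_inject[of "F1 F M" "U C (F0 F (Trg B M))"])
  note [simp] = M
  have a: "cL F M M \<cdot>\<^bsub>C\<^esub> F2 F (trL B M (U B S) (runit B M)) =
      trL C (F1 F M) (F1 F (U B S)) (F2 F (runit B M) \<cdot>\<^bsub>C\<^esub> c_left M (U B S))"
    unfolding M(2) by (rule cL_trL) auto
  have "cL F M M \<cdot>\<^bsub>C\<^esub> F2 F (trL B M (U B S) (runit B M)) \<cdot>\<^bsub>C\<^esub> iU F S =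
      trL C (F1 F M) (U C (F0 F S)) (runit C (F1 F M))"
    by (rule cL_iU[of _ "Src B M"]) (simp add: Hom1_def)
  moreover have "cL F M M \<cdot>\<^bsub>C\<^esub> F2 F (trL B M (U B S) (runit B M)) \<cdot>\<^bsub>C\<^esub> iU F S =
      trL C (F1 F M) (F1 F (U B S)) (F2 F (runit B M) \<cdot>\<^bsub>C\<^esub> c_left M (U B S)) \<cdot>\<^bsub>C\<^esub> iU F S"
    by (rule C.extend[OF a]) auto
  ultimately show "trL C (F1 F M) (U C (F0 F (Trg B M)))
      (F2 F (runit B M) \<cdot>\<^bsub>C\<^esub> c_left M (U B S) \<cdot>\<^bsub>C\<^esub> (Id C (F1 F M) \<odot>\<^sub>2\<^bsub>C\<^esub> iU F S)) =
      trL C (F1 F M) (U C (F0 F (Trg B M))) (runit C (F1 F M))"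
    by simp
qed (use M in auto)

text \<open>Compatibility with \<open>a\<close>, precomposed with \<open>F\<close> of the two-fold transpose of the associator. On
  each side \<open>cR_trR\<close>, \<open>cL_trL\<close> and \<open>amap_trL_trR\<close> turn the composite into one two-fold transpose;
  the transposed 2-cells are then equal.\<close>

lemma c_left_assoc_c:
  assumes M: "M \<in> Ob B" "X \<in> Ob B" "N \<in> Ob B" "Trg B M = Src B X" "Trg B X = Src B N"
  shows "F2 F (assoc B M X N) \<cdot>\<^bsub>C\<^esub> c (M \<odot>\<^bsub>B\<^esub> X) N \<cdot>\<^bsub>C\<^esub> (c_left M X \<odot>\<^sub>2\<^bsub>C\<^esub> Id C (F1 F N)) =
    c_left M (X \<odot>\<^bsub>B\<^esub> N) \<cdot>\<^bsub>C\<^esub> (Id C (F1 F M) \<odot>\<^sub>2\<^bsub>C\<^esub> c X N) \<cdot>\<^bsub>C\<^esub> assoc C (F1 F M) (F1 F X) (F1 F N)"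
    (is "?H = _")
proof -
  note [simp] = M
  let ?h = "assoc B M X N"
  let ?P = "M \<odot>\<^bsub>B\<^esub> (X \<odot>\<^bsub>B\<^esub> N)"
  let ?FM = "F1 F M" and ?FX = "F1 F X" and ?FN = "F1 F N"
  let ?a = "assoc C ?FM ?FX ?FN"
  let ?K = "c_left M (X \<odot>\<^bsub>B\<^esub> N) \<cdot>\<^bsub>C\<^esub> (Id C ?FM \<odot>\<^sub>2\<^bsub>C\<^esub> c X N)"
  \<comment> \<open>Since \<open>?h\<close> is the associator, \<open>a\<close> sends \<open>?g\<close> to the two-fold transpose of an identity.\<close>
  let ?k = "trR B (M \<odot>\<^bsub>B\<^esub> X) N ?h"
  let ?g = "trL B M X ?k"
  let ?j = "trL B M (X \<odot>\<^bsub>B\<^esub> N) (Id B ?P)"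
  have 1: "cL F (N \<triangleright>\<^bsub>B\<^esub> ?P) M \<cdot>\<^bsub>C\<^esub> F2 F ?g = trL C ?FM ?FX (F2 F ?k \<cdot>\<^bsub>C\<^esub> c_left M X)"
    by (rule cL_trL) auto
  have 2: "cR F N ?P \<cdot>\<^bsub>C\<^esub> F2 F ?k = trR C (F1 F (M \<odot>\<^bsub>B\<^esub> X)) ?FN (F2 F ?h \<cdot>\<^bsub>C\<^esub> c (M \<odot>\<^bsub>B\<^esub> X) N)"
    by (rule cR_trR) auto
  have 3: "(cR F N ?P \<triangleleft>\<^sub>2\<^bsub>C\<^esub> Id C ?FM) \<cdot>\<^bsub>C\<^esub> cL F (N \<triangleright>\<^bsub>B\<^esub> ?P) M \<cdot>\<^bsub>C\<^esub> F2 F ?g =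
      trL C ?FM ?FX (trR C (?FM \<odot>\<^bsub>C\<^esub> ?FX) ?FN ?H)"
  proof -
    have "(cR F N ?P \<triangleleft>\<^sub>2\<^bsub>C\<^esub> Id C ?FM) \<cdot>\<^bsub>C\<^esub> cL F (N \<triangleright>\<^bsub>B\<^esub> ?P) M \<cdot>\<^bsub>C\<^esub> F2 F ?g =
        trL C ?FM ?FX ((cR F N ?P \<cdot>\<^bsub>C\<^esub> F2 F ?k) \<cdot>\<^bsub>C\<^esub> c_left M X)"
      unfolding 1 by simp
    then show ?thesis
      unfolding 2 by simp
  qed
  have 4: "amap C ?FN (F1 F ?P) ?FM \<cdot>\<^bsub>C\<^esub> trL C ?FM ?FX (trR C (?FM \<odot>\<^bsub>C\<^esub> ?FX) ?FN ?H) =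
      trR C ?FX ?FN (trL C ?FM (?FX \<odot>\<^bsub>C\<^esub> ?FN) (?H \<cdot>\<^bsub>C\<^esub> inv_ar C ?a))"
    by (rule C.amap_trL_trR) auto
  have 5: "amap B N ?P M \<cdot>\<^bsub>B\<^esub> ?g = trR B X N ?j"
    using B.amap_trL_trR[of ?h M X N ?P] by simp
  have 6: "cR F N (?P \<triangleleft>\<^bsub>B\<^esub> M) \<cdot>\<^bsub>C\<^esub> F2 F (trR B X N ?j) = trR C ?FX ?FN (F2 F ?j \<cdot>\<^bsub>C\<^esub> c X N)"
    by (rule cR_trR) auto
  have 7: "cL F ?P M \<cdot>\<^bsub>C\<^esub> F2 F ?j = trL C ?FM (F1 F (X \<odot>\<^bsub>B\<^esub> N)) (c_left M (X \<odot>\<^bsub>B\<^esub> N))"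
    using cL_trL[of "Id B ?P" M "X \<odot>\<^bsub>B\<^esub> N" ?P] by simp
  have 8: "(Id C ?FN \<triangleright>\<^sub>2\<^bsub>C\<^esub> cL F ?P M) \<cdot>\<^bsub>C\<^esub> cR F N (?P \<triangleleft>\<^bsub>B\<^esub> M) \<cdot>\<^bsub>C\<^esub> F2 F (trR B X N ?j) =
      trR C ?FX ?FN (trL C ?FM (?FX \<odot>\<^bsub>C\<^esub> ?FN) ?K)"
  proof -
    have "(Id C ?FN \<triangleright>\<^sub>2\<^bsub>C\<^esub> cL F ?P M) \<cdot>\<^bsub>C\<^esub> cR F N (?P \<triangleleft>\<^bsub>B\<^esub> M) \<cdot>\<^bsub>C\<^esub> F2 F (trR B X N ?j) =
        trR C ?FX ?FN ((cL F ?P M \<cdot>\<^bsub>C\<^esub> F2 F ?j) \<cdot>\<^bsub>C\<^esub> c X N)"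
      unfolding 6 by simp
    then show ?thesis
      unfolding 7 by simp
  qed
  have e: "amap C ?FN (F1 F ?P) ?FM \<cdot>\<^bsub>C\<^esub> (cR F N ?P \<triangleleft>\<^sub>2\<^bsub>C\<^esub> Id C ?FM) \<cdot>\<^bsub>C\<^esub> cL F (N \<triangleright>\<^bsub>B\<^esub> ?P) M =
      (Id C ?FN \<triangleright>\<^sub>2\<^bsub>C\<^esub> cL F ?P M) \<cdot>\<^bsub>C\<^esub> cR F N (?P \<triangleleft>\<^bsub>B\<^esub> M) \<cdot>\<^bsub>C\<^esub> F2 F (amap B N ?P M)"
    by (rule c_amap[of _ "Src B N" "Trg B N" _ "Src B M" _ "Trg B M"]) (simp_all add: Hom1_def)
  have "amap C ?FN (F1 F ?P) ?FM \<cdot>\<^bsub>C\<^esub> (cR F N ?P \<triangleleft>\<^sub>2\<^bsub>C\<^esub> Id C ?FM) \<cdot>\<^bsub>C\<^esub> cL F (N \<triangleright>\<^bsub>B\<^esub> ?P) M \<cdot>\<^bsub>C\<^esub> F2 F ?g =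
      (amap C ?FN (F1 F ?P) ?FM \<cdot>\<^bsub>C\<^esub> (cR F N ?P \<triangleleft>\<^sub>2\<^bsub>C\<^esub> Id C ?FM) \<cdot>\<^bsub>C\<^esub> cL F (N \<triangleright>\<^bsub>B\<^esub> ?P) M) \<cdot>\<^bsub>C\<^esub> F2 F ?g"
    by simp
  also have "\<dots> = (Id C ?FN \<triangleright>\<^sub>2\<^bsub>C\<^esub> cL F ?P M) \<cdot>\<^bsub>C\<^esub> cR F N (?P \<triangleleft>\<^bsub>B\<^esub> M) \<cdot>\<^bsub>C\<^esub> F2 F (amap B N ?P M) \<cdot>\<^bsub>C\<^esub> F2 F ?g"
    unfolding e by simp
  also have "F2 F (amap B N ?P M) \<cdot>\<^bsub>C\<^esub> F2 F ?g = F2 F (trR B X N ?j)"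
    unfolding 5[symmetric] by (rule F2_Comp[symmetric]) auto
  finally have "trR C ?FX ?FN (trL C ?FM (?FX \<odot>\<^bsub>C\<^esub> ?FN) (?H \<cdot>\<^bsub>C\<^esub> inv_ar C ?a)) =
      trR C ?FX ?FN (trL C ?FM (?FX \<odot>\<^bsub>C\<^esub> ?FN) ?K)"
    unfolding 3 4 8 .
  then have "trL C ?FM (?FX \<odot>\<^bsub>C\<^esub> ?FN) (?H \<cdot>\<^bsub>C\<^esub> inv_ar C ?a) = trL C ?FM (?FX \<odot>\<^bsub>C\<^esub> ?FN) ?K"
    by (rule C.trR_inject) auto
  then have "?H \<cdot>\<^bsub>C\<^esub> inv_ar C ?a = ?K"
    by (rule C.trL_inject) auto
  then have "?K \<cdot>\<^bsub>C\<^esub> ?a = (?H \<cdot>\<^bsub>C\<^esub> inv_ar C ?a) \<cdot>\<^bsub>C\<^esub> ?a"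
    by simp
  also have "\<dots> = ?H"
    by simp
  finally show ?thesis
    by simp
qed

text \<open>In the mixed associativity law with \<open>U\<close> in the middle, the unit law of \<open>c_left\<close> for \<open>M \<odot> U\<close> removes
  \<open>c_left\<close> on one side, and the unit law of \<open>c\<close> for \<open>U \<odot> N\<close> removes \<open>c\<close> on the other. The triangle
  identifies what remains on the two sides as \<open>c\<close> and \<open>c_left\<close>, each composed with \<open>r \<odot> 1\<close>.\<close>

lemma c_left_eq_c:
  assumes M: "M \<in> Ob B" "N \<in> Ob B" "Trg B M = Src B N"
  shows "c_left M N = c M N"
proof -
  define S where "S = Src B N"
  have [simp]: "S \<in> Cell0 B" "Src B N = S" "Trg B M = S"
    using M by (simp_all add: S_def)
  note [simp] = M(1,2)
  let ?U = "U B S"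
  let ?FM = "F1 F M" and ?FN = "F1 F N"
  let ?UC = "U C (F0 F S)"
  let ?r = "runit C ?FM \<odot>\<^sub>2\<^bsub>C\<^esub> Id C ?FN"
  have m: "F2 F (assoc B M ?U N) \<cdot>\<^bsub>C\<^esub> c (M \<odot>\<^bsub>B\<^esub> ?U) N \<cdot>\<^bsub>C\<^esub> (c_left M ?U \<odot>\<^sub>2\<^bsub>C\<^esub> Id C ?FN) =
      c_left M (?U \<odot>\<^bsub>B\<^esub> N) \<cdot>\<^bsub>C\<^esub> (Id C ?FM \<odot>\<^sub>2\<^bsub>C\<^esub> c ?U N) \<cdot>\<^bsub>C\<^esub> assoc C ?FM (F1 F ?U) ?FN"
    by (rule c_left_assoc_c) auto
  have nR: "c M N \<cdot>\<^bsub>C\<^esub> (F2 F (runit B M) \<odot>\<^sub>2\<^bsub>C\<^esub> F2 F (Id B N)) =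
      F2 F (runit B M \<odot>\<^sub>2\<^bsub>B\<^esub> Id B N) \<cdot>\<^bsub>C\<^esub> c (M \<odot>\<^bsub>B\<^esub> ?U) N"
    by (rule c_natural) auto
  have nL: "c_left M N \<cdot>\<^bsub>C\<^esub> (F2 F (Id B M) \<odot>\<^sub>2\<^bsub>C\<^esub> F2 F (lunit B N)) =
      F2 F (Id B M \<odot>\<^sub>2\<^bsub>B\<^esub> lunit B N) \<cdot>\<^bsub>C\<^esub> c_left M (?U \<odot>\<^bsub>B\<^esub> N)"
    by (rule c_left_natural) auto
  have t: "F2 F (runit B M \<odot>\<^sub>2\<^bsub>B\<^esub> Id B N) = F2 F (Id B M \<odot>\<^sub>2\<^bsub>B\<^esub> lunit B N) \<cdot>\<^bsub>C\<^esub> F2 F (assoc B M ?U N)"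
    by (subst B.triangle_simp[symmetric]) (auto intro: F2_Comp)
  have t': "(Id C ?FM \<odot>\<^sub>2\<^bsub>C\<^esub> lunit C ?FN) \<cdot>\<^bsub>C\<^esub> assoc C ?FM ?UC ?FN = ?r"
    by (rule C.triangle_simp) auto
  have a: "assoc C ?FM (F1 F ?U) ?FN \<cdot>\<^bsub>C\<^esub> ((Id C ?FM \<odot>\<^sub>2\<^bsub>C\<^esub> iU F S) \<odot>\<^sub>2\<^bsub>C\<^esub> Id C ?FN) =
      (Id C ?FM \<odot>\<^sub>2\<^bsub>C\<^esub> (iU F S \<odot>\<^sub>2\<^bsub>C\<^esub> Id C ?FN)) \<cdot>\<^bsub>C\<^esub> assoc C ?FM ?UC ?FN"
    by (rule C.assoc_natural) auto
  have ur: "F2 F (runit B M) \<cdot>\<^bsub>C\<^esub> c_left M ?U \<cdot>\<^bsub>C\<^esub> (Id C ?FM \<odot>\<^sub>2\<^bsub>C\<^esub> iU F S) = runit C ?FM"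
    by (rule c_left_runit) auto
  have ul: "F2 F (lunit B N) \<cdot>\<^bsub>C\<^esub> c ?U N \<cdot>\<^bsub>C\<^esub> (iU F S \<odot>\<^sub>2\<^bsub>C\<^esub> Id C ?FN) = lunit C ?FN"
    by (rule c_lunit) auto
  have "c M N \<cdot>\<^bsub>C\<^esub> ?r = (c M N \<cdot>\<^bsub>C\<^esub> (F2 F (runit B M) \<odot>\<^sub>2\<^bsub>C\<^esub> F2 F (Id B N))) \<cdot>\<^bsub>C\<^esub>
      (c_left M ?U \<odot>\<^sub>2\<^bsub>C\<^esub> Id C ?FN) \<cdot>\<^bsub>C\<^esub> ((Id C ?FM \<odot>\<^sub>2\<^bsub>C\<^esub> iU F S) \<odot>\<^sub>2\<^bsub>C\<^esub> Id C ?FN)"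
    by (simp add: ur)
  also have "\<dots> = F2 F (Id B M \<odot>\<^sub>2\<^bsub>B\<^esub> lunit B N) \<cdot>\<^bsub>C\<^esub> (F2 F (assoc B M ?U N) \<cdot>\<^bsub>C\<^esub> c (M \<odot>\<^bsub>B\<^esub> ?U) N \<cdot>\<^bsub>C\<^esub>
      (c_left M ?U \<odot>\<^sub>2\<^bsub>C\<^esub> Id C ?FN)) \<cdot>\<^bsub>C\<^esub> ((Id C ?FM \<odot>\<^sub>2\<^bsub>C\<^esub> iU F S) \<odot>\<^sub>2\<^bsub>C\<^esub> Id C ?FN)"
    unfolding nR t by simp
  also have "\<dots> = (F2 F (Id B M \<odot>\<^sub>2\<^bsub>B\<^esub> lunit B N) \<cdot>\<^bsub>C\<^esub> c_left M (?U \<odot>\<^bsub>B\<^esub> N)) \<cdot>\<^bsub>C\<^esub> (Id C ?FM \<odot>\<^sub>2\<^bsub>C\<^esub> c ?U N) \<cdot>\<^bsub>C\<^esub>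
      (assoc C ?FM (F1 F ?U) ?FN \<cdot>\<^bsub>C\<^esub> ((Id C ?FM \<odot>\<^sub>2\<^bsub>C\<^esub> iU F S) \<odot>\<^sub>2\<^bsub>C\<^esub> Id C ?FN))"
    unfolding m by simp
  also have "\<dots> = c_left M N \<cdot>\<^bsub>C\<^esub> (Id C ?FM \<odot>\<^sub>2\<^bsub>C\<^esub> (F2 F (lunit B N) \<cdot>\<^bsub>C\<^esub> c ?U N \<cdot>\<^bsub>C\<^esub>
      (iU F S \<odot>\<^sub>2\<^bsub>C\<^esub> Id C ?FN))) \<cdot>\<^bsub>C\<^esub> assoc C ?FM ?UC ?FN"
    unfolding nL[symmetric] a by simp
  also have "\<dots> = c_left M N \<cdot>\<^bsub>C\<^esub> ?r"
    unfolding ul t' ..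
  finally show ?thesis
    by (rule C.iso_cancel_right[rotated, OF sym]) auto
qed

lemma c_assoc:
  assumes "M \<in> Ob B" "X \<in> Ob B" "N \<in> Ob B" "Trg B M = Src B X" "Trg B X = Src B N"
  shows "F2 F (assoc B M X N) \<cdot>\<^bsub>C\<^esub> c (M \<odot>\<^bsub>B\<^esub> X) N \<cdot>\<^bsub>C\<^esub> (c M X \<odot>\<^sub>2\<^bsub>C\<^esub> Id C (F1 F N)) =
    c M (X \<odot>\<^bsub>B\<^esub> N) \<cdot>\<^bsub>C\<^esub> (Id C (F1 F M) \<odot>\<^sub>2\<^bsub>C\<^esub> c X N) \<cdot>\<^bsub>C\<^esub> assoc C (F1 F M) (F1 F X) (F1 F N)"
  using c_left_assoc_c[OF assms] assms by (simp add: c_left_eq_c)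

end

section \<open>Images of dual pairs\<close>

context lax_closed_functor
begin

lemma F2_inv_iso:
  assumes "is_iso B f"
  shows "F2 F (inv_ar B f) \<cdot>\<^bsub>C\<^esub> F2 F f = Id C (F1 F (Dom B f))"
  using F2_Comp[of f "inv_ar B f"] assms B.is_iso_Ar[OF assms] by simp

lemma runit_inv_iU:
  assumes "M \<in> Ob B" "S = Trg B M" "is_iso C (iU F S)"
  shows "runit C (F1 F M) \<cdot>\<^bsub>C\<^esub> (Id C (F1 F M) \<odot>\<^sub>2\<^bsub>C\<^esub> inv_ar C (iU F S)) = F2 F (runit B M) \<cdot>\<^bsub>C\<^esub> c M (U B S)"
proof -
  have u: "F2 F (runit B M) \<cdot>\<^bsub>C\<^esub> c M (U B S) \<cdot>\<^bsub>C\<^esub> (Id C (F1 F M) \<odot>\<^sub>2\<^bsub>C\<^esub> iU F S) = runit C (F1 F M)"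
    by (rule c_runit) (use assms in auto)
  show ?thesis
    unfolding u[symmetric] using assms by simp
qed

lemma lunit_inv_iU:
  assumes "M \<in> Ob B" "R = Src B M" "is_iso C (iU F R)"
  shows "lunit C (F1 F M) \<cdot>\<^bsub>C\<^esub> (inv_ar C (iU F R) \<odot>\<^sub>2\<^bsub>C\<^esub> Id C (F1 F M)) = F2 F (lunit B M) \<cdot>\<^bsub>C\<^esub> c (U B R) M"
proof -
  have u: "F2 F (lunit B M) \<cdot>\<^bsub>C\<^esub> c (U B R) M \<cdot>\<^bsub>C\<^esub> (iU F R \<odot>\<^sub>2\<^bsub>C\<^esub> Id C (F1 F M)) = lunit C (F1 F M)"
    by (rule c_lunit) (use assms in auto)
  show ?thesis
    unfolding u[symmetric] using assms by simp
qed

lemma c_iU_inv_lunit: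
  assumes M: "M \<in> Ob B" "R = Src B M"
  shows "c (U B R) M \<cdot>\<^bsub>C\<^esub> (iU F R \<odot>\<^sub>2\<^bsub>C\<^esub> Id C (F1 F M)) \<cdot>\<^bsub>C\<^esub> inv_ar C (lunit C (F1 F M)) =
    F2 F (inv_ar B (lunit B M))"
proof -
  have u: "F2 F (lunit B M) \<cdot>\<^bsub>C\<^esub> c (U B R) M \<cdot>\<^bsub>C\<^esub> (iU F R \<odot>\<^sub>2\<^bsub>C\<^esub> Id C (F1 F M)) = lunit C (F1 F M)"
    by (rule c_lunit) (use assms in auto)
  have i: "F2 F (inv_ar B (lunit B M)) \<cdot>\<^bsub>C\<^esub> F2 F (lunit B M) = Id C (F1 F (U B R \<odot>\<^bsub>B\<^esub> M))"
    using F2_inv_iso[of "lunit B M"] M by simp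
  have "c (U B R) M \<cdot>\<^bsub>C\<^esub> (iU F R \<odot>\<^sub>2\<^bsub>C\<^esub> Id C (F1 F M)) \<cdot>\<^bsub>C\<^esub> inv_ar C (lunit C (F1 F M)) =
      (F2 F (inv_ar B (lunit B M)) \<cdot>\<^bsub>C\<^esub> F2 F (lunit B M)) \<cdot>\<^bsub>C\<^esub>
      c (U B R) M \<cdot>\<^bsub>C\<^esub> (iU F R \<odot>\<^sub>2\<^bsub>C\<^esub> Id C (F1 F M)) \<cdot>\<^bsub>C\<^esub> inv_ar C (lunit C (F1 F M))"
    unfolding i using M by simp
  also have "\<dots> = F2 F (inv_ar B (lunit B M)) \<cdot>\<^bsub>C\<^esub>
      (F2 F (lunit B M) \<cdot>\<^bsub>C\<^esub> c (U B R) M \<cdot>\<^bsub>C\<^esub> (iU F R \<odot>\<^sub>2\<^bsub>C\<^esub> Id C (F1 F M))) \<cdot>\<^bsub>C\<^esub> inv_ar C (lunit C (F1 F M))"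
    using M by simp
  also have "\<dots> = F2 F (inv_ar B (lunit B M))"
    unfolding u using M by simp
  finally show ?thesis .
qed

lemma c_iU_inv_runit:
  assumes M: "M \<in> Ob B" "S = Trg B M"
  shows "c M (U B S) \<cdot>\<^bsub>C\<^esub> (Id C (F1 F M) \<odot>\<^sub>2\<^bsub>C\<^esub> iU F S) \<cdot>\<^bsub>C\<^esub> inv_ar C (runit C (F1 F M)) =
    F2 F (inv_ar B (runit B M))"
proof -
  have u: "F2 F (runit B M) \<cdot>\<^bsub>C\<^esub> c M (U B S) \<cdot>\<^bsub>C\<^esub> (Id C (F1 F M) \<odot>\<^sub>2\<^bsub>C\<^esub> iU F S) = runit C (F1 F M)"
    by (rule c_runit) (use assms in auto)
  have i: "F2 F (inv_ar B (runit B M)) \<cdot>\<^bsub>C\<^esub> F2 F (runit B M) = Id C (F1 F (M \<odot>\<^bsub>B\<^esub> U B S))"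
    using F2_inv_iso[of "runit B M"] M by simp
  have "c M (U B S) \<cdot>\<^bsub>C\<^esub> (Id C (F1 F M) \<odot>\<^sub>2\<^bsub>C\<^esub> iU F S) \<cdot>\<^bsub>C\<^esub> inv_ar C (runit C (F1 F M)) =
      (F2 F (inv_ar B (runit B M)) \<cdot>\<^bsub>C\<^esub> F2 F (runit B M)) \<cdot>\<^bsub>C\<^esub>
      c M (U B S) \<cdot>\<^bsub>C\<^esub> (Id C (F1 F M) \<odot>\<^sub>2\<^bsub>C\<^esub> iU F S) \<cdot>\<^bsub>C\<^esub> inv_ar C (runit C (F1 F M))"
    unfolding i using M by simp
  also have "\<dots> = F2 F (inv_ar B (runit B M)) \<cdot>\<^bsub>C\<^esub>
      (F2 F (runit B M) \<cdot>\<^bsub>C\<^esub> c M (U B S) \<cdot>\<^bsub>C\<^esub> (Id C (F1 F M) \<odot>\<^sub>2\<^bsub>C\<^esub> iU F S)) \<cdot>\<^bsub>C\<^esub> inv_ar C (runit C (F1 F M))"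
    using M by simp
  also have "\<dots> = F2 F (inv_ar B (runit B M))"
    unfolding u using M by simp
  finally show ?thesis .
qed

end

locale lax_dual_pair = lax_closed_functor B C F
  for B :: "('o, 'm, 'c, 'y) closed_bicategory_scheme"
    and C :: "('p, 'n, 'd, 'z) closed_bicategory_scheme"
    and F :: "('o, 'm, 'c, 'p, 'n, 'd, 'x) lax_closed_functor_scheme" +
  fixes M M' :: 'm and \<eta> \<epsilon> :: 'c
  assumes dual: "dual_pair B M M' \<eta> \<epsilon>"
    and c_is_iso: "is_iso C (c_hcomp B C F M M')"
    and iU_is_iso: "is_iso C (iU F (Trg B M))"
begin

definition \<eta>F :: 'd where
  "\<eta>F = inv_ar C (c M M') \<cdot>\<^bsub>C\<^esub> F2 F \<eta> \<cdot>\<^bsub>C\<^esub> iU F (Src B M)"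

definition \<epsilon>F :: 'd where
  "\<epsilon>F = inv_ar C (iU F (Trg B M)) \<cdot>\<^bsub>C\<^esub> F2 F \<epsilon> \<cdot>\<^bsub>C\<^esub> c M' M"

lemmas dual_simps [simp] = B.dual_pairD[OF dual] c_is_iso iU_is_iso

lemma \<eta>F_simps [simp]:
  "\<eta>F \<in> Ar C" "Dom C \<eta>F = U C (F0 F (Src B M))" "Cod C \<eta>F = F1 F M \<odot>\<^bsub>C\<^esub> F1 F M'"
  "c M M' \<cdot>\<^bsub>C\<^esub> \<eta>F = F2 F \<eta> \<cdot>\<^bsub>C\<^esub> iU F (Src B M)"
  by (simp_all add: \<eta>F_def)

lemma \<epsilon>F_simps [simp]:
  "\<epsilon>F \<in> Ar C" "Dom C \<epsilon>F = F1 F M' \<odot>\<^bsub>C\<^esub> F1 F M" "Cod C \<epsilon>F = U C (F0 F (Trg B M))"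
  by (simp_all add: \<epsilon>F_def)

text \<open>After the tensor constraint cancels the inverse in \<open>\<eta>F\<close>, naturality and the unit law show that
  inserting \<open>\<eta>F\<close> is the image of inserting \<open>\<eta>\<close>.\<close>

lemma unit_left:
  assumes X [simp]: "X \<in> Ob B" "Src B X = Src B M"
  shows "c (M \<odot>\<^bsub>B\<^esub> M') X \<cdot>\<^bsub>C\<^esub> ((c M M' \<cdot>\<^bsub>C\<^esub> \<eta>F) \<odot>\<^sub>2\<^bsub>C\<^esub> Id C (F1 F X)) \<cdot>\<^bsub>C\<^esub> inv_ar C (lunit C (F1 F X)) =
    F2 F (\<eta> \<odot>\<^sub>2\<^bsub>B\<^esub> Id B X) \<cdot>\<^bsub>C\<^esub> F2 F (inv_ar B (lunit B X))"
proof -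
  let ?U = "U B (Src B M)"
  have n: "c (M \<odot>\<^bsub>B\<^esub> M') X \<cdot>\<^bsub>C\<^esub> (F2 F \<eta> \<odot>\<^sub>2\<^bsub>C\<^esub> F2 F (Id B X)) =
      F2 F (\<eta> \<odot>\<^sub>2\<^bsub>B\<^esub> Id B X) \<cdot>\<^bsub>C\<^esub> c ?U X"
    by (rule c_natural) auto
  have u: "c ?U X \<cdot>\<^bsub>C\<^esub> (iU F (Src B M) \<odot>\<^sub>2\<^bsub>C\<^esub> Id C (F1 F X)) \<cdot>\<^bsub>C\<^esub> inv_ar C (lunit C (F1 F X)) =
      F2 F (inv_ar B (lunit B X))"
    by (rule c_iU_inv_lunit) auto
  have "c (M \<odot>\<^bsub>B\<^esub> M') X \<cdot>\<^bsub>C\<^esub> ((c M M' \<cdot>\<^bsub>C\<^esub> \<eta>F) \<odot>\<^sub>2\<^bsub>C\<^esub> Id C (F1 F X)) \<cdot>\<^bsub>C\<^esub> inv_ar C (lunit C (F1 F X)) =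
      (c (M \<odot>\<^bsub>B\<^esub> M') X \<cdot>\<^bsub>C\<^esub> (F2 F \<eta> \<odot>\<^sub>2\<^bsub>C\<^esub> F2 F (Id B X))) \<cdot>\<^bsub>C\<^esub>
      (iU F (Src B M) \<odot>\<^sub>2\<^bsub>C\<^esub> Id C (F1 F X)) \<cdot>\<^bsub>C\<^esub> inv_ar C (lunit C (F1 F X))"
    by simp
  also have "\<dots> = F2 F (\<eta> \<odot>\<^sub>2\<^bsub>B\<^esub> Id B X) \<cdot>\<^bsub>C\<^esub> c ?U X \<cdot>\<^bsub>C\<^esub>
      (iU F (Src B M) \<odot>\<^sub>2\<^bsub>C\<^esub> Id C (F1 F X)) \<cdot>\<^bsub>C\<^esub> inv_ar C (lunit C (F1 F X))"
    unfolding n by simp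
  also have "\<dots> = F2 F (\<eta> \<odot>\<^sub>2\<^bsub>B\<^esub> Id B X) \<cdot>\<^bsub>C\<^esub> F2 F (inv_ar B (lunit B X))"
    unfolding u ..
  finally show ?thesis .
qed

lemma unit_right:
  assumes X [simp]: "X \<in> Ob B" "Trg B X = Src B M"
  shows "c X (M \<odot>\<^bsub>B\<^esub> M') \<cdot>\<^bsub>C\<^esub> (Id C (F1 F X) \<odot>\<^sub>2\<^bsub>C\<^esub> (c M M' \<cdot>\<^bsub>C\<^esub> \<eta>F)) \<cdot>\<^bsub>C\<^esub> inv_ar C (runit C (F1 F X)) =
    F2 F (Id B X \<odot>\<^sub>2\<^bsub>B\<^esub> \<eta>) \<cdot>\<^bsub>C\<^esub> F2 F (inv_ar B (runit B X))"
proof -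
  let ?U = "U B (Src B M)"
  have n: "c X (M \<odot>\<^bsub>B\<^esub> M') \<cdot>\<^bsub>C\<^esub> (F2 F (Id B X) \<odot>\<^sub>2\<^bsub>C\<^esub> F2 F \<eta>) =
      F2 F (Id B X \<odot>\<^sub>2\<^bsub>B\<^esub> \<eta>) \<cdot>\<^bsub>C\<^esub> c X ?U"
    by (rule c_natural) auto
  have u: "c X ?U \<cdot>\<^bsub>C\<^esub> (Id C (F1 F X) \<odot>\<^sub>2\<^bsub>C\<^esub> iU F (Src B M)) \<cdot>\<^bsub>C\<^esub> inv_ar C (runit C (F1 F X)) =
      F2 F (inv_ar B (runit B X))"
    by (rule c_iU_inv_runit) auto
  have "c X (M \<odot>\<^bsub>B\<^esub> M') \<cdot>\<^bsub>C\<^esub> (Id C (F1 F X) \<odot>\<^sub>2\<^bsub>C\<^esub> (c M M' \<cdot>\<^bsub>C\<^esub> \<eta>F)) \<cdot>\<^bsub>C\<^esub> inv_ar C (runit C (F1 F X)) =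
      (c X (M \<odot>\<^bsub>B\<^esub> M') \<cdot>\<^bsub>C\<^esub> (F2 F (Id B X) \<odot>\<^sub>2\<^bsub>C\<^esub> F2 F \<eta>)) \<cdot>\<^bsub>C\<^esub>
      (Id C (F1 F X) \<odot>\<^sub>2\<^bsub>C\<^esub> iU F (Src B M)) \<cdot>\<^bsub>C\<^esub> inv_ar C (runit C (F1 F X))"
    by simp
  also have "\<dots> = F2 F (Id B X \<odot>\<^sub>2\<^bsub>B\<^esub> \<eta>) \<cdot>\<^bsub>C\<^esub> c X ?U \<cdot>\<^bsub>C\<^esub>
      (Id C (F1 F X) \<odot>\<^sub>2\<^bsub>C\<^esub> iU F (Src B M)) \<cdot>\<^bsub>C\<^esub> inv_ar C (runit C (F1 F X))"
    unfolding n by simp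
  also have "\<dots> = F2 F (Id B X \<odot>\<^sub>2\<^bsub>B\<^esub> \<eta>) \<cdot>\<^bsub>C\<^esub> F2 F (inv_ar B (runit B X))"
    unfolding u ..
  finally show ?thesis .
qed

text \<open>Contracting with \<open>\<epsilon>F\<close> is, up to the constraints of the two products on the source, the image of
  contracting with \<open>\<epsilon>\<close>: the inverse of \<open>i\<close> in \<open>\<epsilon>F\<close> turns the unit law around, and the
  associativity law moves the constraint \<open>F M' \<odot> F M \<Rightarrow> F (M' \<odot> M)\<close> across.\<close>

lemma counit_right:
  assumes Q [simp]: "Q \<in> Ob B" "Trg B Q = Trg B M"
  shows "runit C (F1 F Q) \<cdot>\<^bsub>C\<^esub> (Id C (F1 F Q) \<odot>\<^sub>2\<^bsub>C\<^esub> \<epsilon>F) \<cdot>\<^bsub>C\<^esub> assoc C (F1 F Q) (F1 F M') (F1 F M) =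
    F2 F (runit B Q) \<cdot>\<^bsub>C\<^esub> F2 F (Id B Q \<odot>\<^sub>2\<^bsub>B\<^esub> \<epsilon>) \<cdot>\<^bsub>C\<^esub> F2 F (assoc B Q M' M) \<cdot>\<^bsub>C\<^esub>
      c (Q \<odot>\<^bsub>B\<^esub> M') M \<cdot>\<^bsub>C\<^esub> (c Q M' \<odot>\<^sub>2\<^bsub>C\<^esub> Id C (F1 F M))"
proof -
  let ?U = "U B (Trg B M)"
  let ?a = "assoc C (F1 F Q) (F1 F M') (F1 F M)"
  have u: "runit C (F1 F Q) \<cdot>\<^bsub>C\<^esub> (Id C (F1 F Q) \<odot>\<^sub>2\<^bsub>C\<^esub> inv_ar C (iU F (Trg B M))) =
      F2 F (runit B Q) \<cdot>\<^bsub>C\<^esub> c Q ?U"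
    by (rule runit_inv_iU) auto
  have n: "c Q ?U \<cdot>\<^bsub>C\<^esub> (F2 F (Id B Q) \<odot>\<^sub>2\<^bsub>C\<^esub> F2 F \<epsilon>) = F2 F (Id B Q \<odot>\<^sub>2\<^bsub>B\<^esub> \<epsilon>) \<cdot>\<^bsub>C\<^esub> c Q (M' \<odot>\<^bsub>B\<^esub> M)"
    by (rule c_natural) auto
  have a: "F2 F (assoc B Q M' M) \<cdot>\<^bsub>C\<^esub> c (Q \<odot>\<^bsub>B\<^esub> M') M \<cdot>\<^bsub>C\<^esub> (c Q M' \<odot>\<^sub>2\<^bsub>C\<^esub> Id C (F1 F M)) =
      c Q (M' \<odot>\<^bsub>B\<^esub> M) \<cdot>\<^bsub>C\<^esub> (Id C (F1 F Q) \<odot>\<^sub>2\<^bsub>C\<^esub> c M' M) \<cdot>\<^bsub>C\<^esub> ?a"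
    by (rule c_assoc) auto
  have "runit C (F1 F Q) \<cdot>\<^bsub>C\<^esub> (Id C (F1 F Q) \<odot>\<^sub>2\<^bsub>C\<^esub> \<epsilon>F) \<cdot>\<^bsub>C\<^esub> ?a =
      (runit C (F1 F Q) \<cdot>\<^bsub>C\<^esub> (Id C (F1 F Q) \<odot>\<^sub>2\<^bsub>C\<^esub> inv_ar C (iU F (Trg B M)))) \<cdot>\<^bsub>C\<^esub>
      (F2 F (Id B Q) \<odot>\<^sub>2\<^bsub>C\<^esub> F2 F \<epsilon>) \<cdot>\<^bsub>C\<^esub> (Id C (F1 F Q) \<odot>\<^sub>2\<^bsub>C\<^esub> c M' M) \<cdot>\<^bsub>C\<^esub> ?a"
    by (simp add: \<epsilon>F_def)
  also have "\<dots> = F2 F (runit B Q) \<cdot>\<^bsub>C\<^esub> (c Q ?U \<cdot>\<^bsub>C\<^esub> (F2 F (Id B Q) \<odot>\<^sub>2\<^bsub>C\<^esub> F2 F \<epsilon>)) \<cdot>\<^bsub>C\<^esub>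
      (Id C (F1 F Q) \<odot>\<^sub>2\<^bsub>C\<^esub> c M' M) \<cdot>\<^bsub>C\<^esub> ?a"
    unfolding u by simp
  also have "\<dots> = F2 F (runit B Q) \<cdot>\<^bsub>C\<^esub> F2 F (Id B Q \<odot>\<^sub>2\<^bsub>B\<^esub> \<epsilon>) \<cdot>\<^bsub>C\<^esub>
      (c Q (M' \<odot>\<^bsub>B\<^esub> M) \<cdot>\<^bsub>C\<^esub> (Id C (F1 F Q) \<odot>\<^sub>2\<^bsub>C\<^esub> c M' M) \<cdot>\<^bsub>C\<^esub> ?a)"
    unfolding n by simp
  finally show ?thesis
    unfolding a[symmetric] .
qed

lemma counit_left:
  "lunit C (F1 F M') \<cdot>\<^bsub>C\<^esub> (\<epsilon>F \<odot>\<^sub>2\<^bsub>C\<^esub> Id C (F1 F M')) \<cdot>\<^bsub>C\<^esub> inv_ar C (assoc C (F1 F M') (F1 F M) (F1 F M')) =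
    F2 F (lunit B M') \<cdot>\<^bsub>C\<^esub> F2 F (\<epsilon> \<odot>\<^sub>2\<^bsub>B\<^esub> Id B M') \<cdot>\<^bsub>C\<^esub> F2 F (inv_ar B (assoc B M' M M')) \<cdot>\<^bsub>C\<^esub>
      c M' (M \<odot>\<^bsub>B\<^esub> M') \<cdot>\<^bsub>C\<^esub> (Id C (F1 F M') \<odot>\<^sub>2\<^bsub>C\<^esub> c M M')"
proof -
  let ?U = "U B (Trg B M)"
  let ?a = "assoc C (F1 F M') (F1 F M) (F1 F M')"
  have u: "lunit C (F1 F M') \<cdot>\<^bsub>C\<^esub> (inv_ar C (iU F (Trg B M)) \<odot>\<^sub>2\<^bsub>C\<^esub> Id C (F1 F M')) =
      F2 F (lunit B M') \<cdot>\<^bsub>C\<^esub> c ?U M'"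
    by (rule lunit_inv_iU) auto
  have n: "c ?U M' \<cdot>\<^bsub>C\<^esub> (F2 F \<epsilon> \<odot>\<^sub>2\<^bsub>C\<^esub> F2 F (Id B M')) = F2 F (\<epsilon> \<odot>\<^sub>2\<^bsub>B\<^esub> Id B M') \<cdot>\<^bsub>C\<^esub> c (M' \<odot>\<^bsub>B\<^esub> M) M'"
    by (rule c_natural) auto
  have a: "F2 F (assoc B M' M M') \<cdot>\<^bsub>C\<^esub> c (M' \<odot>\<^bsub>B\<^esub> M) M' \<cdot>\<^bsub>C\<^esub> (c M' M \<odot>\<^sub>2\<^bsub>C\<^esub> Id C (F1 F M')) =
      c M' (M \<odot>\<^bsub>B\<^esub> M') \<cdot>\<^bsub>C\<^esub> (Id C (F1 F M') \<odot>\<^sub>2\<^bsub>C\<^esub> c M M') \<cdot>\<^bsub>C\<^esub> ?a"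
    by (rule c_assoc) auto
  have i: "F2 F (inv_ar B (assoc B M' M M')) \<cdot>\<^bsub>C\<^esub> F2 F (assoc B M' M M') =
      Id C (F1 F ((M' \<odot>\<^bsub>B\<^esub> M) \<odot>\<^bsub>B\<^esub> M'))"
    using F2_inv_iso[of "assoc B M' M M'"] by simp
  have a': "c (M' \<odot>\<^bsub>B\<^esub> M) M' \<cdot>\<^bsub>C\<^esub> (c M' M \<odot>\<^sub>2\<^bsub>C\<^esub> Id C (F1 F M')) \<cdot>\<^bsub>C\<^esub> inv_ar C ?a =
      F2 F (inv_ar B (assoc B M' M M')) \<cdot>\<^bsub>C\<^esub> c M' (M \<odot>\<^bsub>B\<^esub> M') \<cdot>\<^bsub>C\<^esub> (Id C (F1 F M') \<odot>\<^sub>2\<^bsub>C\<^esub> c M M')"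
  proof -
    have "c (M' \<odot>\<^bsub>B\<^esub> M) M' \<cdot>\<^bsub>C\<^esub> (c M' M \<odot>\<^sub>2\<^bsub>C\<^esub> Id C (F1 F M')) \<cdot>\<^bsub>C\<^esub> inv_ar C ?a =
      (F2 F (inv_ar B (assoc B M' M M')) \<cdot>\<^bsub>C\<^esub> F2 F (assoc B M' M M')) \<cdot>\<^bsub>C\<^esub>
      c (M' \<odot>\<^bsub>B\<^esub> M) M' \<cdot>\<^bsub>C\<^esub> (c M' M \<odot>\<^sub>2\<^bsub>C\<^esub> Id C (F1 F M')) \<cdot>\<^bsub>C\<^esub> inv_ar C ?a"
      unfolding i by simp
    also have "\<dots> = F2 F (inv_ar B (assoc B M' M M')) \<cdot>\<^bsub>C\<^esub>
      (F2 F (assoc B M' M M') \<cdot>\<^bsub>C\<^esub> c (M' \<odot>\<^bsub>B\<^esub> M) M' \<cdot>\<^bsub>C\<^esub> (c M' M \<odot>\<^sub>2\<^bsub>C\<^esub> Id C (F1 F M'))) \<cdot>\<^bsub>C\<^esub> inv_ar C ?a"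
      by simp
    finally show ?thesis
      unfolding a by simp
  qed
  have "lunit C (F1 F M') \<cdot>\<^bsub>C\<^esub> (\<epsilon>F \<odot>\<^sub>2\<^bsub>C\<^esub> Id C (F1 F M')) \<cdot>\<^bsub>C\<^esub> inv_ar C ?a =
      (lunit C (F1 F M') \<cdot>\<^bsub>C\<^esub> (inv_ar C (iU F (Trg B M)) \<odot>\<^sub>2\<^bsub>C\<^esub> Id C (F1 F M'))) \<cdot>\<^bsub>C\<^esub>
      (F2 F \<epsilon> \<odot>\<^sub>2\<^bsub>C\<^esub> F2 F (Id B M')) \<cdot>\<^bsub>C\<^esub> (c M' M \<odot>\<^sub>2\<^bsub>C\<^esub> Id C (F1 F M')) \<cdot>\<^bsub>C\<^esub> inv_ar C ?a"
    by (simp add: \<epsilon>F_def)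
  also have "\<dots> = F2 F (lunit B M') \<cdot>\<^bsub>C\<^esub> (c ?U M' \<cdot>\<^bsub>C\<^esub> (F2 F \<epsilon> \<odot>\<^sub>2\<^bsub>C\<^esub> F2 F (Id B M'))) \<cdot>\<^bsub>C\<^esub>
      (c M' M \<odot>\<^sub>2\<^bsub>C\<^esub> Id C (F1 F M')) \<cdot>\<^bsub>C\<^esub> inv_ar C ?a"
    unfolding u by simp
  also have "\<dots> = F2 F (lunit B M') \<cdot>\<^bsub>C\<^esub> F2 F (\<epsilon> \<odot>\<^sub>2\<^bsub>B\<^esub> Id B M') \<cdot>\<^bsub>C\<^esub>
      (c (M' \<odot>\<^bsub>B\<^esub> M) M' \<cdot>\<^bsub>C\<^esub> (c M' M \<odot>\<^sub>2\<^bsub>C\<^esub> Id C (F1 F M')) \<cdot>\<^bsub>C\<^esub> inv_ar C ?a)"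
    unfolding n by simp
  finally show ?thesis
    unfolding a' .
qed

text \<open>In each triangle identity the constraints left over by the counit are exactly those that the
  unit needs. Thus the composite is the image of the corresponding triangle for \<open>(M, M')\<close>.\<close>

lemma dual_pair_image: "dual_pair C (F1 F M) (F1 F M') \<eta>F \<epsilon>F"
proof -
  let ?FM = "F1 F M" and ?FM' = "F1 F M'"
  have "runit C ?FM \<cdot>\<^bsub>C\<^esub> (Id C ?FM \<odot>\<^sub>2\<^bsub>C\<^esub> \<epsilon>F) \<cdot>\<^bsub>C\<^esub> assoc C ?FM ?FM' ?FM \<cdot>\<^bsub>C\<^esub>
      (\<eta>F \<odot>\<^sub>2\<^bsub>C\<^esub> Id C ?FM) \<cdot>\<^bsub>C\<^esub> inv_ar C (lunit C ?FM) =
      (runit C ?FM \<cdot>\<^bsub>C\<^esub> (Id C ?FM \<odot>\<^sub>2\<^bsub>C\<^esub> \<epsilon>F) \<cdot>\<^bsub>C\<^esub> assoc C ?FM ?FM' ?FM) \<cdot>\<^bsub>C\<^esub>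
      (\<eta>F \<odot>\<^sub>2\<^bsub>C\<^esub> Id C ?FM) \<cdot>\<^bsub>C\<^esub> inv_ar C (lunit C ?FM)"
    by simp
  also have "\<dots> = F2 F (runit B M) \<cdot>\<^bsub>C\<^esub> F2 F (Id B M \<odot>\<^sub>2\<^bsub>B\<^esub> \<epsilon>) \<cdot>\<^bsub>C\<^esub> F2 F (assoc B M M' M) \<cdot>\<^bsub>C\<^esub>
      (c (M \<odot>\<^bsub>B\<^esub> M') M \<cdot>\<^bsub>C\<^esub> ((c M M' \<cdot>\<^bsub>C\<^esub> \<eta>F) \<odot>\<^sub>2\<^bsub>C\<^esub> Id C ?FM) \<cdot>\<^bsub>C\<^esub> inv_ar C (lunit C ?FM))"
    unfolding counit_right[OF dual_simps(1) refl] by (simp del: \<eta>F_simps(4))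
  also have "\<dots> = F2 F (runit B M \<cdot>\<^bsub>B\<^esub> (Id B M \<odot>\<^sub>2\<^bsub>B\<^esub> \<epsilon>) \<cdot>\<^bsub>B\<^esub> assoc B M M' M \<cdot>\<^bsub>B\<^esub>
      (\<eta> \<odot>\<^sub>2\<^bsub>B\<^esub> Id B M) \<cdot>\<^bsub>B\<^esub> inv_ar B (lunit B M))"
    unfolding unit_left[OF dual_simps(1) refl] by (simp add: F2_Comp)
  also have "\<dots> = Id C ?FM"
    unfolding B.dual_pair_zigzag(1)[OF dual] by simp
  finally have z1: "runit C ?FM \<cdot>\<^bsub>C\<^esub> (Id C ?FM \<odot>\<^sub>2\<^bsub>C\<^esub> \<epsilon>F) \<cdot>\<^bsub>C\<^esub> assoc C ?FM ?FM' ?FM \<cdot>\<^bsub>C\<^esub>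
      (\<eta>F \<odot>\<^sub>2\<^bsub>C\<^esub> Id C ?FM) \<cdot>\<^bsub>C\<^esub> inv_ar C (lunit C ?FM) = Id C ?FM" .
  have "lunit C ?FM' \<cdot>\<^bsub>C\<^esub> (\<epsilon>F \<odot>\<^sub>2\<^bsub>C\<^esub> Id C ?FM') \<cdot>\<^bsub>C\<^esub> inv_ar C (assoc C ?FM' ?FM ?FM') \<cdot>\<^bsub>C\<^esub>
      (Id C ?FM' \<odot>\<^sub>2\<^bsub>C\<^esub> \<eta>F) \<cdot>\<^bsub>C\<^esub> inv_ar C (runit C ?FM') =
      (lunit C ?FM' \<cdot>\<^bsub>C\<^esub> (\<epsilon>F \<odot>\<^sub>2\<^bsub>C\<^esub> Id C ?FM') \<cdot>\<^bsub>C\<^esub> inv_ar C (assoc C ?FM' ?FM ?FM')) \<cdot>\<^bsub>C\<^esub>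
      (Id C ?FM' \<odot>\<^sub>2\<^bsub>C\<^esub> \<eta>F) \<cdot>\<^bsub>C\<^esub> inv_ar C (runit C ?FM')"
    by simp
  also have "\<dots> = F2 F (lunit B M') \<cdot>\<^bsub>C\<^esub> F2 F (\<epsilon> \<odot>\<^sub>2\<^bsub>B\<^esub> Id B M') \<cdot>\<^bsub>C\<^esub> F2 F (inv_ar B (assoc B M' M M')) \<cdot>\<^bsub>C\<^esub>
      (c M' (M \<odot>\<^bsub>B\<^esub> M') \<cdot>\<^bsub>C\<^esub> (Id C ?FM' \<odot>\<^sub>2\<^bsub>C\<^esub> (c M M' \<cdot>\<^bsub>C\<^esub> \<eta>F)) \<cdot>\<^bsub>C\<^esub> inv_ar C (runit C ?FM'))"
    unfolding counit_left by (simp del: \<eta>F_simps(4))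
  also have "\<dots> = F2 F (lunit B M' \<cdot>\<^bsub>B\<^esub> (\<epsilon> \<odot>\<^sub>2\<^bsub>B\<^esub> Id B M') \<cdot>\<^bsub>B\<^esub> inv_ar B (assoc B M' M M') \<cdot>\<^bsub>B\<^esub>
      (Id B M' \<odot>\<^sub>2\<^bsub>B\<^esub> \<eta>) \<cdot>\<^bsub>B\<^esub> inv_ar B (runit B M'))"
    unfolding unit_right[OF dual_simps(2,4)] by (simp add: F2_Comp)
  also have "\<dots> = Id C ?FM'"
    unfolding B.dual_pair_zigzag(2)[OF dual] by simp
  finally have z2: "lunit C ?FM' \<cdot>\<^bsub>C\<^esub> (\<epsilon>F \<odot>\<^sub>2\<^bsub>C\<^esub> Id C ?FM') \<cdot>\<^bsub>C\<^esub> inv_ar C (assoc C ?FM' ?FM ?FM') \<cdot>\<^bsub>C\<^esub>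
      (Id C ?FM' \<odot>\<^sub>2\<^bsub>C\<^esub> \<eta>F) \<cdot>\<^bsub>C\<^esub> inv_ar C (runit C ?FM') = Id C ?FM'" .
  show ?thesis
    unfolding dual_pair_def using z1 z2 by (simp add: Hom1_def hom_def)
qed

text \<open>Both sides are transposes along \<open>F M\<close> of the contraction with the counit.\<close>

lemma cR_dual_in:
  assumes Q [simp]: "Q \<in> Ob B" "Trg B Q = Trg B M"
  shows "cR F M Q \<cdot>\<^bsub>C\<^esub> F2 F (B.dual_in M M' \<epsilon> Q) \<cdot>\<^bsub>C\<^esub> c Q M' = C.dual_in (F1 F M) (F1 F M') \<epsilon>F (F1 F Q)"
proof -
  let ?h = "runit B Q \<cdot>\<^bsub>B\<^esub> (Id B Q \<odot>\<^sub>2\<^bsub>B\<^esub> \<epsilon>) \<cdot>\<^bsub>B\<^esub> assoc B Q M' M"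
  let ?in = "B.dual_in M M' \<epsilon> Q"
  have [simp]: "?in \<in> Ar B" "Dom B ?in = Q \<odot>\<^bsub>B\<^esub> M'" "Cod B ?in = M \<triangleright>\<^bsub>B\<^esub> Q"
    by (auto intro: B.dual_in_simps[OF dual])
  have t: "cR F M Q \<cdot>\<^bsub>C\<^esub> F2 F ?in = trR C (F1 F (Q \<odot>\<^bsub>B\<^esub> M')) (F1 F M) (F2 F ?h \<cdot>\<^bsub>C\<^esub> c (Q \<odot>\<^bsub>B\<^esub> M') M)"
    unfolding B.dual_in_def by (rule cR_trR) auto
  have "cR F M Q \<cdot>\<^bsub>C\<^esub> F2 F ?in \<cdot>\<^bsub>C\<^esub> c Q M' = (cR F M Q \<cdot>\<^bsub>C\<^esub> F2 F ?in) \<cdot>\<^bsub>C\<^esub> c Q M'"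
    by simp
  also have "\<dots> = trR C (F1 F Q \<odot>\<^bsub>C\<^esub> F1 F M') (F1 F M)
      (F2 F (runit B Q) \<cdot>\<^bsub>C\<^esub> F2 F (Id B Q \<odot>\<^sub>2\<^bsub>B\<^esub> \<epsilon>) \<cdot>\<^bsub>C\<^esub> F2 F (assoc B Q M' M) \<cdot>\<^bsub>C\<^esub>
      c (Q \<odot>\<^bsub>B\<^esub> M') M \<cdot>\<^bsub>C\<^esub> (c Q M' \<odot>\<^sub>2\<^bsub>C\<^esub> Id C (F1 F M)))"
    unfolding t by (simp add: F2_Comp)
  also have "\<dots> = C.dual_in (F1 F M) (F1 F M') \<epsilon>F (F1 F Q)"
    unfolding C.dual_in_def counit_right[OF Q] ..
  finally show ?thesis .
qed

text \<open>Both evaluations in \<open>dual_out\<close> satisfy \<open>ev \<cdot> (1 \<odot> cL) = F ev \<cdot> c\<close>, which needs \<open>c_left = c\<close>.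
  Applying this twice leaves two constraints, and the associativity law moves them next to the
  unit, where \<open>unit_left\<close> absorbs them.\<close>

lemma F2_dual_out:
  assumes P [simp]: "P \<in> Ob B" "Src B P = Src B M"
  shows "F2 F (B.dual_out M M' \<eta> P) = C.dual_out (F1 F M) (F1 F M') \<eta>F (F1 F P) \<cdot>\<^bsub>C\<^esub>
    (cL F P M \<triangleleft>\<^sub>2\<^bsub>C\<^esub> Id C (F1 F M')) \<cdot>\<^bsub>C\<^esub> cL F (P \<triangleleft>\<^bsub>B\<^esub> M) M'"
proof -
  let ?FM = "F1 F M" and ?FM' = "F1 F M'" and ?FP = "F1 F P"
  let ?PM = "P \<triangleleft>\<^bsub>B\<^esub> M"
  let ?X = "?PM \<triangleleft>\<^bsub>B\<^esub> M'"
  let ?FX = "F1 F ?X"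
  let ?Y = "(?FP \<triangleleft>\<^bsub>C\<^esub> ?FM) \<triangleleft>\<^bsub>C\<^esub> ?FM'"
  let ?D = "(cL F P M \<triangleleft>\<^sub>2\<^bsub>C\<^esub> Id C ?FM') \<cdot>\<^bsub>C\<^esub> cL F ?PM M'"
  have cL_ev: "cL F V W = trL C (F1 F W) (F1 F (V \<triangleleft>\<^bsub>B\<^esub> W)) (F2 F (evL B W V) \<cdot>\<^bsub>C\<^esub> c W (V \<triangleleft>\<^bsub>B\<^esub> W))"
    if [simp]: "W \<in> Ob B" "V \<in> Ob B" "Src B W = Src B V" for V W
    using cL_trL[of "evL B W V" W "V \<triangleleft>\<^bsub>B\<^esub> W" V] by (simp add: c_left_eq_c)
  have D: "?D = trL C ?FM' ?FX (cL F P M \<cdot>\<^bsub>C\<^esub> F2 F (evL B M' ?PM) \<cdot>\<^bsub>C\<^esub> c M' ?X)"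
    by (subst cL_ev[of M' ?PM]) simp_all
  have ev: "evL C ?FM ?FP \<cdot>\<^bsub>C\<^esub> (Id C ?FM \<odot>\<^sub>2\<^bsub>C\<^esub> cL F P M) = F2 F (evL B M P) \<cdot>\<^bsub>C\<^esub> c M ?PM"
    by (subst cL_ev[of M P]) simp_all
  have [simp]: "?D \<in> Ar C" "Dom C ?D = ?FX" "Cod C ?D = ?Y"
    by simp_all
  have n1: "inv_ar C (lunit C ?Y) \<cdot>\<^bsub>C\<^esub> ?D =
      (Id C (U C (F0 F (Src B M))) \<odot>\<^sub>2\<^bsub>C\<^esub> ?D) \<cdot>\<^bsub>C\<^esub> inv_ar C (lunit C ?FX)"
  proof (rule C.iso_cancel_left[of "lunit C ?Y"])
    have "lunit C ?Y \<cdot>\<^bsub>C\<^esub> (Id C (U C (F0 F (Src B M))) \<odot>\<^sub>2\<^bsub>C\<^esub> ?D) \<cdot>\<^bsub>C\<^esub> inv_ar C (lunit C ?FX) =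
        (?D \<cdot>\<^bsub>C\<^esub> lunit C ?FX) \<cdot>\<^bsub>C\<^esub> inv_ar C (lunit C ?FX)"
      by (intro C.extend C.lunit_natural) auto
    then show "lunit C ?Y \<cdot>\<^bsub>C\<^esub> inv_ar C (lunit C ?Y) \<cdot>\<^bsub>C\<^esub> ?D = lunit C ?Y \<cdot>\<^bsub>C\<^esub>
        (Id C (U C (F0 F (Src B M))) \<odot>\<^sub>2\<^bsub>C\<^esub> ?D) \<cdot>\<^bsub>C\<^esub> inv_ar C (lunit C ?FX)"
      by simp
  qed simp_all
  have n2: "assoc C ?FM ?FM' ?Y \<cdot>\<^bsub>C\<^esub> ((Id C ?FM \<odot>\<^sub>2\<^bsub>C\<^esub> Id C ?FM') \<odot>\<^sub>2\<^bsub>C\<^esub> ?D) =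
      (Id C ?FM \<odot>\<^sub>2\<^bsub>C\<^esub> (Id C ?FM' \<odot>\<^sub>2\<^bsub>C\<^esub> ?D)) \<cdot>\<^bsub>C\<^esub> assoc C ?FM ?FM' ?FX"
    by (rule C.assoc_natural) simp_all
  have ev': "evL C ?FM' (?FP \<triangleleft>\<^bsub>C\<^esub> ?FM) \<cdot>\<^bsub>C\<^esub> (Id C ?FM' \<odot>\<^sub>2\<^bsub>C\<^esub> ?D) =
      cL F P M \<cdot>\<^bsub>C\<^esub> F2 F (evL B M' ?PM) \<cdot>\<^bsub>C\<^esub> c M' ?X"
    unfolding D by (rule C.evL_trL) simp_all
  have nc: "c M ?PM \<cdot>\<^bsub>C\<^esub> (F2 F (Id B M) \<odot>\<^sub>2\<^bsub>C\<^esub> F2 F (evL B M' ?PM)) =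
      F2 F (Id B M \<odot>\<^sub>2\<^bsub>B\<^esub> evL B M' ?PM) \<cdot>\<^bsub>C\<^esub> c M (M' \<odot>\<^bsub>B\<^esub> ?X)"
    by (rule c_natural) simp_all
  have a: "F2 F (assoc B M M' ?X) \<cdot>\<^bsub>C\<^esub> c (M \<odot>\<^bsub>B\<^esub> M') ?X \<cdot>\<^bsub>C\<^esub> (c M M' \<odot>\<^sub>2\<^bsub>C\<^esub> Id C ?FX) =
      c M (M' \<odot>\<^bsub>B\<^esub> ?X) \<cdot>\<^bsub>C\<^esub> (Id C ?FM \<odot>\<^sub>2\<^bsub>C\<^esub> c M' ?X) \<cdot>\<^bsub>C\<^esub> assoc C ?FM ?FM' ?FX"
    by (rule c_assoc) simp_all
  let ?e = "evL C ?FM ?FP" and ?e' = "evL C ?FM' (?FP \<triangleleft>\<^bsub>C\<^esub> ?FM)"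
  let ?l = "inv_ar C (lunit C ?FX)"
  have "C.dual_out ?FM ?FM' \<eta>F ?FP \<cdot>\<^bsub>C\<^esub> ?D = ?e \<cdot>\<^bsub>C\<^esub> (Id C ?FM \<odot>\<^sub>2\<^bsub>C\<^esub> ?e') \<cdot>\<^bsub>C\<^esub> assoc C ?FM ?FM' ?Y \<cdot>\<^bsub>C\<^esub>
      (\<eta>F \<odot>\<^sub>2\<^bsub>C\<^esub> Id C ?Y) \<cdot>\<^bsub>C\<^esub> (inv_ar C (lunit C ?Y) \<cdot>\<^bsub>C\<^esub> ?D)"
    unfolding C.dual_out_def by simp
  also have "\<dots> = ?e \<cdot>\<^bsub>C\<^esub> (Id C ?FM \<odot>\<^sub>2\<^bsub>C\<^esub> ?e') \<cdot>\<^bsub>C\<^esub>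
      (assoc C ?FM ?FM' ?Y \<cdot>\<^bsub>C\<^esub> ((Id C ?FM \<odot>\<^sub>2\<^bsub>C\<^esub> Id C ?FM') \<odot>\<^sub>2\<^bsub>C\<^esub> ?D)) \<cdot>\<^bsub>C\<^esub> (\<eta>F \<odot>\<^sub>2\<^bsub>C\<^esub> Id C ?FX) \<cdot>\<^bsub>C\<^esub> ?l"
    unfolding n1 by simp
  also have "\<dots> = ?e \<cdot>\<^bsub>C\<^esub> (Id C ?FM \<odot>\<^sub>2\<^bsub>C\<^esub> (?e' \<cdot>\<^bsub>C\<^esub> (Id C ?FM' \<odot>\<^sub>2\<^bsub>C\<^esub> ?D))) \<cdot>\<^bsub>C\<^esub>
      assoc C ?FM ?FM' ?FX \<cdot>\<^bsub>C\<^esub> (\<eta>F \<odot>\<^sub>2\<^bsub>C\<^esub> Id C ?FX) \<cdot>\<^bsub>C\<^esub> ?l"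
    unfolding n2 by simp
  also have "\<dots> = (?e \<cdot>\<^bsub>C\<^esub> (Id C ?FM \<odot>\<^sub>2\<^bsub>C\<^esub> cL F P M)) \<cdot>\<^bsub>C\<^esub> (F2 F (Id B M) \<odot>\<^sub>2\<^bsub>C\<^esub> F2 F (evL B M' ?PM)) \<cdot>\<^bsub>C\<^esub>
      (Id C ?FM \<odot>\<^sub>2\<^bsub>C\<^esub> c M' ?X) \<cdot>\<^bsub>C\<^esub> assoc C ?FM ?FM' ?FX \<cdot>\<^bsub>C\<^esub> (\<eta>F \<odot>\<^sub>2\<^bsub>C\<^esub> Id C ?FX) \<cdot>\<^bsub>C\<^esub> ?l"
    unfolding ev' by simp
  also have "\<dots> = F2 F (evL B M P) \<cdot>\<^bsub>C\<^esub> (c M ?PM \<cdot>\<^bsub>C\<^esub> (F2 F (Id B M) \<odot>\<^sub>2\<^bsub>C\<^esub> F2 F (evL B M' ?PM))) \<cdot>\<^bsub>C\<^esub>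
      (Id C ?FM \<odot>\<^sub>2\<^bsub>C\<^esub> c M' ?X) \<cdot>\<^bsub>C\<^esub> assoc C ?FM ?FM' ?FX \<cdot>\<^bsub>C\<^esub> (\<eta>F \<odot>\<^sub>2\<^bsub>C\<^esub> Id C ?FX) \<cdot>\<^bsub>C\<^esub> ?l"
    unfolding ev by simp
  also have "\<dots> = F2 F (evL B M P) \<cdot>\<^bsub>C\<^esub> F2 F (Id B M \<odot>\<^sub>2\<^bsub>B\<^esub> evL B M' ?PM) \<cdot>\<^bsub>C\<^esub>
      (c M (M' \<odot>\<^bsub>B\<^esub> ?X) \<cdot>\<^bsub>C\<^esub> (Id C ?FM \<odot>\<^sub>2\<^bsub>C\<^esub> c M' ?X) \<cdot>\<^bsub>C\<^esub> assoc C ?FM ?FM' ?FX) \<cdot>\<^bsub>C\<^esub>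
      (\<eta>F \<odot>\<^sub>2\<^bsub>C\<^esub> Id C ?FX) \<cdot>\<^bsub>C\<^esub> ?l"
    unfolding nc by simp
  also have "\<dots> = F2 F (evL B M P) \<cdot>\<^bsub>C\<^esub> F2 F (Id B M \<odot>\<^sub>2\<^bsub>B\<^esub> evL B M' ?PM) \<cdot>\<^bsub>C\<^esub> F2 F (assoc B M M' ?X) \<cdot>\<^bsub>C\<^esub>
      (c (M \<odot>\<^bsub>B\<^esub> M') ?X \<cdot>\<^bsub>C\<^esub> ((c M M' \<cdot>\<^bsub>C\<^esub> \<eta>F) \<odot>\<^sub>2\<^bsub>C\<^esub> Id C ?FX) \<cdot>\<^bsub>C\<^esub> ?l)"
    unfolding a[symmetric] by (simp del: \<eta>F_simps(4))
  also have "\<dots> = F2 F (evL B M P) \<cdot>\<^bsub>C\<^esub> F2 F (Id B M \<odot>\<^sub>2\<^bsub>B\<^esub> evL B M' ?PM) \<cdot>\<^bsub>C\<^esub> F2 F (assoc B M M' ?X) \<cdot>\<^bsub>C\<^esub>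
      F2 F (\<eta> \<odot>\<^sub>2\<^bsub>B\<^esub> Id B ?X) \<cdot>\<^bsub>C\<^esub> F2 F (inv_ar B (lunit B ?X))"
    by (subst unit_left) simp_all
  also have "\<dots> = F2 F (B.dual_out M M' \<eta> P)"
    unfolding B.dual_out_def by (simp add: F2_Comp)
  finally show ?thesis ..
qed

end

section \<open>Images of cotraces\<close>

context lax_coshadow_functor
begin

lemma G2_simps [simp]:
  assumes "f \<in> Ar T"
  shows "G2 F f \<in> Ar Z" "Dom Z (G2 F f) = G1 F (Dom T f)" "Cod Z (G2 F f) = G1 F (Cod T f)"
  using cat_functorD(2-4)[OF G_functor, of f] assms by auto

lemma G2_Comp:
  assumes "f \<in> Ar T" "g \<in> Ar T" "Cod T f = Dom T g"
  shows "G2 F (g \<cdot>\<^bsub>T\<^esub> f) = G2 F g \<cdot>\<^bsub>Z\<^esub> G2 F f"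
  using cat_functorD(6)[OF G_functor, of f g] assms by auto

lemma phi_simps [simp]:
  assumes "M \<in> Ob B" "Src B M = Trg B M"
  shows "phi F M \<in> Ar Z" "Dom Z (phi F M) = G1 F (Csh1 ShB M)" "Cod Z (phi F M) = Csh1 ShC (F1 F M)"
  using nat_transD(1-3)[OF phi_nat[of "Src B M"], of M] assms by (auto simp: Hom1_def)

lemma phi_natural:
  assumes "m \<in> Ar B" "Src B (Dom B m) = Trg B (Dom B m)" "M = Dom B m" "N = Cod B m"
  shows "phi F N \<cdot>\<^bsub>Z\<^esub> G2 F (Csh2 ShB m) = Csh2 ShC (F2 F m) \<cdot>\<^bsub>Z\<^esub> phi F M"
  using nat_transD(4)[OF phi_nat[of "Src B (Dom B m)"], of m] assms by (auto simp: Hom1_def)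

text \<open>The cotrace of \<open>F M\<close> may be taken with respect to the image pair. Then \<open>\<phi>\<close> slides through the
  three factors of the cotrace from left to right: past \<open>out\<close> by \<open>F2_dual_out\<close>, past \<open>\<theta>\<close> by the
  defining compatibility of a coshadow functor, and past the source half by \<open>cR_trR\<close> and
  \<open>cR_dual_in\<close>.\<close>

lemma phi_cotr:
  assumes d: "dual_pair B M M' \<eta> \<epsilon>"
    and ci: "is_iso C (c_hcomp B C F M M')" and ii: "is_iso C (iU F (Trg B M))"
    and Q: "Q \<in> Ob B" "Src B Q = Trg B M" "Trg B Q = Trg B M"
    and P: "P \<in> Ob B" "Src B P = Src B M" "Trg B P = Src B M"
    and f: "f \<in> Ar B" "Dom B f = M \<triangleright>\<^bsub>B\<^esub> Q" "Cod B f = P \<triangleleft>\<^bsub>B\<^esub> M"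
    and cQ: "is_iso C (cR F M Q)"
    and d': "dual_pair C (F1 F M) N \<eta>' \<epsilon>'"
  shows "phi F P \<cdot>\<^bsub>Z\<^esub> G2 F (cotr B T ShB M M' \<eta> \<epsilon> Q P f) =
    cotr C Z ShC (F1 F M) N \<eta>' \<epsilon>' (F1 F Q) (F1 F P)
      (cL F P M \<cdot>\<^bsub>C\<^esub> F2 F f \<cdot>\<^bsub>C\<^esub> inv_ar C (cR F M Q)) \<cdot>\<^bsub>Z\<^esub> phi F Q"
proof -
  interpret lax_dual_pair B C F M M' \<eta> \<epsilon>
    by unfold_locales (fact d ci ii)+
  note [simp] = Q P f cQ B.dual_in_simps[OF dual] B.dual_out_simps[OF dual]
    C.dual_in_simps[OF dual_pair_image] C.dual_out_simps[OF dual_pair_image]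
  let ?FM = "F1 F M" and ?FM' = "F1 F M'" and ?FP = "F1 F P" and ?FQ = "F1 F Q"
  let ?PM = "P \<triangleleft>\<^bsub>B\<^esub> M"
  let ?X = "?PM \<triangleleft>\<^bsub>B\<^esub> M'"
  let ?Y = "M' \<triangleright>\<^bsub>B\<^esub> ?PM"
  let ?out = "B.dual_out M M' \<eta> P" and ?in = "B.dual_in M M' \<epsilon> Q"
  let ?out' = "C.dual_out ?FM ?FM' \<eta>F ?FP" and ?in' = "C.dual_in ?FM ?FM' \<epsilon>F ?FQ"
  let ?\<alpha> = "trR B Q M' (f \<cdot>\<^bsub>B\<^esub> ?in)"
  let ?f' = "cL F P M \<cdot>\<^bsub>C\<^esub> F2 F f \<cdot>\<^bsub>C\<^esub> inv_ar C (cR F M Q)"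
  let ?\<alpha>' = "trR C ?FQ ?FM' (?f' \<cdot>\<^bsub>C\<^esub> ?in')"
  let ?\<theta> = "theta ShB M' ?PM"
  let ?\<theta>' = "theta ShC ?FM' (F1 F ?PM)"
  let ?l = "cL F P M \<triangleleft>\<^sub>2\<^bsub>C\<^esub> Id C ?FM'"
  let ?r = "Id C ?FM' \<triangleright>\<^sub>2\<^bsub>C\<^esub> cL F P M"

  have p1: "phi F P \<cdot>\<^bsub>Z\<^esub> G2 F (Csh2 ShB ?out) = Csh2 ShC (F2 F ?out) \<cdot>\<^bsub>Z\<^esub> phi F ?X"
    by (rule phi_natural) simp_all
  have o: "Csh2 ShC (F2 F ?out) = Csh2 ShC ?out' \<cdot>\<^bsub>Z\<^esub> Csh2 ShC ?l \<cdot>\<^bsub>Z\<^esub> Csh2 ShC (cL F ?PM M')"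
    unfolding F2_dual_out[OF P(1,2)] by (simp add: C.Csh2_Comp)
  have p2: "Csh2 ShC (cL F ?PM M') \<cdot>\<^bsub>Z\<^esub> phi F ?X \<cdot>\<^bsub>Z\<^esub> G2 F ?\<theta> =
      ?\<theta>' \<cdot>\<^bsub>Z\<^esub> Csh2 ShC (cR F M' ?PM) \<cdot>\<^bsub>Z\<^esub> phi F ?Y"
    by (rule phi_theta[symmetric, of _ "Trg B M" "Src B M"]) (simp_all add: Hom1_def)
  have p3: "phi F ?Y \<cdot>\<^bsub>Z\<^esub> G2 F (Csh2 ShB ?\<alpha>) = Csh2 ShC (F2 F ?\<alpha>) \<cdot>\<^bsub>Z\<^esub> phi F Q"
    by (rule phi_natural) simp_all
  have th: "theta ShC ?FM' (?FP \<triangleleft>\<^bsub>C\<^esub> ?FM) \<cdot>\<^bsub>Z\<^esub> Csh2 ShC ?r = Csh2 ShC ?l \<cdot>\<^bsub>Z\<^esub> ?\<theta>'"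
    by (rule C.theta_natural) simp_all
  have t: "cR F M' ?PM \<cdot>\<^bsub>C\<^esub> F2 F ?\<alpha> = trR C ?FQ ?FM' (F2 F (f \<cdot>\<^bsub>B\<^esub> ?in) \<cdot>\<^bsub>C\<^esub> c Q M')"
    by (rule cR_trR) simp_all
  have a: "?r \<cdot>\<^bsub>C\<^esub> cR F M' ?PM \<cdot>\<^bsub>C\<^esub> F2 F ?\<alpha> = ?\<alpha>'"
    unfolding t cR_dual_in[OF Q(1,3), symmetric] by (simp add: F2_Comp)
  have "phi F P \<cdot>\<^bsub>Z\<^esub> G2 F (cotr B T ShB M M' \<eta> \<epsilon> Q P f) =
      (phi F P \<cdot>\<^bsub>Z\<^esub> G2 F (Csh2 ShB ?out)) \<cdot>\<^bsub>Z\<^esub> G2 F ?\<theta> \<cdot>\<^bsub>Z\<^esub> G2 F (Csh2 ShB ?\<alpha>)"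
    unfolding B.cotr_eq[OF d Q P(1,2) f(1,2)] by (simp add: G2_Comp)
  also have "\<dots> = Csh2 ShC ?out' \<cdot>\<^bsub>Z\<^esub> Csh2 ShC ?l \<cdot>\<^bsub>Z\<^esub>
      (Csh2 ShC (cL F ?PM M') \<cdot>\<^bsub>Z\<^esub> phi F ?X \<cdot>\<^bsub>Z\<^esub> G2 F ?\<theta>) \<cdot>\<^bsub>Z\<^esub> G2 F (Csh2 ShB ?\<alpha>)"
    unfolding p1 o by simp
  also have "\<dots> = Csh2 ShC ?out' \<cdot>\<^bsub>Z\<^esub> (Csh2 ShC ?l \<cdot>\<^bsub>Z\<^esub> ?\<theta>') \<cdot>\<^bsub>Z\<^esub> Csh2 ShC (cR F M' ?PM) \<cdot>\<^bsub>Z\<^esub>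
      (phi F ?Y \<cdot>\<^bsub>Z\<^esub> G2 F (Csh2 ShB ?\<alpha>))"
    unfolding p2 by simp
  also have "\<dots> = (Csh2 ShC ?out' \<cdot>\<^bsub>Z\<^esub> theta ShC ?FM' (?FP \<triangleleft>\<^bsub>C\<^esub> ?FM) \<cdot>\<^bsub>Z\<^esub>
      Csh2 ShC (?r \<cdot>\<^bsub>C\<^esub> cR F M' ?PM \<cdot>\<^bsub>C\<^esub> F2 F ?\<alpha>)) \<cdot>\<^bsub>Z\<^esub> phi F Q"
    unfolding p3 th[symmetric] by (simp add: C.Csh2_Comp del: C.trR_postcomp)
  also have "\<dots> = cotr C Z ShC ?FM ?FM' \<eta>F \<epsilon>F ?FQ ?FP ?f' \<cdot>\<^bsub>Z\<^esub> phi F Q"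
    unfolding a by (subst C.cotr_eq[OF dual_pair_image]) simp_all
  also have "cotr C Z ShC ?FM ?FM' \<eta>F \<epsilon>F ?FQ ?FP ?f' = cotr C Z ShC ?FM N \<eta>' \<epsilon>' ?FQ ?FP ?f'"
    by (rule C.cotr_indep[OF dual_pair_image d']) simp_all
  finally show ?thesis .
qed

end

theorem proposition7p4:
  fixes B :: "('o, 'm, 'c) closed_bicategory"
    and T :: "('t, 'u) category"
    and ShB :: "('m, 'c, 't, 'u) coshadow"
    and C :: "('p, 'n, 'd) closed_bicategory"
    and Z :: "('v, 'w) category"
    and ShC :: "('n, 'd, 'v, 'w) coshadow"
    and F :: "('o, 'm, 'c, 't, 'u, 'p, 'n, 'd, 'v, 'w) lax_coshadow_functor"
    and R S :: 'o and M Md :: 'm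
  assumes closed_B: "closed_bicategory B"
    and closed_C: "closed_bicategory C"
    and cosh_B: "coshadow B T ShB"
    and cosh_C: "coshadow C Z ShC"
    and lax_F: "lax_coshadow_functor B T ShB C Z ShC F"
    and M_cell: "M \<in> Hom1 B R S"
    and M_dual: "right_dual B M Md"
    and c_iso: "is_iso C (c_hcomp B C F M Md)"
    and i_iso: "is_iso C (iU F S)"
  shows "right_dual C (F1 F M) (F1 F Md) \<and>
    (\<forall>Q\<in>Hom1 B S S. \<forall>P\<in>Hom1 B R R. is_iso C (cR F M Q) \<longrightarrow>
      (\<forall>f\<in>hom B (M \<triangleright>\<^bsub>B\<^esub> Q) (P \<triangleleft>\<^bsub>B\<^esub> M).
       \<forall>M' \<eta> \<epsilon>. dual_pair B M M' \<eta> \<epsilon> \<longrightarrow>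
       (\<forall>N \<eta>' \<epsilon>'. dual_pair C (F1 F M) N \<eta>' \<epsilon>' \<longrightarrow>
        phi F P \<cdot>\<^bsub>Z\<^esub> G2 F (cotr B T ShB M M' \<eta> \<epsilon> Q P f) =
        cotr C Z ShC (F1 F M) N \<eta>' \<epsilon>' (F1 F Q) (F1 F P)
          (cL F P M \<cdot>\<^bsub>C\<^esub> F2 F f \<cdot>\<^bsub>C\<^esub> inv_ar C (cR F M Q)) \<cdot>\<^bsub>Z\<^esub> phi F Q)))"
proof -
  interpret lax_coshadow_functor B T ShB C Z ShC F
    by (rule lax_F)
  obtain \<eta>\<^sub>0 \<epsilon>\<^sub>0 where d: "dual_pair B M Md \<eta>\<^sub>0 \<epsilon>\<^sub>0"
    using M_dual unfolding right_dual_def by blast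
  have M: "M \<in> Ob B" "Src B M = R" "Trg B M = S"
    using M_cell by (auto simp: Hom1_def)
  have i: "is_iso C (iU F (Trg B M))"
    using i_iso M by simp
  interpret D: lax_dual_pair B C F M Md \<eta>\<^sub>0 \<epsilon>\<^sub>0
    by unfold_locales (fact d c_iso i)+
  show ?thesis
  proof (intro conjI ballI allI impI)
    show "right_dual C (F1 F M) (F1 F Md)"
      unfolding right_dual_def using D.dual_pair_image by blast
  next
    fix Q P f M' \<eta> \<epsilon> N \<eta>' \<epsilon>'
    assume "Q \<in> Hom1 B S S" "P \<in> Hom1 B R R" and cQ: "is_iso C (cR F M Q)"
      and "f \<in> hom B (M \<triangleright>\<^bsub>B\<^esub> Q) (P \<triangleleft>\<^bsub>B\<^esub> M)"
      and e: "dual_pair B M M' \<eta> \<epsilon>" and d': "dual_pair C (F1 F M) N \<eta>' \<epsilon>'"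
    then have QPf: "Q \<in> Ob B" "Src B Q = Trg B M" "Trg B Q = Trg B M"
      "P \<in> Ob B" "Src B P = Src B M" "Trg B P = Src B M"
      "f \<in> Ar B" "Dom B f = M \<triangleright>\<^bsub>B\<^esub> Q" "Cod B f = P \<triangleleft>\<^bsub>B\<^esub> M"
      using M by (auto simp: Hom1_def hom_def)
    \<comment> \<open>The constraint \<open>c\<close> is assumed invertible only for \<open>Md\<close>, whereas the cotrace in \<open>B\<close> may use
      another dual.\<close>
    have "cotr B T ShB M M' \<eta> \<epsilon> Q P f = cotr B T ShB M Md \<eta>\<^sub>0 \<epsilon>\<^sub>0 Q P f"
      by (rule B.cotr_indep[OF e d]) (fact QPf)+
    then show "phi F P \<cdot>\<^bsub>Z\<^esub> G2 F (cotr B T ShB M M' \<eta> \<epsilon> Q P f) =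
        cotr C Z ShC (F1 F M) N \<eta>' \<epsilon>' (F1 F Q) (F1 F P)
          (cL F P M \<cdot>\<^bsub>C\<^esub> F2 F f \<cdot>\<^bsub>C\<^esub> inv_ar C (cR F M Q)) \<cdot>\<^bsub>Z\<^esub> phi F Q"
      using phi_cotr[OF d c_iso i QPf cQ d'] by simp
  qed
qed

end
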